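(* There exists a polynomial time algorithm that, given an instance $(F\cup C,d)$ of the minimum size star cover problem with load parameter $T$ and any $\varepsilon\in(0,1)$, finds a star cover of load at most $(2+\varepsilon)T$ and size at most $O(\mathrm{OPT}_{\mathrm{MS}}/\varepsilon^2)$, where the constant hidden in the $O(\cdot)$ is absolute.
   Context: Let $F$ (facilities) and $C$ (clients) be finite sets and $(F\cup C,d)$ a finite metric space. A star is a pair $(f,C_f)$ with $f\in F$, $C_f\subseteq C$; two stars $(f,C_f),(g,C_g)$ are disjoint if $f\neq g$ and $C_f\cap C_g=\varnothing$. A star cover of $(F,C)$ is a finite collection $S$ of pairwise disjoint stars whose client sets cover $C$; its size is $|S|$. The load of a star $(f,C_f)$ is $\sum_{c\in C_f}d(f,c)$, and the load $L(S)$ of a star cover is the maximum load of its stars. In the minimum size star cover problem, given $(F\cup C,d)$ and $T\in\mathbb{R}_+$, one seeks a star cover of load at most $T$ of minimum size; $\mathrm{OPT}_{\mathrm{MS}}$ denotes this minimum size. *)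

theory Defs
  imports
    "HOL-Analysis.Abstract_Metric_Spaces"
    "HOL-Computational_Algebra.Polynomial"
    "HOL-Library.Log_Nat"
begin

section \<open>Star covers\<close>

type_synonym 'a star = "'a \<times> 'a set"

definition disjoint_stars :: "'a star \<Rightarrow> 'a star \<Rightarrow> bool" where
  "disjoint_stars s t \<longleftrightarrow> fst s \<noteq> fst t \<and> snd s \<inter> snd t = {}"

definition star_cover :: "'a set \<Rightarrow> 'a set \<Rightarrow> 'a star set \<Rightarrow> bool" where
  "star_cover F C S \<longleftrightarrow>
     finite S \<and>
     (\<forall>(f, A) \<in> S. f \<in> F \<and> A \<subseteq> C) \<and>
     pairwise disjoint_stars S \<and>
     C \<subseteq> (\<Union>(f, A) \<in> S. A)"

definition star_load :: "('a \<Rightarrow> 'a \<Rightarrow> real) \<Rightarrow> 'a star \<Rightarrow> real" where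
  "star_load d s = (\<Sum>c \<in> snd s. d (fst s) c)"

text \<open>Loads are nonnegative, so the maximum over the empty cover (which occurs only if there
  are no clients) is taken to be 0.\<close>

definition cover_load :: "('a \<Rightarrow> 'a \<Rightarrow> real) \<Rightarrow> 'a star set \<Rightarrow> real" where
  "cover_load d S = (if S = {} then 0 else Max (star_load d ` S))"

definition coverable :: "'a set \<Rightarrow> 'a set \<Rightarrow> ('a \<Rightarrow> 'a \<Rightarrow> real) \<Rightarrow> real \<Rightarrow> bool" where
  "coverable F C d T \<longleftrightarrow> (\<exists>S. star_cover F C S \<and> cover_load d S \<le> T)"

text \<open>Meaningful only if \<open>coverable F C d T\<close> holds.\<close>

definition OPT_MS :: "'a set \<Rightarrow> 'a set \<Rightarrow> ('a \<Rightarrow> 'a \<Rightarrow> real) \<Rightarrow> real \<Rightarrow> nat" where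
  "OPT_MS F C d T = (LEAST k. \<exists>S. star_cover F C S \<and> cover_load d S \<le> T \<and> card S = k)"


section \<open>Random access machine with logarithmic cost\<close>

text \<open>
  Programs are structured RAM programs over unbounded integers, with indirect addressing.
  Every operation is charged the bit length of its operands, including addresses. Under this cost
  measure (unlike under unit cost) running time is polynomially related to Turing machine time,
  even in the presence of multiplication and division.
\<close>

type_synonym memory = "int \<Rightarrow> int"

datatype binop = Add | Sub | Mul | Div

datatype expr = Const int | Mem expr | Bin binop expr expr

datatype com =
    Skip
  | Store expr expr
  | Seq com com
  | IfPos expr com com
  | WhilePos expr com

fun apply_op :: "binop \<Rightarrow> int \<Rightarrow> int \<Rightarrow> int" where
  "apply_op Add x y = x + y"
| "apply_op Sub x y = x - y"
| "apply_op Mul x y = x * y"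
| "apply_op Div x y = x div y"

fun val :: "memory \<Rightarrow> expr \<Rightarrow> int" where
  "val m (Const x) = x"
| "val m (Mem a) = m (val m a)"
| "val m (Bin p a b) = apply_op p (val m a) (val m b)"

text \<open>Binary length of the absolute value, plus one for the sign.\<close>

definition bits :: "int \<Rightarrow> nat" where
  "bits x = floorlog 2 (nat \<bar>x\<bar>) + 1"

fun cost :: "memory \<Rightarrow> expr \<Rightarrow> nat" where
  "cost m (Const x) = bits x"
| "cost m (Mem a) = cost m a + bits (val m a) + bits (m (val m a))"
| "cost m (Bin p a b) = cost m a + cost m b + bits (val m a) + bits (val m b)"

text \<open>\<open>exec A m t m'\<close>: started on memory \<open>m\<close>, program \<open>A\<close> halts with memory \<open>m'\<close> after time \<open>t\<close>.\<close>

inductive exec :: "com \<Rightarrow> memory \<Rightarrow> nat \<Rightarrow> memory \<Rightarrow> bool" where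
  Skip: "exec Skip m 1 m"
| Store: "exec (Store a e) m
     (1 + cost m a + cost m e + bits (val m a) + bits (val m e)) (m(val m a := val m e))"
| Seq: "exec A m t m' \<Longrightarrow> exec B m' u m'' \<Longrightarrow> exec (Seq A B) m (t + u) m''"
| IfTrue: "val m e > 0 \<Longrightarrow> exec A m t m' \<Longrightarrow> exec (IfPos e A B) m (1 + cost m e + t) m'"
| IfFalse: "\<not> val m e > 0 \<Longrightarrow> exec B m t m' \<Longrightarrow> exec (IfPos e A B) m (1 + cost m e + t) m'"
| WhileFalse: "\<not> val m e > 0 \<Longrightarrow> exec (WhilePos e A) m (1 + cost m e) m"
| WhileTrue: "val m e > 0 \<Longrightarrow> exec A m t m' \<Longrightarrow> exec (WhilePos e A) m' u m'' \<Longrightarrow>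
     exec (WhilePos e A) m (1 + cost m e + t + u) m''"

inductive_cases Skip_elim: "exec Skip m t m'"
inductive_cases Store_elim: "exec (Store a e) m t m'"
inductive_cases Seq_elim: "exec (Seq A B) m t m'"
inductive_cases If_elim: "exec (IfPos e A B) m t m'"
inductive_cases While_elim: "exec (WhilePos e A) m t m'"

lemma exec_deterministic:
  "exec A m t m' \<Longrightarrow> exec A m u m'' \<Longrightarrow> u = t \<and> m'' = m'"
proof (induction arbitrary: u m'' rule: exec.induct)
  case (Skip m)
  then show ?case by (auto elim: Skip_elim)
next
  case (Store a e m)
  then show ?case by (auto elim: Store_elim)
next
  case (Seq A m t m1 B v m2)
  from Seq.prems obtain t' v' m' where
    "exec A m t' m'" "exec B m' v' m''" "u = t' + v'" by (rule Seq_elim)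
  with Seq.IH show ?case by metis
next
  case (IfTrue m e A t m1 B)
  from IfTrue.prems obtain t' where "exec A m t' m''" "u = 1 + cost m e + t'"
    by (rule If_elim) (use IfTrue.hyps in simp_all)
  with IfTrue.IH show ?case by metis
next
  case (IfFalse m e B t m1 A)
  from IfFalse.prems obtain t' where "exec B m t' m''" "u = 1 + cost m e + t'"
    by (rule If_elim) (use IfFalse.hyps in simp_all)
  with IfFalse.IH show ?case by metis
next
  case (WhileFalse m e A)
  from WhileFalse.prems show ?case by (rule While_elim) (use WhileFalse.hyps in simp_all)
next
  case (WhileTrue m e A t m1 v m2)
  from WhileTrue.prems obtain t' v' m' where
    "exec A m t' m'" "exec (WhilePos e A) m' v' m''" "u = 1 + cost m e + t' + v'"
    by (rule While_elim) (use WhileTrue.hyps in simp_all)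
  with WhileTrue.IH show ?case by metis
qed

text \<open>The input occupies the cells 0, 1, ...; all other cells, in particular those with negative
  address, are initially 0.\<close>

definition input_memory :: "int list \<Rightarrow> memory" where
  "input_memory xs = (\<lambda>a. if 0 \<le> a \<and> a < int (length xs) then xs ! nat a else 0)"

definition input_size :: "int list \<Rightarrow> nat" where
  "input_size xs = (\<Sum>x\<leftarrow>xs. bits x)"

definition poly_time_on :: "com \<Rightarrow> int list set \<Rightarrow> bool" where
  "poly_time_on A X \<longleftrightarrow>
     (\<exists>p :: nat poly. \<forall>xs \<in> X. \<exists>t m. exec A (input_memory xs) t m \<and> t \<le> poly p (input_size xs))"


section \<open>Input and output of the minimum size star cover problem\<close>

text \<open>In the input of an algorithm the points are named 0, ..., n - 1 and all numbers are rational.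
  A point may be both a facility and a client.\<close>

definition real_dist :: "(nat \<Rightarrow> nat \<Rightarrow> rat) \<Rightarrow> nat \<Rightarrow> nat \<Rightarrow> real" where
  "real_dist d = (\<lambda>u v. real_of_rat (d u v))"

definition ms_instance :: "nat set \<Rightarrow> nat set \<Rightarrow> (nat \<Rightarrow> nat \<Rightarrow> rat) \<Rightarrow> rat \<Rightarrow> bool" where
  "ms_instance F C d T \<longleftrightarrow>
     (\<exists>n. F \<union> C = {..<n}) \<and> Metric_space (F \<union> C) (real_dist d) \<and> T \<ge> 0"

definition enc_rat :: "rat \<Rightarrow> int list" where
  "enc_rat q = [fst (quotient_of q), snd (quotient_of q)]"

definition enc_input ::
    "nat set \<Rightarrow> nat set \<Rightarrow> (nat \<Rightarrow> nat \<Rightarrow> rat) \<Rightarrow> rat \<Rightarrow> rat \<Rightarrow> int list" where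
  "enc_input F C d T \<epsilon> = (let n = card (F \<union> C) in
     [int n] @ enc_rat T @ enc_rat \<epsilon> @
     map (\<lambda>v. of_bool (v \<in> F)) [0..<n] @
     map (\<lambda>v. of_bool (v \<in> C)) [0..<n] @
     concat (map (\<lambda>u. concat (map (\<lambda>v. enc_rat (d u v)) [0..<n])) [0..<n]))"

text \<open>A collection of stars is output as the number of stars followed by, for each star, its
  facility, the number of its clients, and the list of its clients.\<close>

definition enc_stars :: "(nat \<times> nat list) list \<Rightarrow> int list" where
  "enc_stars ss = int (length ss) #
     concat (map (\<lambda>(f, cs). int f # int (length cs) # map int cs) ss)"

definition outputs_stars :: "com \<Rightarrow> int list \<Rightarrow> nat star set \<Rightarrow> bool" where
  "outputs_stars A xs S \<longleftrightarrow>
     (\<exists>t m ss. exec A (input_memory xs) t m \<and>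
        (\<forall>i < length (enc_stars ss). m (int i) = enc_stars ss ! i) \<and>
        S = (\<lambda>(f, cs). (f, set cs)) ` set ss)"

end

theory Submission
  imports Defs
begin

text \<open>
  An auction assigns the clients. Every facility has an integer price, initially 2. An unassigned
  client joins the facility within distance \<open>T\<close> that minimizes price times distance; a facility of
  load more than \<open>2T\<close> evicts a client that joined at a lower price, or raises its price by 1 if
  there is none. Once its price has been raised, a facility keeps a load of at least \<open>T\<close>, so that
  price minus 2 is a nearly optimal dual variable for its capacity. Therefore the prices stay below
  \<open>2 OPT + 2\<close>, the auction ends after polynomially many bids, and the assignment has total load at
  most \<open>2T OPT\<close> and load at most \<open>2T\<close> per facility.

  The facilities in use may be far too many. The uncapacitated facility location algorithm of Mettu
  and Plaxton opens at most \<open>7 OPT\<close> of them such that the distances of all clients' facilities to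
  the open ones sum up to at most \<open>20T OPT\<close>. Around each open facility, the facilities in use are
  packed, in the order of their distance to it, into groups that can be served by their first member
  with load at most \<open>2T\<close>. Every group but one per open facility has mass more than \<open>T\<close>, so there
  are at most \<open>63 OPT\<close> groups. Hence load \<open>2T\<close> and size \<open>O(OPT)\<close> are achieved for every \<open>\<epsilon>\<close>.
\<close>

section \<open>A loop language and its compilation to the machine\<close>

text \<open>On a machine that charges bit lengths, all stored numbers must stay short. So distances
  and \<open>T\<close> are multiplied by a common denominator, prices are small integers, and every
  loop bound is a function of the number of points. The only rounding left is that of the radii to
  integers. An extra factor \<open>2 * n + 1\<close> in the common denominator makes a positive
  threshold at least \<open>2 * n\<close>, so that rounding costs a ball at most half of its budget
  \<open>T\<close>.

  Origin of the constants, with k the number of facilities of an optimal cover: the auction's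
  assignment costs at most 2kT and the optimal one kT, so, summed over the clients, the facilities
  in use are within 3kT of the optimal ones. Disjoint balls give k + 2 * 3k = 7k open facilities;
  charging inside the cells of the optimal facilities gives the connection cost 6 * 3kT + 2kT =
  20kT. Serving a client from its group's first member adds at most twice the distance from its
  facility to the open one, so the total mass is at most 2kT + 2 * 20kT = 42kT. Each group is paid
  by mass \<open>T\<close>, up to an allowance of at most 3T per open facility: 42k + 3 * 7k = 63k
  groups.\<close>

datatype name =
    IO | Size | Thr | IsFac | IsCli | Dist | Den | Tmp
  | Price | Fac | Paid | Load | Client | Cand | Kick
  | Key | Opened | Nearest | Mass | Acc | Lead | Final | Todo | Best | Hit
  | Sum | Cnt | Pos | Stars | I0 | I1 | I2

fun name_code :: "name \<Rightarrow> int" where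
  "name_code IO = 1" | "name_code Size = 2" | "name_code Thr = 3" | "name_code IsFac = 4"
| "name_code IsCli = 5" | "name_code Dist = 6" | "name_code Den = 7" | "name_code Tmp = 8"
| "name_code Price = 9" | "name_code Fac = 10" | "name_code Paid = 11" | "name_code Load = 12"
| "name_code Client = 13" | "name_code Cand = 14" | "name_code Kick = 15" | "name_code Key = 16"
| "name_code Opened = 17" | "name_code Nearest = 18" | "name_code Mass = 19" | "name_code Acc = 20"
| "name_code Lead = 21" | "name_code Final = 22" | "name_code Todo = 23" | "name_code Best = 24"
| "name_code Hit = 25" | "name_code Sum = 26" | "name_code Cnt = 27" | "name_code Pos = 28"
| "name_code Stars = 29" | "name_code I0 = 30" | "name_code I1 = 31" | "name_code I2 = 32"

lemma name_code_range: "0 < name_code x \<and> name_code x < 64"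
  by (cases x) auto

lemma name_code_inject: "name_code x = name_code y \<longleftrightarrow> x = y"
  by (cases x; cases y; simp)

type_synonym state = "name \<Rightarrow> int \<Rightarrow> int"

datatype ex = Lit int | Arr name ex | Op binop ex ex

abbreviation V :: "name \<Rightarrow> ex" where "V x \<equiv> Arr x (Lit 0)"

fun ev :: "state \<Rightarrow> ex \<Rightarrow> int" where
  "ev s (Lit k) = k"
| "ev s (Arr x e) = s x (ev s e)"
| "ev s (Op p a b) = apply_op p (ev s a) (ev s b)"

fun names :: "ex \<Rightarrow> name set" where
  "names (Lit k) = {}"
| "names (Arr x e) = insert x (names e)"
| "names (Op p a b) = names a \<union> names b"

text \<open>In a well-formed program \<open>Scale\<close> is the only way to read \<open>IO\<close>
  and \<open>Out\<close> the only way to write it. All loops are counted, so a bound on the number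
  of steps can be read off the syntax.\<close>

datatype cm =
    Pass
  | Put name ex ex
  | Scale name ex ex ex
  | Out ex ex
  | Then cm cm
  | Cond ex cm cm
  | For name ex cm

definition upd :: "state \<Rightarrow> name \<Rightarrow> int \<Rightarrow> int \<Rightarrow> state" where
  "upd s x i v = s(x := (s x)(i := v))"

lemma upd_apply: "upd s x i v y = (if y = x then (s x)(i := v) else s y)"
  by (simp add: upd_def)

text \<open>\<open>Scale x i e a\<close> assigns \<open>e * IO[a]\<close> to \<open>x[i]\<close>; it is the only assignment that may multiply.
  As long as the input is intact, it lengthens numbers by at most the length of an input number.\<close>

fun run :: "cm \<Rightarrow> state \<Rightarrow> state" where
  "run Pass s = s"
| "run (Put x i e) s = upd s x (ev s i) (ev s e)"
| "run (Scale x i e a) s =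
     (if 0 \<le> ev s a then upd s x (ev s i) (ev s e * s IO (ev s a)) else s)"
| "run (Out a e) s = (if 0 \<le> ev s a then upd s IO (ev s a) (ev s e) else s)"
| "run (Then c d) s = run d (run c s)"
| "run (Cond e c d) s = (if 0 < ev s e then run c s else run d s)"
| "run (For x e c) s =
     ((\<lambda>s. upd (run c s) x 0 (run c s x 0 + 1)) ^^ nat (ev s e)) (upd s x 0 0)"

fun mods :: "cm \<Rightarrow> name set" where
  "mods Pass = {}"
| "mods (Put x i e) = {x}"
| "mods (Scale x i e a) = {x}"
| "mods (Out a e) = {IO}"
| "mods (Then c d) = mods c \<union> mods d"
| "mods (Cond e c d) = mods c \<union> mods d"
| "mods (For x e c) = insert x (mods c)"

fun scales :: "cm \<Rightarrow> bool" where
  "scales (Scale x i e a) = True"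
| "scales (Then c d) = (scales c \<or> scales d)"
| "scales (Cond e c d) = (scales c \<or> scales d)"
| "scales (For x e c) = scales c"
| "scales _ = False"

text \<open>The values that may be stored: evaluating them lengthens numbers by at most a constant
  number of bits. The divisor is arbitrary because a quotient is never longer than its dividend, and
  an array index is arbitrary because only the content of the cell is the value. Products remain
  possible in tests, indices and loop bounds, which are not stored.\<close>

fun linear :: "ex \<Rightarrow> bool" where
  "linear (Lit k) = True"
| "linear (Arr x e) = True"
| "linear (Op Add a b) = (linear a \<and> linear b)"
| "linear (Op Sub a b) = (linear a \<and> linear b)"
| "linear (Op Mul a b) = False"
| "linear (Op Div a b) = linear a"

fun bounds :: "cm \<Rightarrow> ex set" where
  "bounds (Then c d) = bounds c \<union> bounds d"
| "bounds (Cond e c d) = bounds c \<union> bounds d"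
| "bounds (For x e c) = insert e (bounds c)"
| "bounds _ = {}"

text \<open>Loop bounds depend on \<open>Size\<close> alone, which loop bodies leave unchanged, so a
  bound keeps its value while the loop runs. Expressions must not mention \<open>IO\<close>, because
  the compilation of \<open>Arr\<close> uses the address layout of the other arrays.\<close>

fun well_formed :: "cm \<Rightarrow> bool" where
  "well_formed Pass = True"
| "well_formed (Put x i e) = (x \<noteq> IO \<and> IO \<notin> names i \<and> IO \<notin> names e \<and> linear e)"
| "well_formed (Scale x i e a) =
     (x \<noteq> IO \<and> IO \<notin> names i \<and> IO \<notin> names e \<and> IO \<notin> names a \<and> linear e)"
| "well_formed (Out a e) = (IO \<notin> names a \<and> IO \<notin> names e \<and> linear e)"
| "well_formed (Then c d) = (well_formed c \<and> well_formed d)"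
| "well_formed (Cond e c d) = (IO \<notin> names e \<and> well_formed c \<and> well_formed d)"
| "well_formed (For x e c) =
     (x \<noteq> IO \<and> x \<noteq> Size \<and> x \<notin> mods c \<and> Size \<notin> mods c \<and> names e \<subseteq> {Size} \<and> well_formed c)"

lemma ev_cong: "(\<And>x. x \<in> names e \<Longrightarrow> s x = s' x) \<Longrightarrow> ev s e = ev s' e"
  by (induction e) auto

lemma run_unmodified: "x \<notin> mods c \<Longrightarrow> run c s x = s x"
proof (induction c arbitrary: s)
  case (For y e c)
  have "((\<lambda>s. upd (run c s) y 0 (run c s y 0 + 1)) ^^ k) s' x = s' x" for k s'
    using For by (induction k) (auto simp: upd_apply)
  with For.prems show ?case by (simp add: upd_apply run.simps(7))
qed (auto simp: upd_apply)

text \<open>The invariant rule for counted loops. The induction also carries the counter value and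
  the frame of unmodified names, so that users of the rule get both for free in
  \<open>step\<close>.\<close>

lemma run_For_induct:
  assumes step: "\<And>i s. 0 \<le> i \<Longrightarrow> i < b \<Longrightarrow> s x 0 = i \<Longrightarrow> Q i s \<Longrightarrow>
      (\<And>y. y \<noteq> x \<Longrightarrow> y \<notin> mods c \<Longrightarrow> s y = s0 y) \<Longrightarrow> Q (i + 1) (upd (run c s) x 0 (i + 1))"
    and init: "Q 0 (upd s0 x 0 0)" and x: "x \<notin> mods c" and b: "ev s0 e = b" "0 \<le> b"
  shows "Q b (run (For x e c) s0)"
proof -
  define f where "f = (\<lambda>s. upd (run c s) x 0 (run c s x 0 + 1))"
  have "int k \<le> b \<Longrightarrow> Q (int k) ((f ^^ k) (upd s0 x 0 0)) \<and> (f ^^ k) (upd s0 x 0 0) x 0 = int k \<and>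
     (\<forall>y. y \<noteq> x \<longrightarrow> y \<notin> mods c \<longrightarrow> (f ^^ k) (upd s0 x 0 0) y = s0 y)" for k
  proof (induction k)
    case 0
    have "upd s0 x 0 0 x 0 = 0" "\<And>y. y \<noteq> x \<Longrightarrow> upd s0 x 0 0 y = s0 y"
      by (simp_all add: upd_apply)
    then show ?case using init by simp
  next
    case (Suc k)
    define s where "s = (f ^^ k) (upd s0 x 0 0)"
    have s: "Q (int k) s" "s x 0 = int k" "\<And>y. y \<noteq> x \<Longrightarrow> y \<notin> mods c \<Longrightarrow> s y = s0 y"
      using Suc by (auto simp: s_def)
    have "Q (int k + 1) (upd (run c s) x 0 (int k + 1))"
      using Suc.prems s by (intro step) auto
    moreover have "run c s x 0 = int k" using s(2) x by (simp add: run_unmodified)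
    ultimately have "Q (int k + 1) (f s) \<and> f s x 0 = int k + 1 \<and>
        (\<forall>y. y \<noteq> x \<longrightarrow> y \<notin> mods c \<longrightarrow> f s y = s0 y)"
      using s(3) by (simp add: f_def upd_apply run_unmodified)
    then show ?case by (simp add: s_def add.commute)
  qed
  from this[of "nat b"] b show ?thesis by (simp add: f_def run.simps(7))
qed


declare run.simps(7) [simp del]

subsection \<open>Bit lengths\<close>

lemma bits_le_iff: "bits x \<le> Suc k \<longleftrightarrow> \<bar>x\<bar> < 2 ^ k"
proof -
  have "nat \<bar>x\<bar> < 2 ^ k \<longleftrightarrow> \<bar>x\<bar> < 2 ^ k"
    by (metis abs_ge_zero nat_less_iff of_nat_numeral of_nat_power)
  then show ?thesis by (simp add: bits_def floorlog_le_iff)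
qed

lemma bits_pos: "0 < bits x"
  by (simp add: bits_def)

lemma bits_bound: "\<bar>x\<bar> < 2 ^ (bits x - 1)"
  using bits_le_iff[of x "bits x - 1"] bits_pos[of x] by simp

lemma bits_mono: "\<bar>x\<bar> \<le> \<bar>y\<bar> \<Longrightarrow> bits x \<le> bits y"
  unfolding bits_def by (intro add_right_mono floorlog_mono nat_mono)

lemma bits_add_sub:
  assumes "bits x \<le> k" "bits y \<le> k"
  shows "bits (x + y) \<le> Suc k" "bits (x - y) \<le> Suc k"
proof -
  obtain j where k: "k = Suc j" using assms bits_pos[of x] by (cases k) auto
  then have "\<bar>x\<bar> < 2 ^ j" "\<bar>y\<bar> < 2 ^ j" using assms by (simp_all add: bits_le_iff)
  then have "\<bar>x + y\<bar> < 2 ^ k" "\<bar>x - y\<bar> < 2 ^ k" unfolding k by auto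
  then show "bits (x + y) \<le> Suc k" "bits (x - y) \<le> Suc k" by (simp_all add: bits_le_iff)
qed

lemma bits_mult: "bits (x * y) \<le> bits x + bits y"
proof -
  have "\<bar>x\<bar> * \<bar>y\<bar> \<le> 2 ^ (bits x - 1) * 2 ^ (bits y - 1)"
    using bits_bound[of x] bits_bound[of y] by (intro mult_mono) auto
  also have "\<dots> = 2 ^ (bits x - 1 + (bits y - 1))" by (simp add: power_add)
  also have "\<dots> < (2::int) ^ (bits x + bits y - 1)"
    using bits_pos[of x] bits_pos[of y] by (intro power_strict_increasing) auto
  finally show ?thesis
    using bits_le_iff[of "x * y" "bits x + bits y - 1"] bits_pos[of x] by (simp add: abs_mult)
qed

lemma bits_div: "bits (x div y) \<le> bits x"
proof (rule bits_mono)
  have *: "\<bar>a div b\<bar> \<le> \<bar>a\<bar>" if "0 < b" for a b :: int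
  proof (cases "0 \<le> a")
    case True
    then show ?thesis using that zdiv_mono2[of a 1 b] by (simp add: pos_imp_zdiv_nonneg_iff)
  next
    case False
    then show ?thesis using that zdiv_mono2_neg[of a 1 b] neg_imp_zdiv_neg_iff
      pos_imp_zdiv_neg_iff[of b a] by simp
  qed
  show "\<bar>x div y\<bar> \<le> \<bar>x\<bar>"
    using *[of y x] *[of "- y" "- x"] by (cases y "0::int" rule: linorder_cases) auto
qed


subsection \<open>Correctness and running time of the compiled program\<close>

text \<open>The polynomial \<open>2 * i\<^sup>2 + i\<close> is injective on the integers with nonnegative values, so distinct
  array cells never collide, whatever their indices, and only the array \<open>IO\<close> lives at nonnegative
  addresses.\<close>

definition addr :: "name \<Rightarrow> int \<Rightarrow> int" where
  "addr x i = - name_code x - 64 * (i * (2 * i + 1))"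

lemma addr_inject: "addr x i = addr y j \<longleftrightarrow> x = y \<and> i = j"
proof
  assume eq: "addr x i = addr y j"
  define p q where "p = i * (2 * i + 1)" and "q = j * (2 * j + 1)"
  have e: "name_code x + 64 * p = name_code y + 64 * q"
    using eq by (simp add: addr_def p_def q_def)
  \<comment> \<open>Name codes lie strictly between 0 and 64, so the residue modulo 64 recovers the
    name.\<close>
  have "name_code x = (name_code x + 64 * p) mod 64" using name_code_range[of x] by simp
  also have "\<dots> = name_code y" unfolding e using name_code_range[of y] by simp
  finally have c: "name_code x = name_code y" .
  with e have "p = q" by simp
  \<comment> \<open>The difference of the two polynomial values factors, and the second factor is
    odd, hence nonzero.\<close>
  then have "(i - j) * (2 * (i + j) + 1) = 0" by (simp add: p_def q_def algebra_simps)
  moreover have "2 * (i + j) + 1 \<noteq> 0" by presburger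
  ultimately show "x = y \<and> i = j" using c by (simp add: name_code_inject)
qed simp

lemma addr_neg: "addr x i < 0"
proof -
  have "0 \<le> i * (2 * i + 1)" by (cases "0 \<le> i") (auto intro: mult_nonpos_nonpos)
  then show ?thesis using name_code_range[of x] by (simp add: addr_def)
qed

text \<open>Negative addresses belong to the other arrays, so negative indices of \<open>IO\<close>
  are masked; otherwise a store to one array would be visible in another.\<close>

definition view :: "memory \<Rightarrow> state" where
  "view m x i = (if x = IO then if 0 \<le> i then m i else 0 else m (addr x i))"

lemma view_store: "x \<noteq> IO \<Longrightarrow> view (m(addr x i := v)) = upd (view m) x i v"
  using addr_neg[of x i] by (auto simp: fun_eq_iff view_def upd_def addr_inject)

lemma view_store_IO: "0 \<le> i \<Longrightarrow> view (m(i := v)) = upd (view m) IO i v"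
  by (auto simp: fun_eq_iff view_def upd_def) (metis addr_neg not_le)

definition address :: "name \<Rightarrow> expr \<Rightarrow> expr" where
  "address x e = Bin Sub (Const (- name_code x))
     (Bin Mul (Const 64) (Bin Mul e (Bin Add (Bin Mul (Const 2) e) (Const 1))))"

fun comp_ex :: "ex \<Rightarrow> expr" where
  "comp_ex (Lit k) = Const k"
| "comp_ex (Arr x e) = Mem (address x (comp_ex e))"
| "comp_ex (Op p a b) = Bin p (comp_ex a) (comp_ex b)"

lemma val_address: "val m (address x e) = addr x (val m e)"
  by (simp add: addr_def address_def)

lemma val_comp_ex: "IO \<notin> names e \<Longrightarrow> val m (comp_ex e) = ev (view m) e"
  by (induction e) (auto simp: val_address view_def)


text \<open>The guards of \<open>Scale\<close> and \<open>Out\<close> add 1 because the machine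
  tests for positivity and the guard is nonnegativity.\<close>

fun compile :: "cm \<Rightarrow> com" where
  "compile Pass = Skip"
| "compile (Put x i e) = Store (address x (comp_ex i)) (comp_ex e)"
| "compile (Scale x i e a) = IfPos (Bin Add (comp_ex a) (Const 1))
     (Store (address x (comp_ex i)) (Bin Mul (comp_ex e) (Mem (comp_ex a)))) Skip"
| "compile (Out a e) = IfPos (Bin Add (comp_ex a) (Const 1)) (Store (comp_ex a) (comp_ex e)) Skip"
| "compile (Then c d) = Seq (compile c) (compile d)"
| "compile (Cond e c d) = IfPos (comp_ex e) (compile c) (compile d)"
| "compile (For x e c) = Seq (Store (address x (Const 0)) (Const 0))
     (WhilePos (Bin Sub (comp_ex e) (comp_ex (V x)))
       (Seq (compile c) (Store (address x (Const 0)) (Bin Add (comp_ex (V x)) (Const 1)))))"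

definition bounded :: "nat \<Rightarrow> memory \<Rightarrow> bool" where
  "bounded b m \<longleftrightarrow> (\<forall>a. bits (m a) \<le> b)"

text \<open>If all cells have at most \<open>b\<close> bits, then \<open>width e * (b + 1)\<close>
  bounds the length of the value of \<open>e\<close>, and \<open>weight e * (b + 1)\<close> bounds
  the cost of evaluating it. A memory access has width 1, however long its address.\<close>

fun width :: "expr \<Rightarrow> nat" where
  "width (Const k) = bits k"
| "width (Mem a) = 1"
| "width (Bin p a b) = width a + width b + 1"

fun weight :: "expr \<Rightarrow> nat" where
  "weight (Const k) = bits k"
| "weight (Mem a) = weight a + width a + 1"
| "weight (Bin p a b) = weight a + weight b + width a + width b"

fun com_weight :: "com \<Rightarrow> nat" where
  "com_weight Skip = 1"
| "com_weight (Store a e) = 1 + weight a + weight e + width a + width e"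
| "com_weight (Seq c d) = com_weight c + com_weight d"
| "com_weight (IfPos e c d) = 1 + weight e + com_weight c + com_weight d"
| "com_weight (WhilePos e c) = 1 + weight e + com_weight c"

text \<open>The number of bits by which the value of a linear expression can exceed the longest
  cell.\<close>

fun slack :: "ex \<Rightarrow> nat" where
  "slack (Lit k) = bits k"
| "slack (Arr x e) = 0"
| "slack (Op p a b) = slack a + slack b + 1"

fun growth :: "cm \<Rightarrow> nat" where
  "growth Pass = 0"
| "growth (Put x i e) = slack e"
| "growth (Scale x i e a) = slack e"
| "growth (Out a e) = slack e"
| "growth (Then c d) = growth c + growth d"
| "growth (Cond e c d) = growth c + growth d"
| "growth (For x e c) = growth c + slack (Op Add (V x) (Lit 1)) + bits 0"

text \<open>An upper bound on the number of tests, stores and skips if no loop bound exceeds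
  \<open>M\<close>. Both branches of a conditional are counted, which keeps the bound independent of
  the state.\<close>

fun steps :: "nat \<Rightarrow> cm \<Rightarrow> nat" where
  "steps M Pass = 1"
| "steps M (Put x i e) = 1"
| "steps M (Scale x i e a) = 2"
| "steps M (Out a e) = 2"
| "steps M (Then c d) = steps M c + steps M d"
| "steps M (Cond e c d) = 1 + steps M c + steps M d"
| "steps M (For x e c) = 2 + M * (steps M c + 2)"

lemma bits_apply_op: "bits (apply_op p x y) \<le> bits x + bits y + 1"
proof (cases p)
  case Add
  then show ?thesis using bits_add_sub(1)[of x "bits x + bits y" y] by simp
next
  case Sub
  then show ?thesis using bits_add_sub(2)[of x "bits x + bits y" y] by simp
next
  case Mul
  then show ?thesis using bits_mult[of x y] by simp
next
  case Div
  then show ?thesis using bits_div[of x y] by simp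
qed

lemma bits_val: "bounded b m \<Longrightarrow> bits (val m e) \<le> width e * (b + 1)"
proof (induction e)
  case (Mem a)
  then show ?case by (simp add: bounded_def le_SucI)
next
  case (Bin p x y)
  then show ?case
    using bits_apply_op[of p "val m x" "val m y"] by (simp add: algebra_simps)
qed simp

lemma cost_le: "bounded b m \<Longrightarrow> cost m e \<le> weight e * (b + 1)"
proof (induction e)
  case (Mem a)
  then have "bits (m (val m a)) \<le> b" by (simp add: bounded_def)
  with Mem show ?case using bits_val[of b m a] by (simp add: algebra_simps)
next
  case (Bin p x y)
  then show ?case
    using bits_val[of b m x] bits_val[of b m y] by (simp add: algebra_simps)
qed simp

lemma bits_linear:
  "linear e \<Longrightarrow> IO \<notin> names e \<Longrightarrow> bounded b m \<Longrightarrow> bits (ev (view m) e) \<le> b + slack e"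
proof (induction e rule: linear.induct)
  case (3 x y)
  then show ?case
    using bits_add_sub(1)[of "ev (view m) x" "b + slack x + slack y" "ev (view m) y"] by simp
next
  case (4 x y)
  then show ?case
    using bits_add_sub(2)[of "ev (view m) x" "b + slack x + slack y" "ev (view m) y"] by simp
next
  case (6 x y)
  then show ?case using bits_div[of "ev (view m) x" "ev (view m) y"] by simp
qed (auto simp: bounded_def view_def)

text \<open>Each of the \<open>k\<close> steps lengthens numbers by at most \<open>D\<close> bits
  and costs at most \<open>w\<close> times the final length. The quantifier over \<open>b\<close> is
  inside, so that a second program can be measured from the length that the first one leaves
  behind.\<close>

definition timed :: "nat \<Rightarrow> nat \<Rightarrow> com \<Rightarrow> nat \<Rightarrow> memory \<Rightarrow> memory \<Rightarrow> bool" where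
  "timed D w c k m m' \<longleftrightarrow> (\<exists>t. exec c m t m' \<and>
     (\<forall>b. bounded b m \<longrightarrow> bounded (b + k * D) m' \<and> t \<le> k * w * (b + k * D + 1)))"

lemma timed_Skip: "1 \<le> w \<Longrightarrow> timed D w Skip 1 m m"
  using exec.Skip[of m] by (auto simp: timed_def bounded_def intro!: exI[of _ 1] trans_le_add1)

lemma timed_Store:
  assumes growth: "\<And>b. bounded b m \<Longrightarrow> bits (val m e) \<le> b + D"
    and w: "com_weight (Store a e) \<le> w"
  shows "timed D w (Store a e) 1 m (m(val m a := val m e))"
  unfolding timed_def
proof (intro exI conjI allI impI)
  fix b assume b: "bounded b m"
  show "bounded (b + 1 * D) (m(val m a := val m e))"
    using growth[OF b] b by (auto simp: bounded_def trans_le_add1)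
  have "1 + cost m a + cost m e + bits (val m a) + bits (val m e) \<le>
      com_weight (Store a e) * (b + 1)"
    using cost_le[OF b, of a] cost_le[OF b, of e] bits_val[OF b, of a] bits_val[OF b, of e]
    by (simp add: algebra_simps)
  also have "\<dots> \<le> w * (b + D + 1)" using w by (intro mult_mono) auto
  finally show "1 + cost m a + cost m e + bits (val m a) + bits (val m e) \<le> 1 * w * (b + 1 * D + 1)"
    by simp
qed (rule exec.Store)

lemma timed_Seq:
  assumes "timed D w c k m m1" "timed D w d l m1 m2"
  shows "timed D w (Seq c d) (k + l) m m2"
proof -
  obtain t u where t: "exec c m t m1"
      "\<And>b. bounded b m \<Longrightarrow> bounded (b + k * D) m1 \<and> t \<le> k * w * (b + k * D + 1)"
    and u: "exec d m1 u m2"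
      "\<And>b. bounded b m1 \<Longrightarrow> bounded (b + l * D) m2 \<and> u \<le> l * w * (b + l * D + 1)"
    using assms unfolding timed_def by blast
  show ?thesis unfolding timed_def
  proof (intro exI conjI allI impI)
    show "exec (Seq c d) m (t + u) m2" using t(1) u(1) by (rule exec.Seq)
    fix b assume b: "bounded b m"
    show "bounded (b + (k + l) * D) m2"
      using t(2)[OF b] u(2) by (fastforce simp: algebra_simps)
    have "t \<le> k * w * (b + (k + l) * D + 1)"
      using t(2)[OF b] by (elim conjE order_trans) (intro mult_left_mono, auto simp: algebra_simps)
    moreover have "u \<le> l * w * (b + (k + l) * D + 1)"
      using u(2)[of "b + k * D"] t(2)[OF b] by (simp add: algebra_simps)
    ultimately show "t + u \<le> (k + l) * w * (b + (k + l) * D + 1)"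
      by (simp add: algebra_simps)
  qed
qed

text \<open>Shared by conditionals and loop iterations: a test stores nothing and counts as one
  step.\<close>

lemma timed_test:
  assumes "timed D w c k m m'" "1 + weight e \<le> w"
    and "\<And>t. exec c m t m' \<Longrightarrow> exec d m (1 + cost m e + t) m'"
  shows "timed D w d (k + 1) m m'"
proof -
  obtain t where t: "exec c m t m'"
      "\<And>b. bounded b m \<Longrightarrow> bounded (b + k * D) m' \<and> t \<le> k * w * (b + k * D + 1)"
    using assms unfolding timed_def by blast
  show ?thesis unfolding timed_def
  proof (intro exI conjI allI impI)
    show "exec d m (1 + cost m e + t) m'" using t(1) by (rule assms(3))
    fix b assume b: "bounded b m"
    show "bounded (b + (k + 1) * D) m'"
      using t(2)[OF b] by (auto simp: bounded_def add.assoc trans_le_add2 intro: order_trans)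
    have "t \<le> k * w * (b + (k + 1) * D + 1)"
      using t(2)[OF b] by (elim conjE order_trans) (intro mult_left_mono, auto simp: algebra_simps)
    moreover have "1 + cost m e \<le> (1 + weight e) * (b + (k + 1) * D + 1)"
      using cost_le[OF b, of e] by (simp add: algebra_simps trans_le_add1)
    moreover have "\<dots> \<le> w * (b + (k + 1) * D + 1)" using assms(2) by (intro mult_right_mono) auto
    ultimately show "1 + cost m e + t \<le> (k + 1) * w * (b + (k + 1) * D + 1)"
      by (simp add: algebra_simps)
  qed
qed

lemma timed_If:
  assumes "timed D w (if 0 < val m e then c else d) k m m'" "1 + weight e \<le> w"
  shows "timed D w (IfPos e c d) (k + 1) m m'"
  using assms
proof (rule timed_test)
  fix t assume "exec (if 0 < val m e then c else d) m t m'"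
  then show "exec (IfPos e c d) m (1 + cost m e + t) m'"
    by (cases "0 < val m e") (auto intro: exec.IfTrue[simplified] exec.IfFalse[simplified])
qed

lemma timed_mono:
  assumes "timed D w c k m m'" "k \<le> l"
  shows "timed D w c l m m'"
proof -
  obtain t where t: "exec c m t m'"
      "\<And>b. bounded b m \<Longrightarrow> bounded (b + k * D) m' \<and> t \<le> k * w * (b + k * D + 1)"
    using assms unfolding timed_def by blast
  show ?thesis unfolding timed_def
  proof (intro exI conjI allI impI)
    show "exec c m t m'" by fact
    fix b assume b: "bounded b m"
    have *: "b + k * D \<le> b + l * D" using assms(2) by simp
    then show "bounded (b + l * D) m'"
      using t(2)[OF b] unfolding bounded_def by (meson order_trans)
    have "k * w * (b + k * D + 1) \<le> l * w * (b + l * D + 1)"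
      using assms(2) * by (intro mult_mono) auto
    then show "t \<le> l * w * (b + l * D + 1)" using t(2)[OF b] by linarith
  qed
qed

lemma bounds_names: "well_formed c \<Longrightarrow> e \<in> bounds c \<Longrightarrow> names e \<subseteq> {Size}"
  by (induction c) auto

lemma linear_growth:
  assumes "linear e" "IO \<notin> names e" "slack e \<le> D" "bounded b m"
  shows "bits (val m (comp_ex e)) \<le> b + D"
  using bits_linear[OF assms(1,2,4)] assms(2,3) by (simp add: val_comp_ex)

text \<open>Time and length bounds add up along the structure of the program. Multiplication by an
  input cell is harmless only while the input is intact and the length budget \<open>D\<close>
  covers every cell at a nonnegative address; hence the premise on \<open>scales\<close>. A loop
  needs an unchanged \<open>Size\<close>, since its bound is evaluated again before each
  iteration.\<close>

theorem compile_correct: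
  assumes "well_formed c" "bounds c \<noteq> {} \<Longrightarrow> Size \<notin> mods c" "com_weight (compile c) \<le> w" "growth c \<le> D"
    and "scales c \<Longrightarrow> IO \<notin> mods c \<and> (\<forall>a\<ge>0. growth c + bits (m a) \<le> D)"
    and "\<And>e. e \<in> bounds c \<Longrightarrow> ev (view m) e \<le> int M"
  shows "\<exists>m'. timed D w (compile c) (steps M c) m m' \<and> view m' = run c (view m)"
  using assms
proof (induction c arbitrary: m)
  case Pass
  then show ?case using timed_Skip[of w D m] by auto
next
  case (Put x i e)
  then show ?case
    using timed_Store[of m "comp_ex e" D "address x (comp_ex i)" w] linear_growth[of e D _ m]
    by (intro exI conjI) (auto simp: val_address view_store val_comp_ex)
next
  case (Scale x i e a)
  show ?case
  proof (cases "0 \<le> ev (view m) a")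
    case True
    let ?d = "Store (address x (comp_ex i)) (Bin Mul (comp_ex e) (Mem (comp_ex a)))"
    have v: "val m (comp_ex a) = ev (view m) a" "val m (comp_ex e) = ev (view m) e"
      "val m (comp_ex i) = ev (view m) i"
      using Scale.prems by (simp_all add: val_comp_ex)
    have "bits (val m (Bin Mul (comp_ex e) (Mem (comp_ex a)))) \<le> b + D" if "bounded b m" for b
      using bits_mult[of "ev (view m) e" "m (ev (view m) a)"] bits_linear[of e b m] that
        Scale.prems True by (fastforce simp: v)
    from timed_Store[OF this, of "address x (comp_ex i)" w]
    have "timed D w ?d 1 m (m(val m (address x (comp_ex i)) :=
        val m (Bin Mul (comp_ex e) (Mem (comp_ex a)))))"
      using Scale.prems by simp
    then have "timed D w (compile (Scale x i e a)) (1 + 1) m (m(val m (address x (comp_ex i)) :=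
        val m (Bin Mul (comp_ex e) (Mem (comp_ex a)))))"
      using Scale.prems True
      unfolding compile.simps by (intro timed_If) (auto simp: v)
    then show ?thesis using Scale.prems True
      by (intro exI conjI)
        (auto simp: val_address view_store v numeral_2_eq_2 view_def[of m IO])
  next
    case False
    have "timed D w (compile (Scale x i e a)) (1 + 1) m m"
      using Scale.prems False timed_Skip[of w D m]
      unfolding compile.simps by (intro timed_If) (auto simp: val_comp_ex)
    then show ?thesis using False by (auto simp: numeral_2_eq_2)
  qed
next
  case (Out a e)
  have v: "val m (comp_ex a) = ev (view m) a" "val m (comp_ex e) = ev (view m) e"
    using Out.prems by (simp_all add: val_comp_ex)
  show ?case
  proof (cases "0 \<le> ev (view m) a")
    case True
    have "timed D w (Store (comp_ex a) (comp_ex e)) 1 m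
        (m(val m (comp_ex a) := val m (comp_ex e)))"
      using Out.prems by (intro timed_Store linear_growth) auto
    then have "timed D w (compile (Out a e)) (1 + 1) m (m(val m (comp_ex a) := val m (comp_ex e)))"
      using Out.prems True
      unfolding compile.simps by (intro timed_If) (auto simp: v)
    then show ?thesis using True
      by (intro exI conjI) (auto simp: view_store_IO v numeral_2_eq_2 simp del: fun_upd_apply)
  next
    case False
    have "timed D w (compile (Out a e)) (1 + 1) m m"
      using Out.prems False timed_Skip[of w D m]
      unfolding compile.simps by (intro timed_If) (auto simp: v)
    then show ?thesis using False by (auto simp: numeral_2_eq_2)
  qed
next
  case (Then c d)
  have "\<exists>m1. timed D w (compile c) (steps M c) m m1 \<and> view m1 = run c (view m)"
    using Then.prems by (intro Then.IH(1)) force+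
  then obtain m1 where m1: "timed D w (compile c) (steps M c) m m1" "view m1 = run c (view m)"
    by blast
  have io: "m1 a = m a" if "IO \<notin> mods c" "0 \<le> a" for a
    using run_unmodified[OF that(1), of "view m"] that(2) m1(2) by (metis view_def)
  have "ev (view m1) e = ev (view m) e" if "e \<in> bounds d" for e
  proof (rule ev_cong)
    have "Size \<notin> mods c" using Then.prems(2) that by auto
    then have "view m1 Size = view m Size" using m1(2) by (simp add: run_unmodified)
    moreover fix x assume "x \<in> names e"
    ultimately show "view m1 x = view m x"
      using bounds_names[OF _ that] Then.prems(1) by auto
  qed
  then have "\<exists>m2. timed D w (compile d) (steps M d) m1 m2 \<and> view m2 = run d (view m1)"
    using Then.prems io by (intro Then.IH(2)) force+
  with m1 show ?case using timed_Seq by fastforce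
next
  case (Cond e c d)
  show ?case
  proof (cases "0 < ev (view m) e")
    case True
    have "\<exists>m'. timed D w (compile c) (steps M c) m m' \<and> view m' = run c (view m)"
      using Cond.prems by (intro Cond.IH(1)) force+
    then obtain m' where m': "timed D w (compile c) (steps M c) m m'" "view m' = run c (view m)"
      by blast
    have "timed D w (compile (Cond e c d)) (steps M c + 1) m m'"
      using Cond.prems True m'(1)
      unfolding compile.simps by (intro timed_If) (auto simp: val_comp_ex)
    then show ?thesis using True m'(2) timed_mono[where l = "steps M (Cond e c d)"] by fastforce
  next
    case False
    have "\<exists>m'. timed D w (compile d) (steps M d) m m' \<and> view m' = run d (view m)"
      using Cond.prems by (intro Cond.IH(2)) force+
    then obtain m' where m': "timed D w (compile d) (steps M d) m m'" "view m' = run d (view m)"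
      by blast
    have "timed D w (compile (Cond e c d)) (steps M d + 1) m m'"
      using Cond.prems False m'(1)
      unfolding compile.simps by (intro timed_If) (auto simp: val_comp_ex)
    then show ?thesis using False m'(2) timed_mono[where l = "steps M (Cond e c d)"] by fastforce
  qed
next
  case (For x e c)
  define f where "f = (\<lambda>s. upd (run c s) x 0 (run c s x 0 + 1))"
  define test where "test = Bin Sub (comp_ex e) (comp_ex (V x))"
  define inc where "inc = Store (address x (Const 0)) (Bin Add (comp_ex (V x)) (Const 1))"
  have wf: "x \<noteq> IO" "x \<noteq> Size" "x \<notin> mods c" "Size \<notin> mods c" "names e \<subseteq> {Size}" "well_formed c"
    using For.prems(1) by auto
  have IO: "IO \<notin> names e" using wf by auto
  have weights: "com_weight (compile c) \<le> w" "com_weight inc \<le> w" "1 + weight test \<le> w"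
    "com_weight (Store (address x (Const 0)) (Const 0)) \<le> w"
    using For.prems(3) by (auto simp: test_def inc_def)
  \<comment> \<open>Induction on the number \<open>k\<close> of remaining iterations, which is
    determined by the counter and the constant value of the bound.\<close>
  have loop: "\<exists>m'. timed D w (WhilePos test (Seq (compile c) inc)) (k * (steps M c + 2) + 1) m1 m' \<and>
      view m' = (f ^^ k) (view m1)"
    if "ev (view m1) e = view m1 x 0 + int k" "view m1 Size = view m Size"
      "scales c \<Longrightarrow> \<forall>a\<ge>0. m1 a = m a" for k m1
    using that
  proof (induction k arbitrary: m1)
    case 0
    have "timed D w (WhilePos test (Seq (compile c) inc)) 1 m1 m1"
      unfolding timed_def
    proof (intro exI conjI allI impI)
      show "exec (WhilePos test (Seq (compile c) inc)) m1 (1 + cost m1 test) m1"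
        using 0 IO wf(1) by (intro exec.WhileFalse) (simp add: test_def val_comp_ex del: comp_ex.simps)
      fix b assume b: "bounded b m1"
      then show "bounded (b + 1 * D) m1" by (auto simp: bounded_def trans_le_add1)
      have "1 + cost m1 test \<le> (1 + weight test) * (b + 1)"
        using cost_le[OF b, of test] by simp
      also have "\<dots> \<le> w * (b + D + 1)" using weights(3) by (intro mult_mono) auto
      finally show "1 + cost m1 test \<le> 1 * w * (b + 1 * D + 1)" by simp
    qed
    then show ?case by auto
  next
    case (Suc k)
    have "ev (view m1) e' \<le> int M" if "e' \<in> bounds c" for e'
    proof -
      have "ev (view m1) e' = ev (view m) e'"
        using bounds_names[OF wf(6) that] Suc.prems(2) by (intro ev_cong) auto
      then show ?thesis using For.prems(6) that by simp
    qed
    then have "\<exists>m2. timed D w (compile c) (steps M c) m1 m2 \<and> view m2 = run c (view m1)"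
      using For.prems wf weights Suc.prems(3) by (intro For.IH) auto
    then obtain m2 where m2: "timed D w (compile c) (steps M c) m1 m2" "view m2 = run c (view m1)"
      by blast
    define m3 where "m3 = m2(addr x 0 := view m2 x 0 + 1)"
    have v: "val m2 (address x (Const 0)) = addr x 0"
      "val m2 (Bin Add (comp_ex (V x)) (Const 1)) = view m2 x 0 + 1"
      using wf(1) by (simp_all add: val_address view_def)
    have "bits (val m2 (Bin Add (comp_ex (V x)) (Const 1))) \<le> b + D" if "bounded b m2" for b
      using linear_growth[of "Op Add (V x) (Lit 1)" D b m2] that wf(1) For.prems(4) by simp
    from timed_Store[OF this weights(2)[unfolded inc_def]]
    have m3: "timed D w inc 1 m2 m3" by (simp only: inc_def m3_def v)
    have view3: "view m3 = f (view m1)"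
      using wf(1) by (simp add: m3_def view_store f_def m2(2))
    have x3: "view m3 x 0 = view m1 x 0 + 1"
      using wf(3) by (simp add: view3 f_def upd_apply run_unmodified)
    have size3: "view m3 Size = view m1 Size"
      using wf by (simp add: view3 f_def upd_apply run_unmodified)
    have e3: "ev (view m3) e = ev (view m1) e"
      using wf(5) size3 by (intro ev_cong) auto
    have io3: "\<forall>a\<ge>0. m3 a = m a" if "scales c"
    proof (intro allI impI)
      fix a :: int assume a: "0 \<le> a"
      have "IO \<notin> mods c" using For.prems(5) that by simp
      then have "view m3 IO a = view m1 IO a"
        using wf(1) by (simp add: view3 f_def upd_apply run_unmodified)
      then show "m3 a = m a" using Suc.prems(3)[OF that] a by (simp add: view_def)
    qed
    obtain m' where m': "timed D w (WhilePos test (Seq (compile c) inc)) (k * (steps M c + 2) + 1) m3 m'"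
      "view m' = (f ^^ k) (view m3)"
      using Suc.IH[of m3] Suc.prems e3 x3 size3 io3 by auto
    obtain t u where t: "exec (Seq (compile c) inc) m1 t m3"
      and u: "exec (WhilePos test (Seq (compile c) inc)) m3 u m'"
      using timed_Seq[OF m2(1) m3] m'(1) unfolding timed_def by blast
    have pos: "0 < val m1 test"
      using Suc.prems(1) IO wf(1) by (simp add: test_def val_comp_ex del: comp_ex.simps)
    have "timed D w (WhilePos test (Seq (compile c) inc))
        (((steps M c + 1) + (k * (steps M c + 2) + 1)) + 1) m1 m'"
    proof (rule timed_test[OF _ weights(3)])
      show "timed D w (Seq (Seq (compile c) inc) (WhilePos test (Seq (compile c) inc)))
          ((steps M c + 1) + (k * (steps M c + 2) + 1)) m1 m'"
        by (intro timed_Seq[OF _ m'(1)] timed_Seq[OF m2(1) m3])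
      fix v assume "exec (Seq (Seq (compile c) inc) (WhilePos test (Seq (compile c) inc))) m1 v m'"
      then obtain v1 v2 m4 where "exec (Seq (compile c) inc) m1 v1 m4"
        "exec (WhilePos test (Seq (compile c) inc)) m4 v2 m'" "v = v1 + v2"
        by (rule Seq_elim)
      then show "exec (WhilePos test (Seq (compile c) inc)) m1 (1 + cost m1 test + v) m'"
        using exec.WhileTrue[OF pos] by (simp add: add.assoc[symmetric])
    qed
    then have "timed D w (WhilePos test (Seq (compile c) inc)) (Suc k * (steps M c + 2) + 1) m1 m'"
      by (simp add: algebra_simps)
    then show ?case using m'(2) by (auto simp: view3 funpow_swap1)
  qed
  define m0 where "m0 = m(addr x 0 := 0)"
  have view0: "view m0 = upd (view m) x 0 0" using wf(1) by (simp add: m0_def view_store)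
  have "bits (val m (Const 0)) \<le> b + D" for b using For.prems(4) by simp
  from timed_Store[OF this weights(4)]
  have t0: "timed D w (Store (address x (Const 0)) (Const 0)) 1 m m0"
    by (simp add: m0_def val_address)
  define b where "b = nat (ev (view m) e)"
  have e0: "ev (view m0) e = ev (view m) e"
    using wf by (intro ev_cong) (auto simp: view0 upd_apply)
  have "\<forall>a\<ge>0. m0 a = m a" using addr_neg[of x 0] by (auto simp: m0_def)
  moreover have "view m0 Size = view m Size" using wf by (simp add: view0 upd_apply)
  ultimately have "\<exists>m'. timed D w (WhilePos test (Seq (compile c) inc)) (b * (steps M c + 2) + 1) m0 m' \<and>
      view m' = (f ^^ b) (view m0)"
  proof (cases "0 \<le> ev (view m) e")
    case True
    then show ?thesis using loop[of m0 b] e0 \<open>\<forall>a\<ge>0. m0 a = m a\<close> \<open>view m0 Size = view m Size\<close>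
      by (simp add: b_def view0 upd_apply)
  next
    case False
    have "timed D w (WhilePos test (Seq (compile c) inc)) 1 m0 m0"
      unfolding timed_def
    proof (intro exI conjI allI impI)
      show "exec (WhilePos test (Seq (compile c) inc)) m0 (1 + cost m0 test) m0"
        using False e0 IO wf(1) by (intro exec.WhileFalse)
          (simp add: test_def val_comp_ex view0[unfolded upd_def] del: comp_ex.simps)
      fix b assume b: "bounded b m0"
      then show "bounded (b + 1 * D) m0" by (auto simp: bounded_def trans_le_add1)
      have "1 + cost m0 test \<le> (1 + weight test) * (b + 1)"
        using cost_le[OF b, of test] by simp
      also have "\<dots> \<le> w * (b + D + 1)" using weights(3) by (intro mult_mono) auto
      finally show "1 + cost m0 test \<le> 1 * w * (b + 1 * D + 1)" by simp
    qed
    then show ?thesis using False by (auto simp: b_def)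
  qed
  then obtain m' where m': "timed D w (WhilePos test (Seq (compile c) inc)) (b * (steps M c + 2) + 1) m0 m'"
      "view m' = (f ^^ b) (view m0)" by blast
  have "b \<le> M" using For.prems(6)[of e] by (simp add: b_def)
  then have "b * (steps M c + 2) \<le> M * (steps M c + 2)" by (rule mult_right_mono) simp
  then have "1 + (b * (steps M c + 2) + 1) \<le> steps M (For x e c)" by simp
  from timed_mono[OF timed_Seq[OF t0 m'(1)] this]
  have "timed D w (compile (For x e c)) (steps M (For x e c)) m m'"
    by (simp add: test_def inc_def)
  then show ?case using m'(2) by (auto simp: b_def view0 f_def run.simps(7))
qed


section \<open>The complete program and its polynomial time bound\<close>

lemma steps_poly: "\<exists>p :: nat poly. \<forall>M. steps M c = poly p M"
proof (induction c)
  case (Then c d)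
  then obtain p q where "\<forall>M. steps M c = poly p M" "\<forall>M. steps M d = poly q M" by blast
  then show ?case by (intro exI[of _ "p + q"]) simp
next
  case (Cond e c d)
  then obtain p q where "\<forall>M. steps M c = poly p M" "\<forall>M. steps M d = poly q M" by blast
  then show ?case by (intro exI[of _ "1 + p + q"]) simp
next
  case (For x e c)
  then obtain p where "\<forall>M. steps M c = poly p M" by blast
  then show ?case by (intro exI[of _ "[:2:] + [:0, 1:] * (p + [:2:])"]) simp
qed (auto intro: exI[of _ "[:1:]"] exI[of _ "[:2:]"])

lemma poly_nat_mono: "x \<le> y \<Longrightarrow> poly p x \<le> poly p (y :: nat)"
  by (induction p) (auto intro: add_mono mult_mono)

text \<open>Expressions cannot name \<open>IO\<close>, so even the number of points is fetched as 1
  times an input cell.\<close>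

definition read_size :: cm where
  "read_size = Scale Size (Lit 0) (Lit 1) (Lit 0)"

definition program :: "cm \<Rightarrow> cm \<Rightarrow> com" where
  "program c d = Seq (compile read_size) (Seq (compile c) (compile d))"

lemma bits_input_memory:
  assumes "xs \<noteq> []"
  shows "bits (input_memory xs a) \<le> input_size xs"
proof -
  have elem: "bits x \<le> input_size xs" if "x \<in> set xs" for x
    using member_le_sum_list[of "bits x" "map bits xs"] that by (simp add: input_size_def)
  have "bits 0 \<le> bits (hd xs)" by (rule bits_mono) simp
  also have "\<dots> \<le> input_size xs" using assms by (intro elem) simp
  finally show ?thesis using elem by (auto simp: input_memory_def nat_less_iff)
qed

lemma view_input_memory:
  "view (input_memory xs) x i = (if x = IO then input_memory xs i else 0)"
  using addr_neg[of x i] by (auto simp: view_def input_memory_def)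

text \<open>The program has two halves: \<open>c\<close> multiplies by input cells and leaves them
  intact, \<open>d\<close> writes the output and no longer multiplies by them. With input size S and
  a polynomial number k of steps, each lengthening numbers by at most \<open>G + S\<close> bits, the
  time is at most k * w * (S + k * (G + S) + 1).\<close>

theorem program_correct:
  assumes c: "well_formed c" "Size \<notin> mods c" "IO \<notin> mods c"
    and d: "well_formed d" "Size \<notin> mods d" "\<not> scales d"
    and q: "\<And>e s. e \<in> bounds c \<union> bounds d \<Longrightarrow> 0 \<le> s Size 0 \<Longrightarrow> ev s e \<le> int (poly q (nat (s Size 0)))"
  shows "\<exists>p. \<forall>xs. xs \<noteq> [] \<and> 0 \<le> hd xs \<and> hd xs \<le> int (input_size xs) \<longrightarrow>
    (\<exists>t m. exec (program c d) (input_memory xs) t m \<and> t \<le> poly p (input_size xs) \<and>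
      view m = run d (run c (upd (view (input_memory xs)) Size 0 (hd xs))))"
proof -
  obtain pc pd where pc: "\<And>M. steps M c = poly pc M" and pd: "\<And>M. steps M d = poly pd M"
    using steps_poly by metis
  define w where "w = com_weight (compile read_size) + com_weight (compile c) + com_weight (compile d)"
  define G where "G = growth read_size + growth c + growth d"
  define k where "k = [:2:] + pcompose pc q + pcompose pd q"
  define p where "p = k * [:w:] * ([:1, 1:] + k * [:G, 1:])"
  show ?thesis
  proof (intro exI[of _ p] allI impI)
    fix xs assume xs: "xs \<noteq> [] \<and> 0 \<le> hd xs \<and> hd xs \<le> int (input_size xs)"
    define S where "S = input_size xs"
    define M where "M = poly q S"
    define m0 where "m0 = input_memory xs"
    have b0: "bounded S m0"
      using xs bits_input_memory by (auto simp: bounded_def S_def m0_def)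
    have "\<exists>m'. timed (G + S) w (compile read_size) (steps M read_size) m0 m' \<and>
        view m' = run read_size (view m0)"
      using b0 by (intro compile_correct) (auto simp: read_size_def w_def G_def bounded_def add_mono)
    then obtain m1 where m1: "timed (G + S) w (compile read_size) 2 m0 m1"
        "view m1 = run read_size (view m0)" by (auto simp: read_size_def)
    have "input_memory xs 0 = hd xs" using xs by (simp add: input_memory_def hd_conv_nth)
    then have v1: "view m1 = upd (view m0) Size 0 (hd xs)"
      unfolding m1(2) by (simp add: read_size_def m0_def view_input_memory)
    have io1: "m1 a = m0 a" if "0 \<le> a" for a
      using fun_cong[OF fun_cong[OF v1, of IO], of a] that by (simp add: upd_apply view_def)
    have size1: "view m1 Size 0 = hd xs" by (simp add: v1 upd_apply)
    have bound: "ev s e \<le> int M" if "e \<in> bounds c \<union> bounds d" "s Size 0 = hd xs" for e s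
    proof -
      have "ev s e \<le> int (poly q (nat (hd xs)))" using q[OF that(1), of s] that(2) xs by simp
      also have "poly q (nat (hd xs)) \<le> M"
        unfolding M_def S_def using xs by (intro poly_nat_mono) linarith
      finally show ?thesis by simp
    qed
    have "\<exists>m'. timed (G + S) w (compile c) (steps M c) m1 m' \<and> view m' = run c (view m1)"
      using b0 io1 c bound size1
      by (intro compile_correct) (auto simp: w_def G_def bounded_def add_mono)
    then obtain m2 where m2: "timed (G + S) w (compile c) (steps M c) m1 m2"
        "view m2 = run c (view m1)" by blast
    have size2: "view m2 Size 0 = hd xs" using m2(2) c(2) size1 by (simp add: run_unmodified)
    have "\<exists>m'. timed (G + S) w (compile d) (steps M d) m2 m' \<and> view m' = run d (view m2)"
      using d bound size2 by (intro compile_correct) (auto simp: w_def G_def)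
    then obtain m3 where m3: "timed (G + S) w (compile d) (steps M d) m2 m3"
        "view m3 = run d (view m2)" by blast
    have "timed (G + S) w (program c d) (2 + (steps M c + steps M d)) m0 m3"
      unfolding program_def by (intro timed_Seq[OF m1(1)] timed_Seq[OF m2(1) m3(1)])
    also have "2 + (steps M c + steps M d) = poly k S"
      by (simp add: k_def pc pd M_def poly_pcompose)
    finally obtain t where "exec (program c d) m0 t m3"
        "t \<le> poly k S * w * (S + poly k S * (G + S) + 1)"
      using b0 unfolding timed_def by blast
    then show "\<exists>t m. exec (program c d) (input_memory xs) t m \<and> t \<le> poly p (input_size xs) \<and>
      view m = run d (run c (upd (view (input_memory xs)) Size 0 (hd xs)))"
      unfolding m0_def[symmetric] S_def[symmetric]
      using m3(2) m2(2) v1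
      by (intro exI[of _ t] exI[of _ m3]) (simp add: p_def algebra_simps)
  qed
qed

lemma finite_argmin:
  fixes f :: "'a \<Rightarrow> 'b :: linorder"
  assumes "finite S" "S \<noteq> {}"
  obtains x where "x \<in> S" "\<And>y. y \<in> S \<Longrightarrow> f x \<le> f y"
  using ex_is_arg_min_if_finite[OF assms, of f] by (auto simp: is_arg_min_linorder)

section \<open>The auction\<close>

text \<open>A snapshot of the auction, compared with an assignment \<open>opt\<close> of load at
  most \<open>T\<close>. The clients in \<open>X\<close> are assigned, and \<open>paid c\<close> is
  the price at which \<open>c\<close> joined, which lags behind the current price by at most 1. A
  client joins where price times distance is least, and prices never fall; hence
  \<open>stable\<close>.\<close>

locale auction =
  fixes F C X :: "'a set" and d :: "'a \<Rightarrow> 'a \<Rightarrow> int" and T :: int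
    and opt fac :: "'a \<Rightarrow> 'a" and price paid :: "'a \<Rightarrow> int"
  assumes finite: "finite F" "finite C" and X: "X \<subseteq> C"
    and nonneg: "\<And>f c. f \<in> F \<Longrightarrow> c \<in> C \<Longrightarrow> 0 \<le> d f c"
    and opt: "\<And>c. c \<in> C \<Longrightarrow> opt c \<in> F"
    and opt_load: "\<And>f. f \<in> F \<Longrightarrow> (\<Sum>c | c \<in> C \<and> opt c = f. d f c) \<le> T"
    and T: "0 \<le> T"
    and fac: "\<And>c. c \<in> X \<Longrightarrow> fac c \<in> F"
    and paid: "\<And>c. c \<in> X \<Longrightarrow> 2 \<le> paid c \<and> price (fac c) - 1 \<le> paid c"
    and stable: "\<And>c f. c \<in> X \<Longrightarrow> f \<in> F \<Longrightarrow> d f c \<le> T \<Longrightarrow> paid c * d (fac c) c \<le> price f * d f c"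
    and price: "\<And>f. f \<in> F \<Longrightarrow> 2 \<le> price f"
    and raised: "\<And>f. f \<in> F \<Longrightarrow> 2 < price f \<Longrightarrow> T \<le> (\<Sum>c | c \<in> X \<and> fac c = f. d f c)"
begin

definition load :: "'a \<Rightarrow> int" where
  "load f = (\<Sum>c | c \<in> X \<and> fac c = f. d f c)"

lemma load_nonneg: "f \<in> F \<Longrightarrow> 0 \<le> load f"
  unfolding load_def using nonneg X by (intro sum_nonneg) auto

text \<open>Puts the optimal facility of a client among those that the client considers, so that
  \<open>stable\<close> applies to it.\<close>

lemma opt_dist: "c \<in> C \<Longrightarrow> d (opt c) c \<le> T"
proof -
  assume c: "c \<in> C"
  have "d (opt c) c \<le> (\<Sum>x | x \<in> C \<and> opt x = opt c. d (opt c) x)"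
    using c nonneg opt finite by (intro member_le_sum) auto
  with opt_load[OF opt[OF c]] show ?thesis by simp
qed

lemma opt_cost: "(\<Sum>c\<in>C. d (opt c) c) \<le> int (card (opt ` C)) * T"
proof -
  have "(\<Sum>c\<in>C. d (opt c) c) = (\<Sum>f\<in>opt ` C. \<Sum>c | c \<in> C \<and> opt c = f. d (opt c) c)"
    using finite by (intro sum.group[symmetric]) auto
  also have "\<dots> = (\<Sum>f\<in>opt ` C. \<Sum>c | c \<in> C \<and> opt c = f. d f c)"
    by (intro sum.cong) auto
  also have "\<dots> \<le> (\<Sum>f\<in>opt ` C. T)" using opt opt_load by (intro sum_mono) auto
  finally show ?thesis by simp
qed

text \<open>Approximate complementary slackness, with \<open>price f - 2\<close> as dual variable of the capacity of
  \<open>f\<close>: a client pays its facility no more than it would pay its optimal one.\<close>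

lemma paid_loads:
  "(\<Sum>f\<in>F. max 2 (price f - 1) * load f) \<le>
     2 * int (card (opt ` C)) * T + (\<Sum>f\<in>F. (price f - 2) * T)"
proof -
  have "(\<Sum>f\<in>F. max 2 (price f - 1) * load f) =
      (\<Sum>f\<in>F. \<Sum>c | c \<in> X \<and> fac c = f. max 2 (price f - 1) * d f c)"
    by (simp add: load_def sum_distrib_left)
  also have "\<dots> \<le> (\<Sum>f\<in>F. \<Sum>c | c \<in> X \<and> fac c = f. paid c * d (fac c) c)"
  proof (intro sum_mono)
    fix f c assume "f \<in> F" "c \<in> {c \<in> X. fac c = f}"
    then show "max 2 (price f - 1) * d f c \<le> paid c * d (fac c) c"
      using paid[of c] nonneg[of f c] X by (auto intro!: mult_right_mono)
  qed
  also have "\<dots> = (\<Sum>c\<in>X. paid c * d (fac c) c)"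
    using finite X fac by (intro sum.group) (auto intro: finite_subset)
  \<comment> \<open>Stability against the optimal facility, which is within distance
    \<open>T\<close>.\<close>
  also have "\<dots> \<le> (\<Sum>c\<in>X. price (opt c) * d (opt c) c)"
    using stable opt X opt_dist by (intro sum_mono) auto
  also have "\<dots> \<le> (\<Sum>c\<in>C. price (opt c) * d (opt c) c)"
    using finite X price opt nonneg by (intro sum_mono2) (auto intro!: mult_nonneg_nonneg intro: order_trans[of 0 2])
  also have "\<dots> = (\<Sum>c\<in>C. 2 * d (opt c) c) + (\<Sum>c\<in>C. (price (opt c) - 2) * d (opt c) c)"
    by (simp add: sum.distrib[symmetric] algebra_simps)
  also have "(\<Sum>c\<in>C. (price (opt c) - 2) * d (opt c) c) =
      (\<Sum>f\<in>F. \<Sum>c | c \<in> C \<and> opt c = f. (price (opt c) - 2) * d (opt c) c)"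
    using finite opt by (intro sum.group[symmetric]) auto
  also have "\<dots> = (\<Sum>f\<in>F. (price f - 2) * (\<Sum>c | c \<in> C \<and> opt c = f. d f c))"
    by (intro sum.cong refl) (auto simp: sum_distrib_left intro!: sum.cong)
  also have "\<dots> \<le> (\<Sum>f\<in>F. (price f - 2) * T)"
    using opt_load price by (intro sum_mono mult_left_mono) auto
  also have "(\<Sum>c\<in>C. 2 * d (opt c) c) \<le> 2 * int (card (opt ` C)) * T"
    using opt_cost by (simp add: sum_distrib_left[symmetric])
  finally show ?thesis by simp
qed

text \<open>The clients pay at least \<open>price f - 1\<close>, the dual variable is
  \<open>price f - 2\<close>, and a raised facility has load at least \<open>T\<close>: one unit of
  price per unit of load is left over. At the initial price the dual variable vanishes and both
  units of the payment are left. An initial price of 1 would leave nothing after the first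
  raise.\<close>

lemma load_value: "f \<in> F \<Longrightarrow> (price f - 2) * T + load f \<le> max 2 (price f - 1) * load f"
proof -
  assume f: "f \<in> F"
  show ?thesis
  proof (cases "2 < price f")
    case True
    then have "(price f - 2) * T \<le> (price f - 2) * load f"
      using raised[OF f] by (intro mult_left_mono) (auto simp: load_def)
    with True show ?thesis by (simp add: max_def algebra_simps)
  next
    case False
    with price[OF f] have "price f = 2" by simp
    then show ?thesis using load_nonneg[OF f] by simp
  qed
qed

lemma total_load: "(\<Sum>f\<in>F. load f) \<le> 2 * int (card (opt ` C)) * T"
proof -
  have "(\<Sum>f\<in>F. (price f - 2) * T + load f) \<le> (\<Sum>f\<in>F. max 2 (price f - 1) * load f)"
    by (intro sum_mono load_value)
  with paid_loads show ?thesis by (simp add: sum.distrib)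
qed

lemma assignment_cost: "(\<Sum>c\<in>X. d (fac c) c) \<le> 2 * int (card (opt ` C)) * T"
proof -
  have "(\<Sum>c\<in>X. d (fac c) c) = (\<Sum>f\<in>F. \<Sum>c | c \<in> X \<and> fac c = f. d (fac c) c)"
    using finite X fac by (intro sum.group[symmetric]) (auto intro: finite_subset)
  also have "\<dots> = (\<Sum>f\<in>F. load f)"
    unfolding load_def by (intro sum.cong refl) auto
  finally show ?thesis using total_load by simp
qed

text \<open>The surplus load of an overloaded facility compensates for the clients that have not yet
  paid the current price.\<close>

lemma overloaded_price:
  assumes i: "i \<in> F" "2 * T < load i" and "0 < T"
  shows "price i \<le> 2 * int (card (opt ` C))"
proof -
  \<comment> \<open>Both sides are equal. A load above \<open>2 * T\<close>, paid at no less than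
    \<open>price i - 1\<close>, exceeds the dual term of \<open>i\<close> by
    \<open>price i * T\<close>.\<close>
  have "price i * T \<le> (price i - 1) * (2 * T) - (price i - 2) * T" by (simp add: algebra_simps)
  also have "(price i - 1) * (2 * T) \<le> max 2 (price i - 1) * load i"
    using price[OF i(1)] i(2) assms(3) by (intro mult_mono) auto
  finally have "(price i - 2) * T + price i * T \<le> max 2 (price i - 1) * load i" by simp
  moreover have "(\<Sum>f\<in>F - {i}. (price f - 2) * T) \<le> (\<Sum>f\<in>F - {i}. max 2 (price f - 1) * load f)"
  proof (intro sum_mono)
    fix f assume "f \<in> F - {i}"
    then show "(price f - 2) * T \<le> max 2 (price f - 1) * load f"
      using load_value[of f] load_nonneg[of f] by simp
  qed
  ultimately have "price i * T + (\<Sum>f\<in>F. (price f - 2) * T) \<le> (\<Sum>f\<in>F. max 2 (price f - 1) * load f)"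
    using finite i(1) by (simp add: sum.remove[of F i])
  with paid_loads have "price i * T \<le> 2 * int (card (opt ` C)) * T" by linarith
  with assms(3) show ?thesis by simp
qed

end


section \<open>Opening facilities by increasing radius\<close>

text \<open>The facility location instance: client \<open>c\<close> sits at its facility
  \<open>q c\<close>, opening costs \<open>T\<close>, and \<open>Os\<close> are the optimal
  facilities. The ideal radius at a point makes the sum of the positive parts of radius minus
  distance equal to \<open>T\<close>. \<open>R_lower\<close> allows for rounding by asking for half
  of that; \<open>R_upper\<close> is required only for prefixes of the distance order, the sets that
  the program tries.\<close>

locale ball_packing =
  fixes P :: "'a set" and d :: "'a \<Rightarrow> 'a \<Rightarrow> real" and X :: "'b set" and q near :: "'b \<Rightarrow> 'a"
    and Os :: "'a set" and T :: real and R :: "'a \<Rightarrow> real" and H :: "'a set"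
  assumes nonneg: "\<And>x y. x \<in> P \<Longrightarrow> y \<in> P \<Longrightarrow> 0 \<le> d x y"
    and sym: "\<And>x y. x \<in> P \<Longrightarrow> y \<in> P \<Longrightarrow> d x y = d y x"
    and triangle: "\<And>x y z. x \<in> P \<Longrightarrow> y \<in> P \<Longrightarrow> z \<in> P \<Longrightarrow> d x z \<le> d x y + d y z"
    and finite: "finite X" "finite Os" "finite H"
    and points: "q ` X \<subseteq> P" "Os \<subseteq> P" "H \<subseteq> P" "near ` X \<subseteq> Os"
    and T: "0 < T"
    and R_lower: "\<And>h. h \<in> H \<Longrightarrow> \<exists>S\<subseteq>X. T / 2 \<le> (\<Sum>c\<in>S. R h - d h (q c))"
    and R_upper: "\<And>c x. c \<in> X \<Longrightarrow> x \<in> X \<Longrightarrow>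
       R (q c) * card {y \<in> X. d (q c) (q y) \<le> d (q c) (q x)} \<le>
         T + (\<Sum>y | y \<in> X \<and> d (q c) (q y) \<le> d (q c) (q x). d (q c) (q y))"
    and separated: "\<And>h h'. h \<in> H \<Longrightarrow> h' \<in> H \<Longrightarrow> h \<noteq> h' \<Longrightarrow> R h + R h' \<le> d h h'"
    and dominating: "\<And>c. c \<in> X \<Longrightarrow> \<exists>h\<in>H. d (q c) h \<le> 2 * R (q c)"
begin

lemma pt: "c \<in> X \<Longrightarrow> q c \<in> P" "c \<in> X \<Longrightarrow> near c \<in> P" "c \<in> X \<Longrightarrow> near c \<in> Os" "h \<in> H \<Longrightarrow> h \<in> P" "y \<in> Os \<Longrightarrow> y \<in> P"
  using points by auto

lemma disjoint_balls:
  assumes "h \<in> H" "h' \<in> H" "h \<noteq> h'" "y \<in> P" "d h y < R h"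
  shows "\<not> d h' y < R h'"
proof -
  have "d h h' \<le> d h y + d h' y"
    using triangle[of h y h'] sym[of y h'] assms pt by simp
  then show ?thesis using separated[OF assms(1-3)] assms(5) by linarith
qed

text \<open>Open balls of radius \<open>R h\<close> around the members of \<open>H\<close> are
  disjoint. A ball that contains an optimal facility is charged to that facility. In any other ball
  each client still has to leave the ball to reach its optimal facility, which costs at least
  \<open>R h - d h (q c)\<close> and at least \<open>T / 2\<close> in total.\<close>

lemma card_opened: "card H * T \<le> card Os * T + 2 * (\<Sum>c\<in>X. d (q c) (near c))"
proof -
  define H1 where "H1 = {h \<in> H. \<exists>y\<in>Os. d h y < R h}"
  define B where "B h = {c \<in> X. d h (q c) < R h}" for h
  obtain g where g: "\<And>h. h \<in> H1 \<Longrightarrow> g h \<in> Os \<and> d h (g h) < R h"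
    using bchoice[of H1 "\<lambda>h y. y \<in> Os \<and> d h y < R h"] by (auto simp: H1_def)
  have "inj_on g H1"
  proof (rule inj_onI, rule ccontr)
    fix h h' assume "h \<in> H1" "h' \<in> H1" "g h = g h'" "h \<noteq> h'"
    then show False using disjoint_balls[of h h' "g h"] g[of h] g[of h'] pt by (auto simp: H1_def)
  qed
  then have H1: "card H1 \<le> card Os"
    using g finite by (intro card_inj_on_le[of g]) auto
  have "(\<Sum>h\<in>H - H1. T / 2) \<le> (\<Sum>h\<in>H - H1. \<Sum>c\<in>B h. d (q c) (near c))"
  proof (intro sum_mono)
    fix h assume h: "h \<in> H - H1"
    obtain S where S: "S \<subseteq> X" "T / 2 \<le> (\<Sum>c\<in>S. R h - d h (q c))"
      using R_lower[of h] h by auto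
    note S(2)
    also have "(\<Sum>c\<in>S. R h - d h (q c)) \<le> (\<Sum>c\<in>S \<inter> B h. R h - d h (q c))"
    proof -
      have "finite S" using S(1) finite finite_subset by blast
      have "(\<Sum>c\<in>S. R h - d h (q c)) = (\<Sum>c\<in>S \<inter> B h. R h - d h (q c)) + (\<Sum>c\<in>S - B h. R h - d h (q c))"
        using \<open>finite S\<close> by (rule sum.Int_Diff)
      moreover have "(\<Sum>c\<in>S - B h. R h - d h (q c)) \<le> 0"
        using S(1) by (intro sum_nonpos) (auto simp: B_def)
      ultimately show ?thesis by simp
    qed
    also have "\<dots> \<le> (\<Sum>c\<in>B h. R h - d h (q c))"
      using finite by (intro sum_mono2) (auto simp: B_def)
    also have "\<dots> \<le> (\<Sum>c\<in>B h. d (q c) (near c))"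
    proof (intro sum_mono)
      fix c assume "c \<in> B h"
      then have c: "c \<in> X" by (simp add: B_def)
      have "R h \<le> d h (near c)" using h pt(3)[OF c] by (force simp: H1_def)
      also have "\<dots> \<le> d h (q c) + d (q c) (near c)" using h c pt by (intro triangle) auto
      finally show "R h - d h (q c) \<le> d (q c) (near c)" by simp
    qed
    finally show "T / 2 \<le> (\<Sum>c\<in>B h. d (q c) (near c))" .
  qed
  also have "\<dots> = (\<Sum>c\<in>(\<Union>h\<in>H - H1. B h). d (q c) (near c))"
    using finite disjoint_balls pt by (intro sum.UNION_disjoint[symmetric]) (auto simp: B_def)
  also have "\<dots> \<le> (\<Sum>c\<in>X. d (q c) (near c))"
    using finite nonneg pt by (intro sum_mono2) (auto simp: B_def)
  finally have *: "card (H - H1) * T \<le> 2 * (\<Sum>c\<in>X. d (q c) (near c))" by simp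
  have "H1 \<subseteq> H" by (auto simp: H1_def)
  then have "card H = card H1 + card (H - H1)"
    using finite(3) card_mono[of H H1] by (simp add: card_Diff_subset finite_subset)
  then have "card H * T = card H1 * T + card (H - H1) * T" by (simp add: algebra_simps)
  also have "card H1 * T \<le> card Os * T" using H1 T by simp
  finally show ?thesis using * by simp
qed

text \<open>Prefixes of the ordering by distance minimize the ratio of cost to size.\<close>

lemma R_le_ratio:
  assumes c: "c \<in> X" and S: "S \<subseteq> X" "S \<noteq> {}"
  shows "R (q c) * card S \<le> T + (\<Sum>x\<in>S. d (q c) (q x))"
proof -
  define e where "e x = d (q c) (q x)" for x
  define r where "r = (T + (\<Sum>x\<in>S. e x)) / card S"
  have fS: "finite S" "0 < card S" using S finite by (auto simp: card_gt_0_iff intro: finite_subset)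
  have r: "(\<Sum>x\<in>S. r - e x) = T" using fS S(2) by (simp add: sum_subtractf r_def)
  \<comment> \<open>Exchanging \<open>S\<close> for all clients closer than its ratio
    \<open>r\<close> drops nonpositive terms \<open>r - e x\<close> and adds positive ones.\<close>
  define S' where "S' = {x \<in> X. e x < r}"
  have fS': "finite S'" using finite by (simp add: S'_def)
  have "T \<le> (\<Sum>x\<in>S'. r - e x)"
  proof -
    have "(\<Sum>x\<in>S. r - e x) = (\<Sum>x\<in>S \<inter> S'. r - e x) + (\<Sum>x\<in>S - S'. r - e x)"
      using fS(1) by (rule sum.Int_Diff)
    moreover have "(\<Sum>x\<in>S - S'. r - e x) \<le> 0" using S by (intro sum_nonpos) (auto simp: S'_def)
    moreover have "(\<Sum>x\<in>S \<inter> S'. r - e x) \<le> (\<Sum>x\<in>S'. r - e x)"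
      using fS' by (intro sum_mono2) (auto simp: S'_def)
    ultimately show ?thesis using r by simp
  qed
  moreover from this have ne: "S' \<noteq> {}" using T by auto
  obtain x where x: "x \<in> S'" "\<And>y. y \<in> S' \<Longrightarrow> e y \<le> e x"
    using finite_argmin[OF fS' ne, of "\<lambda>y. - e y"] by auto
  \<comment> \<open>\<open>S'\<close> is the prefix that ends at its farthest member, so
    \<open>R_upper\<close> applies to it.\<close>
  then have eq: "{y \<in> X. d (q c) (q y) \<le> d (q c) (q x)} = S'" by (auto simp: S'_def e_def)
  then have "{y. y \<in> X \<and> d (q c) (q y) \<le> d (q c) (q x)} = S'" by simp
  with R_upper[of c x] c x(1) eq have "R (q c) * card S' \<le> T + (\<Sum>y\<in>S'. e y)"
    by (simp add: S'_def e_def)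
  ultimately have "R (q c) * card S' \<le> r * card S'"
    by (simp add: sum_subtractf mult.commute[of r])
  then have "R (q c) \<le> r" using ne fS' by (simp add: card_gt_0_iff)
  then have "R (q c) * card S \<le> r * card S" by (intro mult_right_mono) auto
  then show ?thesis using S(2) fS by (simp add: r_def e_def)
qed

text \<open>Each cell of clients with a common optimal facility \<open>y\<close> is treated alone.
  The closest client of the cell has a radius not much larger than the ideal radius \<open>r\<close>
  at \<open>y\<close>, so some open facility is within reach of the entire cell. What exceeds six
  times the own distances is then paid by the budget \<open>T\<close> of \<open>y\<close>.\<close>

lemma connection_cost:
  assumes E: "\<And>c h. c \<in> X \<Longrightarrow> h \<in> H \<Longrightarrow> E c \<le> d (q c) h"
  shows "(\<Sum>c\<in>X. E c) \<le> 6 * (\<Sum>c\<in>X. d (q c) (near c)) + 2 * T * card Os"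
proof -
  define D where "D c = d (q c) (near c)" for c
  have cell: "(\<Sum>c | c \<in> X \<and> near c = y. E c) \<le> 6 * (\<Sum>c | c \<in> X \<and> near c = y. D c) + 2 * T"
    if y: "y \<in> Os" for y
  proof (cases "{c \<in> X. near c = y} = {}")
    case True
    then show ?thesis using T by (simp only: True) simp
  next
    case False
    define Y where "Y = {c \<in> X. near c = y}"
    have fY: "finite Y" using finite by (simp add: Y_def)
    have YP: "y \<in> P" using y pt by auto
    \<comment> \<open>The client of the cell whose location is closest to \<open>y\<close>: its
      detour \<open>D c0\<close> can be charged to every client of the cell.\<close>
    obtain c0 where c0: "c0 \<in> Y" "\<And>c. c \<in> Y \<Longrightarrow> D c0 \<le> D c"
      using finite_argmin[OF fY, of D] False by (auto simp: Y_def)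
    define ratio where "ratio S = (T + (\<Sum>x\<in>S. d y (q x))) / card S" for S
    have fin: "finite (Pow X - {{}})" "Pow X - {{}} \<noteq> {}" using finite c0 by (auto simp: Y_def)
    obtain S where "S \<in> Pow X - {{}}" and min: "\<And>S'. S' \<in> Pow X - {{}} \<Longrightarrow> ratio S \<le> ratio S'"
      using finite_argmin[OF fin, of ratio] by blast
    then have S: "S \<subseteq> X" "S \<noteq> {}" by auto
    have fS: "finite S" "0 < card S" using S finite by (auto simp: card_gt_0_iff intro: finite_subset)
    define r where "r = ratio S"
    have c0X: "c0 \<in> X" "near c0 = y" using c0 by (auto simp: Y_def)
    have "R (q c0) * card S \<le> T + (\<Sum>x\<in>S. d (q c0) (q x))" using c0X S by (intro R_le_ratio) auto
    also have "\<dots> \<le> T + (\<Sum>x\<in>S. D c0 + d y (q x))"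
      unfolding D_def c0X(2) using c0X S YP pt by (intro add_left_mono sum_mono triangle) auto
    also have "\<dots> = (r + D c0) * card S"
    proof -
      have "r * card S = T + (\<Sum>x\<in>S. d y (q x))" using S(2) fS by (simp add: r_def ratio_def)
      then show ?thesis by (simp add: sum.distrib algebra_simps)
    qed
    finally have R: "R (q c0) \<le> r + D c0" using fS by simp
    obtain h where h: "h \<in> H" "d (q c0) h \<le> 2 * R (q c0)" using dominating c0X by blast
    \<comment> \<open>Via \<open>y\<close>, \<open>c0\<close> and \<open>h\<close> the cost is at
      most \<open>D c + D c0 + 2 * (r + D c0)\<close>, hence at most \<open>4 * D c + 2 * r\<close>,
      which equals \<open>6 * D c + 2 * (r - D c)\<close>.\<close>
    have E_le: "E c \<le> 6 * D c + 2 * max 0 (r - D c)" if c: "c \<in> Y" for c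
    proof -
      have cX: "c \<in> X" "near c = y" using c by (auto simp: Y_def)
      have "E c \<le> d (q c) h" using E cX h by auto
      also have "\<dots> \<le> d (q c) y + d y h" using cX h YP pt by (intro triangle) auto
      also have "d y h \<le> d y (q c0) + d (q c0) h" using c0X h YP pt by (intro triangle) auto
      also have "d y (q c0) = D c0" unfolding D_def c0X(2) using c0X YP pt by (intro sym) auto
      finally have "E c \<le> D c + D c0 + d (q c0) h" by (simp add: D_def cX)
      with h(2) R c0(2)[OF c] show ?thesis by (simp add: max_def)
    qed
    define S' where "S' = {c \<in> Y. D c < r}"
    have "(\<Sum>c\<in>Y. max 0 (r - D c)) = (\<Sum>c\<in>S'. r - D c)"
      using fY by (intro sum.mono_neutral_cong_right) (auto simp: S'_def max_def)
    also have "\<dots> \<le> T"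
    proof (cases "S' = {}")
      case True
      then show ?thesis using T by simp
    next
      case False
      have S'X: "S' \<subseteq> X" "finite S'" using finite by (auto simp: S'_def Y_def)
      \<comment> \<open>As \<open>r\<close> is the least ratio over all sets of clients, the set
        \<open>S'\<close> cannot collect more than \<open>T\<close> from its terms
        \<open>r - D c\<close>.\<close>
      have "r \<le> ratio S'" unfolding r_def using False S'X by (intro min) auto
      then have "r * card S' \<le> T + (\<Sum>x\<in>S'. d y (q x))"
        using False S'X by (simp add: ratio_def pos_le_divide_eq card_gt_0_iff)
      also have "(\<Sum>x\<in>S'. d y (q x)) = (\<Sum>x\<in>S'. D x)"
        using pt by (intro sum.cong) (auto simp: S'_def Y_def D_def intro!: sym)
      finally show ?thesis by (simp add: sum_subtractf algebra_simps)
    qed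
    finally have bound: "(\<Sum>c\<in>Y. max 0 (r - D c)) \<le> T" .
    have "(\<Sum>c\<in>Y. E c) \<le> (\<Sum>c\<in>Y. 6 * D c + 2 * max 0 (r - D c))"
      by (intro sum_mono E_le)
    also have "\<dots> = 6 * (\<Sum>c\<in>Y. D c) + 2 * (\<Sum>c\<in>Y. max 0 (r - D c))"
      by (simp add: sum.distrib sum_distrib_left)
    finally show ?thesis using bound by (simp add: Y_def)
  qed
  have "(\<Sum>c\<in>X. E c) = (\<Sum>y\<in>Os. \<Sum>c | c \<in> X \<and> near c = y. E c)"
    using finite points(4) by (intro sum.group[symmetric]) auto
  also have "\<dots> \<le> (\<Sum>y\<in>Os. 6 * (\<Sum>c | c \<in> X \<and> near c = y. D c) + 2 * T)"
    by (intro sum_mono cell)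
  also have "\<dots> = 6 * (\<Sum>y\<in>Os. \<Sum>c | c \<in> X \<and> near c = y. D c) + 2 * T * card Os"
    by (simp add: sum.distrib sum_distrib_left)
  also have "(\<Sum>y\<in>Os. \<Sum>c | c \<in> X \<and> near c = y. D c) = (\<Sum>c\<in>X. D c)"
    using finite points(4) by (intro sum.group) auto
  finally show ?thesis by (simp add: D_def)
qed

end

section \<open>The program\<close>

text \<open>The machine only tests for positivity, so comparisons are encoded as integer expressions
  that are positive exactly if the comparison holds; for equality, 1 minus a square.\<close>

definition lt :: "ex \<Rightarrow> ex \<Rightarrow> ex" where "lt a b = Op Sub b a"
definition le :: "ex \<Rightarrow> ex \<Rightarrow> ex" where "le a b = Op Add (Op Sub b a) (Lit 1)"
definition eq :: "ex \<Rightarrow> ex \<Rightarrow> ex" where "eq a b = Op Sub (Lit 1) (Op Mul (Op Sub a b) (Op Sub a b))"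
definition dst :: "ex \<Rightarrow> ex \<Rightarrow> ex" where "dst a b = Arr Dist (Op Add (Op Mul a (V Size)) b)"

lemma ev_lt [simp]: "0 < ev s (lt a b) \<longleftrightarrow> ev s a < ev s b"
  by (auto simp: lt_def)

lemma ev_le [simp]: "0 < ev s (le a b) \<longleftrightarrow> ev s a \<le> ev s b"
  by (auto simp: le_def)

lemma ev_eq [simp]: "0 < ev s (eq a b) \<longleftrightarrow> ev s a = ev s b"
proof -
  have "0 < 1 - x * x \<longleftrightarrow> x = 0" for x :: int
  proof
    assume *: "0 < 1 - x * x"
    show "x = 0"
    proof (rule ccontr)
      assume "x \<noteq> 0"
      then have "0 < x * x" by (simp add: zero_less_mult_iff linorder_neq_iff disj_commute)
      with * show False by simp
    qed
  qed simp
  from this[of "ev s a - ev s b"] show ?thesis by (simp add: eq_def)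
qed

lemma ev_dst [simp]: "ev s (dst a b) = s Dist (ev s a * s Size 0 + ev s b)"
  by (simp add: dst_def)

lemma names_simps [simp]:
  "names (lt a b) = names a \<union> names b" "names (le a b) = names a \<union> names b"
  "names (eq a b) = names a \<union> names b" "names (dst a b) = {Dist, Size} \<union> names a \<union> names b"
  by (auto simp: lt_def le_def eq_def dst_def)

lemma linear_dst [simp]: "linear (dst a b)"
  by (simp add: dst_def)

fun block :: "cm list \<Rightarrow> cm" where
  "block [] = Pass"
| "block (c # cs) = Then c (block cs)"

text \<open>The result -1 means that no point qualifies. Two conditions are nested because
  expressions have no conjunction. Ties keep the smaller index, so a constant key finds the first
  qualifying point.\<close>

definition search :: "name \<Rightarrow> name \<Rightarrow> ex \<Rightarrow> ex \<Rightarrow> (ex \<Rightarrow> ex) \<Rightarrow> cm" where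
  "search b x p p' k = Then (Put b (Lit 0) (Lit (-1)))
     (For x (V Size)
       (Cond p (Cond p'
         (Cond (lt (V b) (Lit 0)) (Put b (Lit 0) (V x))
           (Cond (lt (k (V x)) (k (V b))) (Put b (Lit 0) (V x)) Pass)) Pass) Pass))"

lemma mods_search [simp]: "mods (search b x p p' k) = {b, x}"
  by (auto simp: search_def)

lemma scales_search [simp]: "\<not> scales (search b x p p' k)"
  by (auto simp: search_def)

lemma bounds_search [simp]: "bounds (search b x p p' k) = {V Size}"
  by (auto simp: search_def)

lemma well_formed_search [simp]:
  "well_formed (search b x p p' k) \<longleftrightarrow> b \<noteq> IO \<and> x \<noteq> IO \<and> x \<noteq> Size \<and> x \<noteq> b \<and> b \<noteq> Size \<and>
     IO \<notin> names p \<union> names p' \<union> names (k (V x)) \<union> names (k (V b))"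
  by (auto simp: search_def)

text \<open>The conditions and keys are evaluated in the middle of the loop; therefore
  \<open>P\<close> and \<open>f\<close> have to describe them in every state that differs from
  \<open>s\<close> only in the two search variables.\<close>

lemma run_search:
  fixes n :: int
  assumes bx: "b \<noteq> x" "b \<noteq> Size" "x \<noteq> Size" and n: "s Size 0 = n" "0 \<le> n"
    and P: "\<And>t. (\<And>y. y \<noteq> b \<Longrightarrow> y \<noteq> x \<Longrightarrow> t y = s y) \<Longrightarrow> 0 \<le> t x 0 \<Longrightarrow> t x 0 < n \<Longrightarrow>
      0 < ev t p \<and> 0 < ev t p' \<longleftrightarrow> P (t x 0)"
    and f: "\<And>t y. (\<And>y. y \<noteq> b \<Longrightarrow> y \<noteq> x \<Longrightarrow> t y = s y) \<Longrightarrow> y = x \<or> y = b \<Longrightarrow>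
      0 \<le> t y 0 \<Longrightarrow> t y 0 < n \<Longrightarrow> ev t (k (V y)) = f (t y 0)"
    and v: "v = run (search b x p p' k) s b 0"
  shows "v = -1 \<and> (\<forall>y. 0 \<le> y \<longrightarrow> y < n \<longrightarrow> \<not> P y) \<or>
    0 \<le> v \<and> v < n \<and> P v \<and> (\<forall>y. 0 \<le> y \<longrightarrow> y < n \<longrightarrow> P y \<longrightarrow> f v \<le> (f y :: int))"
proof -
  define body where "body = Cond p (Cond p' (Cond (lt (V b) (Lit 0)) (Put b (Lit 0) (V x))
      (Cond (lt (k (V x)) (k (V b))) (Put b (Lit 0) (V x)) Pass)) Pass) Pass"
  define s0 where "s0 = upd s b 0 (-1)"
  define Q where "Q i t \<longleftrightarrow> t b 0 = -1 \<and> (\<forall>y. 0 \<le> y \<longrightarrow> y < i \<longrightarrow> \<not> P y) \<or>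
    0 \<le> t b 0 \<and> t b 0 < i \<and> P (t b 0) \<and> (\<forall>y. 0 \<le> y \<longrightarrow> y < i \<longrightarrow> P y \<longrightarrow> f (t b 0) \<le> f y)"
    for i :: int and t :: state
  have mods: "mods body = {b}" by (auto simp: body_def)
  have "Q n (run (For x (V Size) body) s0)"
  proof (rule run_For_induct)
    fix i t assume i: "0 \<le> i" "i < n" "t x 0 = i" and Q: "Q i t"
      and fr: "\<And>y. y \<noteq> x \<Longrightarrow> y \<notin> mods body \<Longrightarrow> t y = s0 y"
    have agree: "\<And>y. y \<noteq> b \<Longrightarrow> y \<noteq> x \<Longrightarrow> t y = s y"
      using fr by (simp add: mods s0_def upd_apply)
    have P: "0 < ev t p \<and> 0 < ev t p' \<longleftrightarrow> P i" using P[of t] agree i by simp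
    have fx: "ev t (k (V x)) = f i" using f[of t x] agree i by simp
    have fb: "0 \<le> t b 0 \<Longrightarrow> t b 0 < i \<Longrightarrow> ev t (k (V b)) = f (t b 0)"
      using f[of t b] agree i by simp
    note lt = zless_add1_eq
    show "Q (i + 1) (upd (run body t) x 0 (i + 1))"
    proof (cases "P i")
      case False
      then have "run body t = t" using P by (auto simp: body_def)
      then show ?thesis using Q False bx unfolding Q_def by (auto simp: upd_apply lt simp del: zle_add1_eq_le)
    next
      case True
      then have p: "0 < ev t p" "0 < ev t p'" using P by auto
      show ?thesis
      proof (cases "t b 0 < 0")
        case neg: True
        then have "run body t = upd t b 0 i" using p i(3) by (simp add: body_def)
        then show ?thesis using Q True neg i bx unfolding Q_def by (auto simp: upd_apply lt simp del: zle_add1_eq_le)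
      next
        case nonneg: False
        then have b: "0 \<le> t b 0" "t b 0 < i" "P (t b 0)"
          "\<And>y. 0 \<le> y \<Longrightarrow> y < i \<Longrightarrow> P y \<Longrightarrow> f (t b 0) \<le> f y"
          using Q unfolding Q_def by auto
        have "run body t = (if f i < f (t b 0) then upd t b 0 i else t)"
          using p nonneg fx fb b i(3) by (simp add: body_def)
        moreover have "f i \<le> f y" if "f i < f (t b 0)" "0 \<le> y" "y < i" "P y" for y
          using b(4)[of y] that by simp
        ultimately show ?thesis using True b i bx unfolding Q_def
          by (auto simp: upd_apply lt simp del: zle_add1_eq_le)
      qed
    qed
  qed (use bx n in \<open>auto simp: Q_def upd_apply s0_def mods\<close>)
  then show ?thesis by (simp add: v search_def body_def[symmetric] s0_def[symmetric] Q_def)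
qed

text \<open>\<open>Den\<close> becomes \<open>2 * n + 1\<close> times the denominator of the
  threshold times the product of all denominators of distances. The input has five leading cells,
  then the facility flags, the client flags and, from cell \<open>2 * n + 5\<close> on, numerators
  alternating with denominators; hence the offsets 5 and 6.\<close>

definition scale_instance :: cm where
  "scale_instance = block
    [Put Den (Lit 0) (Op Add (Op Add (V Size) (V Size)) (Lit 1)),
     Scale Den (Lit 0) (V Den) (Lit 2),
     For I0 (Op Mul (V Size) (V Size))
       (Scale Den (Lit 0) (V Den)
         (Op Add (Op Mul (Lit 2) (Op Add (V Size) (V I0))) (Lit 6))),
     Scale Thr (Lit 0) (V Den) (Lit 1),
     Scale Tmp (Lit 0) (Lit 1) (Lit 2),
     Put Thr (Lit 0) (Op Div (V Thr) (V Tmp)),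
     For I0 (V Size) (block
       [Scale IsFac (V I0) (Lit 1) (Op Add (V I0) (Lit 5)),
        Scale IsCli (V I0) (Lit 1) (Op Add (Op Add (V Size) (V I0)) (Lit 5))]),
     For I0 (Op Mul (V Size) (V Size)) (block
       [Scale Dist (V I0) (V Den) (Op Add (Op Mul (Lit 2) (Op Add (V Size) (V I0))) (Lit 5)),
        Scale Tmp (Lit 0) (Lit 1) (Op Add (Op Mul (Lit 2) (Op Add (V Size) (V I0))) (Lit 6)),
        Put Dist (V I0) (Op Div (Arr Dist (V I0)) (V Tmp))])]"

text \<open>An accumulator above the threshold marks an open facility that has no group to join;
  hence \<open>Acc\<close> starts at \<open>Thr + 1\<close>.\<close>

definition init :: cm where
  "init = For I0 (V Size) (block
    [Put Price (V I0) (Lit 2), Put Fac (V I0) (Lit (-1)), Put Load (V I0) (Lit 0),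
     Put Opened (V I0) (Lit 0), Put Mass (V I0) (Lit 0),
     Put Acc (V I0) (Op Add (V Thr) (Lit 1))])"

definition relieve :: cm where
  "relieve = Then
    (search Kick I1 (eq (Arr Fac (V I1)) (V Cand))
       (lt (Arr Paid (V I1)) (Arr Price (V Cand))) (\<lambda>_. Lit 0))
    (Cond (lt (V Kick) (Lit 0))
       (Put Price (V Cand) (Op Add (Arr Price (V Cand)) (Lit 1)))
       (Then (Put Fac (V Kick) (Lit (-1)))
         (Put Load (V Cand) (Op Sub (Arr Load (V Cand)) (dst (V Cand) (V Kick))))))"

definition assign :: cm where
  "assign = Then
    (search Cand I1 (lt (Lit 0) (Arr IsFac (V I1))) (le (dst (V I1) (V Client)) (V Thr))
       (\<lambda>e. Op Mul (Arr Price e) (dst e (V Client))))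
    (Cond (le (Lit 0) (V Cand)) (block
       [Put Fac (V Client) (V Cand),
        Put Paid (V Client) (Arr Price (V Cand)),
        Put Load (V Cand) (Op Add (Arr Load (V Cand)) (dst (V Cand) (V Client)))]) Pass)"

definition bid :: cm where
  "bid = Then
    (search Cand I1 (lt (Lit 0) (Arr IsFac (V I1)))
       (lt (Op Add (V Thr) (V Thr)) (Arr Load (V I1))) (\<lambda>_. Lit 0))
    (Cond (le (Lit 0) (V Cand)) relieve
      (Then
        (search Client I1 (lt (Lit 0) (Arr IsCli (V I1))) (lt (Arr Fac (V I1)) (Lit 0)) (\<lambda>_. Lit 0))
        (Cond (le (Lit 0) (V Client)) assign Pass)))"

text \<open>For \<open>n\<close> at least 1, the bound 4n^3 + 8n^2 + 2n on the potential of the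
  auction is below 16n^3. Once no client is unassigned and no facility overloaded, the remaining
  rounds are idle.\<close>

definition auction_loop :: cm where
  "auction_loop =
     For I0 (Op Mul (Lit 16) (Op Mul (V Size) (Op Mul (V Size) (V Size)))) bid"

text \<open>The smallest ratio of cost to size is attained by a prefix of the distance order, so it
  suffices to try, for each client, the prefix that ends at the distance of its facility.\<close>

definition radii :: cm where
  "radii = For I0 (V Size) (Then (Put Key (V I0) (V Thr))
    (For I1 (V Size) (Cond (le (Lit 0) (Arr Fac (V I1))) (block
      [Put Sum (Lit 0) (V Thr),
       Put Cnt (Lit 0) (Lit 0),
       For I2 (V Size) (Cond (le (Lit 0) (Arr Fac (V I2)))
         (Cond (le (dst (V I0) (Arr Fac (V I2))) (dst (V I0) (Arr Fac (V I1))))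
           (Then (Put Sum (Lit 0) (Op Add (V Sum) (dst (V I0) (Arr Fac (V I2)))))
             (Put Cnt (Lit 0) (Op Add (V Cnt) (Lit 1)))) Pass) Pass),
       Put Sum (Lit 0) (Op Div (V Sum) (V Cnt)),
       Cond (lt (V Sum) (Arr Key (V I0))) (Put Key (V I0) (V Sum)) Pass]) Pass)))"

text \<open>A selection sort of the facilities in use that executes \<open>body\<close> on each in
  turn. It runs once with the radii as keys, to open facilities, and once with the distances to the
  open ones, to form groups.\<close>

definition by_key :: "cm \<Rightarrow> cm" where
  "by_key body = block
    [For I0 (V Size) (Put Todo (V I0) (Lit 0)),
     For I0 (V Size) (Cond (le (Lit 0) (Arr Fac (V I0))) (Put Todo (Arr Fac (V I0)) (Lit 1)) Pass),
     For I0 (V Size) (Then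
       (search Best I1 (lt (Lit 0) (Arr Todo (V I1))) (Lit 1) (\<lambda>e. Arr Key e))
       (Cond (le (Lit 0) (V Best)) (Then (Put Todo (V Best) (Lit 0)) body) Pass))]"

definition open_step :: cm where
  "open_step = Then
    (search Hit I2 (lt (Lit 0) (Arr Opened (V I2)))
      (le (dst (V Best) (V I2)) (Op Add (Arr Key (V Best)) (Arr Key (V Best)))) (\<lambda>_. Lit 0))
    (Cond (lt (V Hit) (Lit 0)) (Put Opened (V Best) (Lit 1)) Pass)"

definition nearest :: cm where
  "nearest = For I0 (V Size) (block
    [search Best I1 (lt (Lit 0) (Arr Opened (V I1))) (Lit 1) (\<lambda>e. dst (V I0) e),
     Put Nearest (V I0) (V Best),
     Put Key (V I0) (dst (V I0) (V Best))])"

text \<open>By now \<open>Key\<close> holds the distance to the nearest open facility. The mass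
  bounds the load of the facility's clients at any group leader: the leader belongs to the same open
  facility and is at least as close to it, so the way to it is at most twice the key.\<close>

definition masses :: cm where
  "masses = For I0 (V Size) (Cond (le (Lit 0) (Arr Fac (V I0)))
     (Put Mass (Arr Fac (V I0)) (Op Add (Arr Mass (Arr Fac (V I0)))
       (Op Add (dst (Arr Fac (V I0)) (V I0))
         (Op Add (Arr Key (Arr Fac (V I0))) (Arr Key (Arr Fac (V I0))))))) Pass)"

text \<open>A facility of mass more than \<open>T\<close> keeps its clients, as does the leader of a
  group. A light facility joins the current group of its open facility while the accumulated mass is
  at most \<open>T\<close>, which keeps the total at most \<open>2 * T\<close>.\<close>

definition merge_step :: cm where
  "merge_step = Cond (lt (V Thr) (Arr Mass (V Best)))
    (Put Final (V Best) (V Best))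
    (Cond (lt (V Thr) (Arr Acc (Arr Nearest (V Best))))
      (block
        [Put Lead (Arr Nearest (V Best)) (V Best),
         Put Acc (Arr Nearest (V Best)) (Arr Mass (V Best)),
         Put Final (V Best) (V Best)])
      (Then
        (Put Acc (Arr Nearest (V Best))
          (Op Add (Arr Acc (Arr Nearest (V Best))) (Arr Mass (V Best))))
        (Put Final (V Best) (Arr Lead (Arr Nearest (V Best))))))"

text \<open>The number of clients is known only after the scan, so the clients are written two cells
  ahead and the header is filled in afterwards. A point without clients advances nothing, and its
  two reserved cells are reused.\<close>

definition write_star :: cm where
  "write_star = block
    [Put Cnt (Lit 0) (Lit 0),
     For I1 (V Size) (Cond (le (Lit 0) (Arr Fac (V I1)))
       (Cond (eq (Arr Final (Arr Fac (V I1))) (V I0))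
         (Then (Out (Op Add (Op Add (V Pos) (V Cnt)) (Lit 2)) (V I1))
           (Put Cnt (Lit 0) (Op Add (V Cnt) (Lit 1)))) Pass) Pass),
     Cond (lt (Lit 0) (V Cnt)) (block
       [Out (V Pos) (V I0),
        Out (Op Add (V Pos) (Lit 1)) (V Cnt),
        Put Pos (Lit 0) (Op Add (Op Add (V Pos) (V Cnt)) (Lit 2)),
        Put Stars (Lit 0) (Op Add (V Stars) (Lit 1))]) Pass]"

definition write_stars :: cm where
  "write_stars = block
    [Put Pos (Lit 0) (Lit 1), Put Stars (Lit 0) (Lit 0),
     For I0 (V Size) write_star, Out (Lit 0) (V Stars)]"

definition solve :: cm where
  "solve = block [init, auction_loop, radii, by_key open_step, nearest, masses, by_key merge_step]"

definition star_cover_program :: com where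
  "star_cover_program = program scale_instance (Then solve write_stars)"

lemmas program_defs = scale_instance_def init_def relieve_def assign_def bid_def auction_loop_def radii_def
  by_key_def open_step_def nearest_def masses_def merge_step_def write_star_def write_stars_def solve_def

lemma scale_instance_well_formed:
  "well_formed scale_instance" "Size \<notin> mods scale_instance" "IO \<notin> mods scale_instance"
  by (simp_all add: program_defs)

lemma solve_write_well_formed:
  "well_formed (Then solve write_stars)" "Size \<notin> mods (Then solve write_stars)" "\<not> scales (Then solve write_stars)"
  by (simp_all add: program_defs)

lemma loop_bounds:
  assumes "e \<in> bounds scale_instance \<union> bounds (Then solve write_stars)" "0 \<le> s Size 0"
  shows "ev s e \<le> int (poly [:0, 0, 0, 16:] (nat (s Size 0)))"
proof -
  define n where "n = s Size 0"
  have n: "0 \<le> n" using assms by (simp add: n_def)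
  have "n \<le> 16 * (n * (n * n)) \<and> n * n \<le> 16 * (n * (n * n))"
  proof (cases "n = 0")
    case False
    with n have "1 \<le> n" by simp
    then have "n * 1 \<le> n * n" "n * n * 1 \<le> n * n * n" by (auto intro!: mult_left_mono)
    moreover have "0 \<le> n * (n * n)" using n by simp
    ultimately show ?thesis by (simp add: algebra_simps)
  qed simp
  moreover have "int (poly [:0, 0, 0, 16:] (nat n)) = 16 * (n * (n * n))"
    using n by simp
  moreover have "ev s e \<in> {n, n * n, 16 * (n * (n * n))}"
    using assms(1) by (auto simp: program_defs n_def)
  ultimately show ?thesis using n by (auto simp: n_def)
qed

section \<open>Correctness of the auction\<close>

locale integral_instance =
  fixes n T :: int and F C :: "int set" and d :: "int \<Rightarrow> int \<Rightarrow> int"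
  assumes n: "0 \<le> n" and T: "0 \<le> T" and FC: "F \<subseteq> {0..<n}" "C \<subseteq> {0..<n}"
    and nonneg: "\<And>x y. x \<in> {0..<n} \<Longrightarrow> y \<in> {0..<n} \<Longrightarrow> 0 \<le> d x y"
    and self_dist: "\<And>x. x \<in> {0..<n} \<Longrightarrow> d x x = 0"
    and sym: "\<And>x y. x \<in> {0..<n} \<Longrightarrow> y \<in> {0..<n} \<Longrightarrow> d x y = d y x"
    and triangle: "\<And>x y z. x \<in> {0..<n} \<Longrightarrow> y \<in> {0..<n} \<Longrightarrow> z \<in> {0..<n} \<Longrightarrow> d x z \<le> d x y + d y z"
begin

lemma finite_FC: "finite F" "finite C"
  using FC finite_subset by blast+

lemma pts: "f \<in> F \<Longrightarrow> 0 \<le> f" "f \<in> F \<Longrightarrow> f < n" "c \<in> C \<Longrightarrow> 0 \<le> c" "c \<in> C \<Longrightarrow> c < n"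
  using FC by auto

definition env :: "state \<Rightarrow> bool" where
  "env s \<longleftrightarrow> s Size 0 = n \<and> s Thr 0 = T \<and>
     (\<forall>v. 0 \<le> v \<longrightarrow> v < n \<longrightarrow> (0 < s IsFac v \<longleftrightarrow> v \<in> F) \<and> (0 < s IsCli v \<longleftrightarrow> v \<in> C)) \<and>
     (\<forall>u v. 0 \<le> u \<longrightarrow> u < n \<longrightarrow> 0 \<le> v \<longrightarrow> v < n \<longrightarrow> s Dist (u * n + v) = d u v)"

lemma envD:
  assumes "env s"
  shows "s Size 0 = n" "s Thr 0 = T"
    "0 \<le> v \<Longrightarrow> v < n \<Longrightarrow> 0 < s IsFac v \<longleftrightarrow> v \<in> F"
    "0 \<le> v \<Longrightarrow> v < n \<Longrightarrow> 0 < s IsCli v \<longleftrightarrow> v \<in> C"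
    "0 \<le> u \<Longrightarrow> u < n \<Longrightarrow> 0 \<le> v \<Longrightarrow> v < n \<Longrightarrow> s Dist (u * n + v) = d u v"
  using assms by (auto simp: env_def)

lemma env_cong:
  assumes "\<And>y. y \<in> {Size, Thr, IsFac, IsCli, Dist} \<Longrightarrow> t y = s y"
  shows "env t \<longleftrightarrow> env s"
  using assms by (simp add: env_def)

lemma env_run: "{Size, Thr, IsFac, IsCli, Dist} \<inter> mods c = {} \<Longrightarrow> env (run c s) \<longleftrightarrow> env s"
  by (intro env_cong run_unmodified) auto

definition active :: "(int \<Rightarrow> int) \<Rightarrow> int set" where
  "active fac = {c. 0 \<le> c \<and> c < n \<and> 0 \<le> fac c}"

lemma finite_active: "finite (active fac)"
  by (rule finite_subset[of _ "{0..<n}"]) (auto simp: active_def)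

definition star_load_of :: "(int \<Rightarrow> int) \<Rightarrow> int \<Rightarrow> int" where
  "star_load_of fac f = (\<Sum>c | c \<in> active fac \<and> fac c = f. d f c)"

text \<open>The state-dependent premises of \<open>auction\<close> without a competing assignment,
  so that they hold on infeasible instances as well. In addition, clients are within distance
  \<open>T\<close> of their facilities, which limits the effect of an eviction, and nobody has paid
  more than the current price.\<close>

definition auction_inv :: "(int \<Rightarrow> int) \<Rightarrow> (int \<Rightarrow> int) \<Rightarrow> (int \<Rightarrow> int) \<Rightarrow> (int \<Rightarrow> int) \<Rightarrow> bool" where
  "auction_inv price fac paid load \<longleftrightarrow>
     (\<forall>c\<in>active fac. c \<in> C \<and> fac c \<in> F \<and> d (fac c) c \<le> T \<and>
        2 \<le> paid c \<and> price (fac c) - 1 \<le> paid c \<and> paid c \<le> price (fac c) \<and>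
        (\<forall>f\<in>F. d f c \<le> T \<longrightarrow> paid c * d (fac c) c \<le> price f * d f c)) \<and>
     (\<forall>f\<in>F. 2 \<le> price f \<and> load f = star_load_of fac f \<and> (2 < price f \<longrightarrow> T \<le> load f))"

lemma auction_inv_client:
  assumes "auction_inv price fac paid load" "c \<in> active fac"
  shows "c \<in> C \<and> fac c \<in> F \<and> d (fac c) c \<le> T \<and> 2 \<le> paid c \<and> price (fac c) - 1 \<le> paid c \<and>
    paid c \<le> price (fac c) \<and> (\<forall>f\<in>F. d f c \<le> T \<longrightarrow> paid c * d (fac c) c \<le> price f * d f c)"
  using assms unfolding auction_inv_def by blast

lemma auction_inv_facility:
  assumes "auction_inv price fac paid load" "f \<in> F"
  shows "2 \<le> price f" "load f = star_load_of fac f" "2 < price f \<Longrightarrow> T \<le> load f"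
  using assms unfolding auction_inv_def by blast+

lemma star_of_assign:
  assumes "j \<in> C" "fac j < 0" "i \<in> F"
  shows "{c \<in> active (fac(j := i)). (fac(j := i)) c = f} =
    (if f = i then insert j {c \<in> active fac. fac c = f} else {c \<in> active fac. fac c = f})"
  using assms pts by (auto simp: active_def)

lemma star_of_kick:
  assumes "l \<in> active fac" "fac l = i"
  shows "{c \<in> active (fac(l := -1)). (fac(l := -1)) c = f} =
    (if f = i then {c \<in> active fac. fac c = f} - {l} else {c \<in> active fac. fac c = f})"
  using assms by (auto simp: active_def)

lemma auction_inv_assign:
  assumes inv: "auction_inv price fac paid load"
    and j: "j \<in> C" "fac j < 0" and i: "i \<in> F" "d i j \<le> T"
    and best: "\<And>f. f \<in> F \<Longrightarrow> d f j \<le> T \<Longrightarrow> price i * d i j \<le> price f * d f j"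
  shows "auction_inv price (fac(j := i)) (paid(j := price i)) (load(i := load i + d i j))"
proof -
  have act: "active (fac(j := i)) = insert j (active fac)"
    using j i pts by (auto simp: active_def)
  have ij: "0 \<le> d i j" using i j FC by (intro nonneg) auto
  have "star_load_of (fac(j := i)) f = (if f = i then star_load_of fac f + d i j else star_load_of fac f)" for f
  proof -
    have "finite {c \<in> active fac. fac c = i}"
      by (rule finite_subset[OF _ finite_active[of fac]]) auto
    moreover have "j \<notin> {c \<in> active fac. fac c = i}" using j(2) by (simp add: active_def)
    ultimately show ?thesis
      unfolding star_load_of_def star_of_assign[of j fac i, OF j i(1)] by simp
  qed
  note load = this
  show ?thesis unfolding auction_inv_def
  proof (intro conjI ballI)
    fix c assume c: "c \<in> active (fac(j := i))"
    have "c \<in> C \<and> (fac(j := i)) c \<in> F \<and> d ((fac(j := i)) c) c \<le> T \<and> 2 \<le> (paid(j := price i)) c \<and>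
        price ((fac(j := i)) c) - 1 \<le> (paid(j := price i)) c \<and>
        (paid(j := price i)) c \<le> price ((fac(j := i)) c) \<and>
        (\<forall>f\<in>F. d f c \<le> T \<longrightarrow> (paid(j := price i)) c * d ((fac(j := i)) c) c \<le> price f * d f c)"
    proof (cases "c = j")
      case True
      have "2 \<le> price i" using inv i by (simp add: auction_inv_def)
      with True show ?thesis using i j best by simp
    next
      case False
      with c have "c \<in> active fac" by (simp add: act)
      then have "c \<in> C \<and> fac c \<in> F \<and> d (fac c) c \<le> T \<and> 2 \<le> paid c \<and> price (fac c) - 1 \<le> paid c \<and>
          paid c \<le> price (fac c) \<and> (\<forall>f\<in>F. d f c \<le> T \<longrightarrow> paid c * d (fac c) c \<le> price f * d f c)"
        by (rule auction_inv_client[OF inv])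
      then show ?thesis unfolding fun_upd_other[OF False] .
    qed
    then show "c \<in> C" "(fac(j := i)) c \<in> F" "d ((fac(j := i)) c) c \<le> T" "2 \<le> (paid(j := price i)) c"
        "price ((fac(j := i)) c) - 1 \<le> (paid(j := price i)) c"
        "(paid(j := price i)) c \<le> price ((fac(j := i)) c)"
        "\<And>f. f \<in> F \<Longrightarrow> d f c \<le> T \<longrightarrow> (paid(j := price i)) c * d ((fac(j := i)) c) c \<le> price f * d f c"
      by blast+
  next
    fix f assume f: "f \<in> F"
    note * = auction_inv_facility[OF inv f]
    show "2 \<le> price f" by fact
    show "(load(i := load i + d i j)) f = star_load_of (fac(j := i)) f"
      unfolding load using * by (cases "f = i") auto
    show "2 < price f \<longrightarrow> T \<le> (load(i := load i + d i j)) f"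
      using * ij by auto
  qed
qed

text \<open>If every client of \<open>i\<close> has paid at least the current price, then after the
  raise they lag by at most 1, and the overload guarantees the load \<open>T\<close> demanded of a
  raised facility. For other clients a higher price only makes \<open>i\<close> less
  attractive.\<close>

lemma auction_inv_raise:
  assumes inv: "auction_inv price fac paid load" and i: "i \<in> F" "2 * T < load i"
    and all: "\<And>c. c \<in> active fac \<Longrightarrow> fac c = i \<Longrightarrow> price i \<le> paid c"
  shows "auction_inv (price(i := price i + 1)) fac paid load"
proof -
  have stable: "paid c * d (fac c) c \<le> (price f + 1) * d f c"
    if "c \<in> active fac" "f \<in> F" "d f c \<le> T" for c f
  proof -
    have "c \<in> C" using auction_inv_client[OF inv that(1)] by blast
    then have "0 \<le> d f c" using that(2) FC by (intro nonneg) auto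
    moreover have "paid c * d (fac c) c \<le> price f * d f c"
      using auction_inv_client[OF inv that(1)] that(2,3) by blast
    ultimately show ?thesis by (simp add: algebra_simps)
  qed
  show ?thesis unfolding auction_inv_def
  proof (intro conjI ballI)
    fix c assume c: "c \<in> active fac"
    have *: "c \<in> C" "fac c \<in> F" "d (fac c) c \<le> T" "2 \<le> paid c" "price (fac c) - 1 \<le> paid c"
      "paid c \<le> price (fac c)" "\<And>f. f \<in> F \<Longrightarrow> d f c \<le> T \<Longrightarrow> paid c * d (fac c) c \<le> price f * d f c"
      using auction_inv_client[OF inv c] by blast+
    show "c \<in> C" "fac c \<in> F" "d (fac c) c \<le> T" "2 \<le> paid c" by fact+
    show "(price(i := price i + 1)) (fac c) - 1 \<le> paid c" "paid c \<le> (price(i := price i + 1)) (fac c)"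
      using * all[OF c] by auto
    show "d f c \<le> T \<longrightarrow> paid c * d (fac c) c \<le> (price(i := price i + 1)) f * d f c" if "f \<in> F" for f
      using *(7)[OF that] stable[OF c that] by (cases "f = i") auto
  next
    fix f assume f: "f \<in> F"
    note * = auction_inv_facility[OF inv f]
    show "2 \<le> (price(i := price i + 1)) f" "load f = star_load_of fac f"
        "2 < (price(i := price i + 1)) f \<longrightarrow> T \<le> load f"
      using * i T by (cases "f = i"; simp)+
  qed
qed

text \<open>The evicted client is within distance \<open>T\<close>, so a load above
  \<open>2 * T\<close> stays above \<open>T\<close>. This is why only an excess over
  \<open>2 * T\<close> triggers an eviction.\<close>

lemma auction_inv_kick:
  assumes inv: "auction_inv price fac paid load" and i: "2 * T < load i"
    and l: "l \<in> active fac" "fac l = i"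
  shows "auction_inv price (fac(l := -1)) paid (load(i := load i - d i l))"
proof -
  have act: "active (fac(l := -1)) = active fac - {l}"
    using l by (auto simp: active_def)
  have "star_load_of (fac(l := -1)) f = (if f = i then star_load_of fac f - d i l else star_load_of fac f)" for f
    using l finite_active[of fac] unfolding star_load_of_def star_of_kick[of l fac i, OF l]
    by (auto simp: sum_diff1)
  note load = this
  have dl: "d i l \<le> T" using auction_inv_client[OF inv l(1)] l(2) by blast
  show ?thesis unfolding auction_inv_def
  proof (intro conjI ballI)
    fix c assume "c \<in> active (fac(l := -1))"
    then have c: "c \<in> active fac" "c \<noteq> l" by (auto simp: act)
    show "c \<in> C" "(fac(l := -1)) c \<in> F" "d ((fac(l := -1)) c) c \<le> T" "2 \<le> paid c"
        "price ((fac(l := -1)) c) - 1 \<le> paid c" "paid c \<le> price ((fac(l := -1)) c)"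
        "\<And>f. f \<in> F \<Longrightarrow> d f c \<le> T \<longrightarrow> paid c * d ((fac(l := -1)) c) c \<le> price f * d f c"
      using auction_inv_client[OF inv c(1)] unfolding fun_upd_other[OF c(2)] by blast+
  next
    fix f assume f: "f \<in> F"
    note * = auction_inv_facility[OF inv f]
    show "2 \<le> price f" by fact
    show "(load(i := load i - d i l)) f = star_load_of (fac(l := -1)) f"
      unfolding load using * by (cases "f = i") auto
    show "2 < price f \<longrightarrow> T \<le> (load(i := load i - d i l)) f"
      using * i dl by auto
  qed
qed

text \<open>The potential counts assignments twice, since every assignment may be undone once without a
  change of price.\<close>

definition potential :: "(int \<Rightarrow> int) \<Rightarrow> (int \<Rightarrow> int) \<Rightarrow> (int \<Rightarrow> int) \<Rightarrow> int" where
  "potential price fac paid =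
     2 * (\<Sum>f\<in>F. price f * (n + 1) + int (card {c \<in> active fac. fac c = f \<and> paid c = price f})) -
     int (card (active fac))"

lemma card_active: "int (card (active fac)) \<le> n"
proof -
  have "card (active fac) \<le> card {0..<n}" by (intro card_mono) (auto simp: active_def)
  then show ?thesis using n by simp
qed

lemma sum_raise:
  assumes "i \<in> F" "\<And>f. f \<in> F \<Longrightarrow> f \<noteq> i \<Longrightarrow> g f = h f" "h i + k \<le> (g i :: int)"
  shows "sum h F + k \<le> sum g F"
  using assms finite_FC(1) by (simp add: sum.remove[of F i])

lemma potential_assign:
  assumes "j \<in> C" "fac j < 0" "i \<in> F"
  shows "potential price fac paid + 1 \<le> potential price (fac(j := i)) (paid(j := price i))"
proof -
  have act: "active (fac(j := i)) = insert j (active fac)" "j \<notin> active fac"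
    using assms pts by (auto simp: active_def)
  have eq: "{c \<in> active (fac(j := i)). (fac(j := i)) c = f \<and> (paid(j := price i)) c = price f} =
      (if f = i then insert j {c \<in> active fac. fac c = f \<and> paid c = price f}
       else {c \<in> active fac. fac c = f \<and> paid c = price f})" for f
    using assms act by auto
  have "(\<Sum>f\<in>F. price f * (n + 1) + int (card {c \<in> active fac. fac c = f \<and> paid c = price f})) + 1
    \<le> (\<Sum>f\<in>F. price f * (n + 1) + int (card {c \<in> active (fac(j := i)).
         (fac(j := i)) c = f \<and> (paid(j := price i)) c = price f}))"
    using assms act finite_active[of fac] unfolding eq by (intro sum_raise[of i]) auto
  then show ?thesis
    using act finite_active[of fac] by (simp add: potential_def)
qed

text \<open>A raise makes up to \<open>n\<close> clients out of date; the weight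
  \<open>n + 1\<close> of a unit of price outweighs them.\<close>

lemma potential_raise:
  assumes i: "i \<in> F"
  shows "potential price fac paid + 1 \<le> potential (price(i := price i + 1)) fac paid"
proof -
  have "int (card {c \<in> active fac. fac c = i \<and> paid c = price i}) \<le> int (card (active fac))"
    using finite_active by (auto intro!: card_mono)
  also have "\<dots> \<le> n" by (rule card_active)
  finally have *: "int (card {c \<in> active fac. fac c = i \<and> paid c = price i}) \<le> n" .
  have "(\<Sum>f\<in>F. price f * (n + 1) + int (card {c \<in> active fac. fac c = f \<and> paid c = price f})) + 1
    \<le> (\<Sum>f\<in>F. (price(i := price i + 1)) f * (n + 1) +
         int (card {c \<in> active fac. fac c = f \<and> paid c = (price(i := price i + 1)) f}))"
    using i * by (intro sum_raise[of i]) (auto simp: algebra_simps)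
  then show ?thesis by (simp add: potential_def)
qed

text \<open>An evicted client had paid less than the current price and so was not counted among the
  up-to-date ones; only the subtracted number of assigned clients changes.\<close>

lemma potential_kick:
  assumes l: "l \<in> active fac" "fac l = i" "paid l \<noteq> price i"
  shows "potential price fac paid + 1 \<le> potential price (fac(l := -1)) paid"
proof -
  have act: "active (fac(l := -1)) = active fac - {l}"
    using l by (auto simp: active_def)
  have "{c \<in> active (fac(l := -1)). (fac(l := -1)) c = f \<and> paid c = price f} =
      {c \<in> active fac. fac c = f \<and> paid c = price f}" for f
    using l by (auto simp: act)
  moreover have "card (active fac) = card (active fac - {l}) + 1"
    using card_Suc_Diff1[OF finite_active l(1)] by simp
  ultimately show ?thesis by (simp add: potential_def act)
qed

lemma potential_bound:
  assumes "\<And>f. f \<in> F \<Longrightarrow> price f \<le> 2 * n + 1"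
  shows "potential price fac paid \<le> 2 * (n * ((2 * n + 1) * (n + 1) + n))"
proof -
  have "price f * (n + 1) + int (card {c \<in> active fac. fac c = f \<and> paid c = price f})
      \<le> (2 * n + 1) * (n + 1) + n" if "f \<in> F" for f
  proof -
    have "int (card {c \<in> active fac. fac c = f \<and> paid c = price f}) \<le> int (card (active fac))"
      using finite_active by (auto intro!: card_mono)
    moreover have "price f * (n + 1) \<le> (2 * n + 1) * (n + 1)"
      using assms[OF that] n by (intro mult_right_mono) auto
    ultimately show ?thesis using card_active[of fac] by linarith
  qed
  then have "(\<Sum>f\<in>F. price f * (n + 1) + int (card {c \<in> active fac. fac c = f \<and> paid c = price f}))
      \<le> int (card F) * ((2 * n + 1) * (n + 1) + n)"
    by (rule sum_bounded_above)
  also have "\<dots> \<le> n * ((2 * n + 1) * (n + 1) + n)"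
  proof (intro mult_right_mono)
    have "card F \<le> card {0..<n}" using FC by (intro card_mono) auto
    then show "int (card F) \<le> n" using n by simp
  qed (use n in auto)
  finally show ?thesis by (simp add: potential_def)
qed

definition feasible :: "(int \<Rightarrow> int) \<Rightarrow> bool" where
  "feasible opt \<longleftrightarrow> (\<forall>c\<in>C. opt c \<in> F) \<and> (\<forall>f\<in>F. (\<Sum>c | c \<in> C \<and> opt c = f. d f c) \<le> T)"

lemma auction_locale:
  assumes "feasible opt" "auction_inv price fac paid load"
  shows "auction F C (active fac) d T opt fac price paid"
proof
  show "active fac \<subseteq> C" using assms by (auto simp: auction_inv_def)
  show "0 \<le> d f c" if "f \<in> F" "c \<in> C" for f c using FC that by (intro nonneg) auto
qed (use assms finite_FC T in \<open>auto simp: feasible_def auction_inv_def star_load_of_def\<close>)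

lemma raised_price:
  assumes "feasible opt" "auction_inv price fac paid load" "i \<in> F" "2 * T < load i"
  shows "price i \<le> 2 * int (card (opt ` C))" 
proof -
  interpret auction F C "active fac" d T opt fac price paid by (rule auction_locale[OF assms(1,2)])
  have load: "auction.load (active fac) d fac i = load i"
    using assms(2,3) by (simp add: load_def auction_inv_def star_load_of_def)
  \<comment> \<open>If \<open>T\<close> were 0, all clients would be at distance 0 from their
    facilities and no facility could be overloaded.\<close>
  have "0 < T"
  proof (rule ccontr)
    assume "\<not> 0 < T"
    have "load i \<le> (\<Sum>c | c \<in> active fac \<and> fac c = i. 0)"
      using assms(2,3) \<open>\<not> 0 < T\<close> unfolding load[symmetric] load_def
      by (intro sum_mono) (fastforce simp: auction_inv_def)
    then show False using assms(4) T by simp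
  qed
  then show ?thesis using overloaded_price[of i] assms load by simp
qed

lemma card_opt: "int (card (opt ` C)) \<le> n"
proof -
  have "card (opt ` C) \<le> card {0..<n}"
    using card_image_le[OF finite_FC(2), of opt] card_mono[OF _ FC(2)] by simp
  then show ?thesis using n by simp
qed

definition settled :: "(int \<Rightarrow> int) \<Rightarrow> (int \<Rightarrow> int) \<Rightarrow> bool" where
  "settled fac load \<longleftrightarrow> active fac = C \<and> (\<forall>f\<in>F. load f \<le> 2 * T)"

text \<open>The invariant is preserved unconditionally. Feasibility is needed for progress, since
  otherwise a client might have no facility within distance \<open>T\<close>, and for the price
  bound: only an overloaded facility raises its price, from at most \<open>2 * n\<close>.\<close>

lemma run_bid:
  assumes env: "env s" and inv: "auction_inv (s Price) (s Fac) (s Paid) (s Load)" and t: "t = run bid s"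
  shows "auction_inv (t Price) (t Fac) (t Paid) (t Load) \<and>
    (feasible opt \<longrightarrow> (\<forall>f\<in>F. s Price f \<le> 2 * n + 1) \<longrightarrow>
      (\<forall>f\<in>F. t Price f \<le> 2 * n + 1) \<and>
      (if settled (s Fac) (s Load) then settled (t Fac) (t Load)
       else potential (s Price) (s Fac) (s Paid) + 1 \<le> potential (t Price) (t Fac) (t Paid)))"
proof -
  note e = envD[OF env]
  define c1 where "c1 = search Cand I1 (lt (Lit 0) (Arr IsFac (V I1)))
       (lt (Op Add (V Thr) (V Thr)) (Arr Load (V I1))) (\<lambda>_. Lit 0)"
  define s1 where "s1 = run c1 s"
  define i where "i = s1 Cand 0"
  have s1: "s1 y = s y" if "y \<noteq> Cand" "y \<noteq> I1" for y
    using that by (simp add: s1_def c1_def run_unmodified)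
  have env1: "env s1" using env by (subst env_cong[of _ s]) (auto simp: s1)
  have i: "i = -1 \<and> (\<forall>y. 0 \<le> y \<longrightarrow> y < n \<longrightarrow> \<not> (y \<in> F \<and> 2 * T < s Load y)) \<or>
     0 \<le> i \<and> i < n \<and> (i \<in> F \<and> 2 * T < s Load i) \<and>
      (\<forall>y. 0 \<le> y \<longrightarrow> y < n \<longrightarrow> y \<in> F \<and> 2 * T < s Load y \<longrightarrow> (0::int) \<le> 0)"
    unfolding i_def s1_def c1_def
    by (rule run_search[where s = s]) (use e n in \<open>auto\<close>)
  show ?thesis
  proof (cases "0 \<le> i")
    case True
    with i have iF: "i \<in> F" "2 * T < s Load i" "0 \<le> i" "i < n" by simp_all
    then have unsettled: "\<not> settled (s Fac) (s Load)" by (auto simp: settled_def not_le)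
    define c2 where "c2 = search Kick I1 (eq (Arr Fac (V I1)) (V Cand))
       (lt (Arr Paid (V I1)) (Arr Price (V Cand))) (\<lambda>_. Lit 0)"
    define s2 where "s2 = run c2 s1"
    define l where "l = s2 Kick 0"
    have s2: "s2 y = s y" if "y \<noteq> Cand" "y \<noteq> I1" "y \<noteq> Kick" for y
      using that s1 by (simp add: s2_def c2_def run_unmodified)
    have s2c: "s2 Cand 0 = i" by (simp add: s2_def c2_def run_unmodified i_def)
    have l: "l = -1 \<and> (\<forall>y. 0 \<le> y \<longrightarrow> y < n \<longrightarrow> \<not> (s Fac y = i \<and> s Paid y < s Price i)) \<or>
       0 \<le> l \<and> l < n \<and> (s Fac l = i \<and> s Paid l < s Price i) \<and>
      (\<forall>y. 0 \<le> y \<longrightarrow> y < n \<longrightarrow> s Fac y = i \<and> s Paid y < s Price i \<longrightarrow> (0::int) \<le> 0)"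
      unfolding l_def s2_def c2_def
      by (rule run_search[where s = s1]) (use envD[OF env1] n in \<open>auto simp: s1 i_def\<close>)
    have t2: "t = run (Cond (lt (V Kick) (Lit 0))
       (Put Price (V Cand) (Op Add (Arr Price (V Cand)) (Lit 1)))
       (Then (Put Fac (V Kick) (Lit (-1)))
         (Put Load (V Cand) (Op Sub (Arr Load (V Cand)) (dst (V Cand) (V Kick)))))) s2"
      using True by (simp add: t bid_def c1_def[symmetric] s1_def[symmetric] i_def[symmetric]
          relieve_def c2_def[symmetric] s2_def[symmetric])
    show ?thesis
    proof (cases "l < 0")
      case True
      then have t': "t Price = (s Price)(i := s Price i + 1)" "t Fac = s Fac" "t Paid = s Paid" "t Load = s Load"
        by (auto simp: t2 l_def[symmetric] upd_apply s2 s2c)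
      have low: "s Price i \<le> s Paid c" if "c \<in> active (s Fac)" "s Fac c = i" for c
      proof -
        have "\<forall>y. 0 \<le> y \<longrightarrow> y < n \<longrightarrow> \<not> (s Fac y = i \<and> s Paid y < s Price i)"
          using l True by (elim disjE conjE) (assumption | simp)+
        then show ?thesis using that by (auto simp: active_def)
      qed
      have "s Price i \<le> 2 * n" if "feasible opt"
        using raised_price[OF that inv iF(1,2)] card_opt[of opt] by simp
      then show ?thesis
        using auction_inv_raise[OF inv iF(1,2) low] potential_raise[OF iF(1), of "s Price" "s Fac" "s Paid"] unsettled
        unfolding t' by simp
    next
      case False
      with l have l': "0 \<le> l" "l < n" "s Fac l = i" "s Paid l < s Price i" by simp_all
      have t': "t Price = s Price" "t Fac = (s Fac)(l := -1)" "t Paid = s Paid"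
          "t Load = (s Load)(i := s Load i - d i l)"
        using False iF l' e by (auto simp: t2 l_def[symmetric] upd_apply s2 s2c)
      have act: "l \<in> active (s Fac)" using l' iF by (simp add: active_def)
      show ?thesis
        using auction_inv_kick[OF inv iF(2) act l'(3)]
          potential_kick[OF act l'(3), of "s Paid" "s Price"] l'(4) unsettled
        unfolding t' by simp
    qed
  next
    case False
    have none0: "\<forall>y. 0 \<le> y \<longrightarrow> y < n \<longrightarrow> \<not> (y \<in> F \<and> 2 * T < s Load y)"
      using i False by (elim disjE conjE) (assumption | simp)+
    have none: "s Load f \<le> 2 * T" if "f \<in> F" for f
    proof -
      have "0 \<le> f" "f < n" using pts(1,2)[OF that] by auto
      with none0 that show ?thesis by auto
    qed
    define c2 where "c2 = search Client I1 (lt (Lit 0) (Arr IsCli (V I1)))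
      (lt (Arr Fac (V I1)) (Lit 0)) (\<lambda>_. Lit 0)"
    define s2 where "s2 = run c2 s1"
    define j where "j = s2 Client 0"
    have s2: "s2 y = s y" if "y \<noteq> Cand" "y \<noteq> I1" "y \<noteq> Client" for y
      using that s1 by (simp add: s2_def c2_def run_unmodified)
    have env2: "env s2" using env by (subst env_cong[of _ s]) (auto simp: s2)
    have j: "j = -1 \<and> (\<forall>y. 0 \<le> y \<longrightarrow> y < n \<longrightarrow> \<not> (y \<in> C \<and> s Fac y < 0)) \<or>
       0 \<le> j \<and> j < n \<and> (j \<in> C \<and> s Fac j < 0) \<and>
      (\<forall>y. 0 \<le> y \<longrightarrow> y < n \<longrightarrow> y \<in> C \<and> s Fac y < 0 \<longrightarrow> (0::int) \<le> 0)"
      unfolding j_def s2_def c2_def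
      by (rule run_search[where s = s1]) (use envD[OF env1] n in \<open>auto simp: s1\<close>)
    have t2: "t = run (Cond (le (Lit 0) (V Client)) assign Pass) s2"
      using False by (simp add: t bid_def c1_def[symmetric] s1_def[symmetric] i_def[symmetric]
          c2_def[symmetric] s2_def[symmetric])
    show ?thesis
    proof (cases "0 \<le> j")
      case False
      then have t': "t Price = s Price" "t Fac = s Fac" "t Paid = s Paid" "t Load = s Load"
        by (auto simp: t2 j_def[symmetric] s2)
      have "active (s Fac) = C"
      proof (rule Set.equalityI)
        show "active (s Fac) \<subseteq> C" using inv by (auto simp: auction_inv_def)
        have "\<forall>y. 0 \<le> y \<longrightarrow> y < n \<longrightarrow> \<not> (y \<in> C \<and> s Fac y < 0)"
          using j False by (elim disjE conjE) (assumption | simp)+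
        then show "C \<subseteq> active (s Fac)" using pts(3,4) by (auto simp: active_def not_less)
      qed
      then have "settled (s Fac) (s Load)" using none by (simp add: settled_def)
      then show ?thesis using inv unfolding t' by simp
    next
      case True
      with j have j': "0 \<le> j" "j < n" "j \<in> C" "s Fac j < 0" by simp_all
      then have unsettled: "\<not> settled (s Fac) (s Load)" by (auto simp: settled_def active_def)
      define c3 where "c3 = search Cand I1 (lt (Lit 0) (Arr IsFac (V I1)))
        (le (dst (V I1) (V Client)) (V Thr)) (\<lambda>e. Op Mul (Arr Price e) (dst e (V Client)))"
      define s3 where "s3 = run c3 s2"
      define k where "k = s3 Cand 0"
      have s3: "s3 y = s y" if "y \<noteq> Cand" "y \<noteq> I1" "y \<noteq> Client" for y
        using that s2 by (simp add: s3_def c3_def run_unmodified)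
      have s3c: "s3 Client 0 = j" by (simp add: s3_def c3_def run_unmodified j_def)
      have k: "k = -1 \<and> (\<forall>y. 0 \<le> y \<longrightarrow> y < n \<longrightarrow> \<not> (y \<in> F \<and> d y j \<le> T)) \<or>
         0 \<le> k \<and> k < n \<and> (k \<in> F \<and> d k j \<le> T) \<and>
        (\<forall>y. 0 \<le> y \<longrightarrow> y < n \<longrightarrow> y \<in> F \<and> d y j \<le> T \<longrightarrow> s Price k * d k j \<le> s Price y * d y j)"
        unfolding k_def s3_def c3_def
        by (rule run_search[where s = s2]) (use envD[OF env2] n j' e in \<open>auto simp: s2 j_def[symmetric]\<close>)
      have t3: "t = run (Cond (le (Lit 0) (V Cand)) (block
       [Put Fac (V Client) (V Cand),
        Put Paid (V Client) (Arr Price (V Cand)),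
        Put Load (V Cand) (Op Add (Arr Load (V Cand)) (dst (V Cand) (V Client)))]) Pass) s3"
        using True by (simp add: t2 assign_def c3_def[symmetric] s3_def[symmetric] j_def[symmetric])
      show ?thesis
      proof (cases "0 \<le> k")
        case False
        then have t': "t Price = s Price" "t Fac = s Fac" "t Paid = s Paid" "t Load = s Load"
          by (auto simp: t3 k_def[symmetric] s3)
        have "\<not> feasible opt"
        proof
          assume feas: "feasible opt"
          interpret auction F C "active (s Fac)" d T opt "s Fac" "s Price" "s Paid"
            by (rule auction_locale[OF feas inv])
          have "\<forall>y. 0 \<le> y \<longrightarrow> y < n \<longrightarrow> \<not> (y \<in> F \<and> d y j \<le> T)"
            using k False by (elim disjE conjE) (assumption | simp)+
          then show False using opt_dist[OF j'(3)] opt[OF j'(3)] pts(1,2)[OF opt[OF j'(3)]] by blast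
        qed
        then show ?thesis using inv unfolding t' by simp
      next
        case True
        with k have k': "k \<in> F" "d k j \<le> T" "0 \<le> k" "k < n"
          "\<And>f. f \<in> F \<Longrightarrow> d f j \<le> T \<Longrightarrow> s Price k * d k j \<le> s Price f * d f j"
          using pts(1,2) by simp_all
        have t': "t Price = s Price" "t Fac = (s Fac)(j := k)" "t Paid = (s Paid)(j := s Price k)"
            "t Load = (s Load)(k := s Load k + d k j)"
          using True k' j' e by (auto simp: t3 k_def[symmetric] upd_apply s3 s3c)
        show ?thesis
          using auction_inv_assign[OF inv j'(3,4) k'(1,2) k'(5)]
            potential_assign[of j "s Fac" k "s Price" "s Paid", OF j'(3,4) k'(1)] unsettled
          unfolding t' by simp
      qed
    qed
  qed
qed

text \<open>As long as the auction is not settled, the potential is at least the number of rounds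
  played; the loop runs for more rounds than the potential allows.\<close>

lemma run_auction_loop:
  assumes env: "env s" and init: "\<And>v. 0 \<le> v \<Longrightarrow> v < n \<Longrightarrow> s Price v = 2 \<and> s Fac v = -1 \<and> s Load v = 0"
    and t: "t = run auction_loop s"
  shows "auction_inv (t Price) (t Fac) (t Paid) (t Load)"
    and "feasible opt \<Longrightarrow> active (t Fac) = C \<and> (\<forall>f\<in>F. t Load f \<le> 2 * T)"
proof -
  define N where "N = 16 * (n * (n * n))"
  have N: "0 \<le> N" using n by (simp add: N_def)
  define Q where "Q i s \<longleftrightarrow> auction_inv (s Price) (s Fac) (s Paid) (s Load) \<and>
    (feasible opt \<longrightarrow> (\<forall>f\<in>F. s Price f \<le> 2 * n + 1) \<and>
      (settled (s Fac) (s Load) \<or> i \<le> potential (s Price) (s Fac) (s Paid)))"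
    for i and s :: state
  have Qcong: "Q i u = Q i u'" if "\<And>y. y \<in> {Price, Fac, Paid, Load} \<Longrightarrow> u y = u' y" for i u u'
    using that by (simp add: Q_def)
  have "Q N t"
    unfolding t auction_loop_def
  proof (rule run_For_induct)
    fix i u assume "Q i u" and fr: "\<And>y. y \<noteq> I0 \<Longrightarrow> y \<notin> mods bid \<Longrightarrow> u y = s y"
    have "env u" using env by (subst env_cong[of _ s]) (auto intro!: fr simp: program_defs)
    from run_bid[OF this _ refl, of opt] \<open>Q i u\<close> have "Q (i + 1) (run bid u)"
      unfolding Q_def by (cases "settled (u Fac) (u Load)"; cases "feasible opt"; simp)
    then show "Q (i + 1) (upd (run bid u) I0 0 (i + 1))"
      by (subst Qcong[of _ "run bid u"]) (auto simp: upd_apply)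
  next
    have act: "active (s Fac) = {}" using init by (force simp: active_def)
    have "s Price f = 2" "s Load f = 0" if "f \<in> F" for f
      using init[of f] pts(1,2)[OF that] by simp_all
    moreover have pos: "1 \<le> 2 * n" if "f \<in> F" for f using pts(1,2)[OF that] by simp
    ultimately have "Q 0 s"
      using n T by (auto simp: Q_def auction_inv_def act star_load_of_def potential_def
          intro!: sum_nonneg dest: pos)
    then show "Q 0 (upd s I0 0 0)"
      by (subst Qcong[of _ s]) (auto simp: upd_apply)
  qed (use envD[OF env] N in \<open>auto simp: program_defs N_def\<close>)
  then show "auction_inv (t Price) (t Fac) (t Paid) (t Load)" by (simp add: Q_def)
  assume feas: "feasible opt"
  then have prices: "\<And>f. f \<in> F \<Longrightarrow> t Price f \<le> 2 * n + 1"
    and alt: "settled (t Fac) (t Load) \<or> N \<le> potential (t Price) (t Fac) (t Paid)"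
    using \<open>Q N t\<close> by (simp_all add: Q_def)
  have "settled (t Fac) (t Load)"
  proof (cases "n = 0")
    case True
    then show ?thesis using FC unfolding settled_def active_def by auto
  next
    case False
    then have "1 \<le> n" using n by simp
    then have le: "n \<le> n * n" "n * n \<le> n * (n * n)"
      using mult_left_mono[of 1 n n] mult_left_mono[of n "n * n" n] by auto
    have "2 * (n * ((2 * n + 1) * (n + 1) + n)) = 4 * (n * (n * n)) + 8 * (n * n) + 2 * n"
      by (simp add: algebra_simps)
    then have "2 * (n * ((2 * n + 1) * (n + 1) + n)) < N"
      using le \<open>1 \<le> n\<close> unfolding N_def by linarith
    moreover have "potential (t Price) (t Fac) (t Paid) \<le> 2 * (n * ((2 * n + 1) * (n + 1) + n))"
      by (rule potential_bound) (rule prices)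
    ultimately show ?thesis using alt by linarith
  qed
  then show "active (t Fac) = C \<and> (\<forall>f\<in>F. t Load f \<le> 2 * T)" by (simp add: settled_def)
qed

end

section \<open>Correctness of the merging\<close>

definition below :: "(int \<Rightarrow> bool) \<Rightarrow> int \<Rightarrow> int set" where
  "below P i = {c. 0 \<le> c \<and> c < i \<and> P c}"

lemma below_0 [simp]: "below P 0 = {}"
  by (auto simp: below_def)

lemma below_Suc: "0 \<le> i \<Longrightarrow> below P (i + 1) = (if P i then insert i (below P i) else below P i)"
  by (auto simp: below_def zless_add1_eq simp del: zle_add1_eq_le)

lemma finite_below [simp]: "finite (below P i)"
  by (rule finite_subset[of _ "{0..<i}"]) (auto simp: below_def)

lemma not_in_below [simp]: "i \<notin> below P i"
  by (auto simp: below_def)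

lemma sum_below_Suc:
  "0 \<le> i \<Longrightarrow> sum f (below P (i + 1)) = (if P i then f i else 0) + sum f (below P i)"
  by (simp add: below_Suc)

lemma card_below_Suc:
  "0 \<le> i \<Longrightarrow> int (card (below P (i + 1))) = (if P i then 1 else 0) + int (card (below P i))"
  by (simp add: below_Suc)

section \<open>Radii, processing by increasing key, and opening of facilities\<close>

context integral_instance
begin

definition prefix :: "(int \<Rightarrow> int) \<Rightarrow> int \<Rightarrow> int \<Rightarrow> int set" where
  "prefix q f x = {c \<in> active q. d f (q c) \<le> d f (q x)}"

text \<open>Before rounding down, this is the number r for which the terms r -
  \<open>d f (q c)\<close> sum up to \<open>T\<close> over the prefix. The prefix contains
  \<open>x\<close> itself if \<open>x\<close> is active, so the divisor is then positive.\<close>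

definition ratio :: "(int \<Rightarrow> int) \<Rightarrow> int \<Rightarrow> int \<Rightarrow> int" where
  "ratio q f x = (T + (\<Sum>c\<in>prefix q f x. d f (q c))) div int (card (prefix q f x))"

text \<open>The alternative \<open>r = T\<close> is the starting value of the key. At a facility in
  use it is the exact ratio of a set: a single client located there.\<close>

definition radius_up_to :: "int \<Rightarrow> (int \<Rightarrow> int) \<Rightarrow> int \<Rightarrow> int \<Rightarrow> bool" where
  "radius_up_to i q f r \<longleftrightarrow> (\<forall>x\<in>active q. x < i \<longrightarrow> r \<le> ratio q f x) \<and>
     (r = T \<or> (\<exists>x\<in>active q. r = ratio q f x))"

definition valid :: "(int \<Rightarrow> int) \<Rightarrow> bool" where
  "valid q \<longleftrightarrow> (\<forall>c\<in>active q. 0 \<le> q c \<and> q c < n)"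

lemma run_radii:
  assumes env: "env s" and q: "q = s Fac" "valid q" and t: "t = run radii s"
    and f: "0 \<le> f" "f < n"
  shows "radius_up_to n q f (t Key f)"
proof -
  note e = envD[OF env]
  define upd_sum where "upd_sum = Cond (le (Lit 0) (Arr Fac (V I2)))
         (Cond (le (dst (V I0) (Arr Fac (V I2))) (dst (V I0) (Arr Fac (V I1))))
           (Then (Put Sum (Lit 0) (Op Add (V Sum) (dst (V I0) (Arr Fac (V I2)))))
             (Put Cnt (Lit 0) (Op Add (V Cnt) (Lit 1)))) Pass) Pass"
  define body where "body = Cond (le (Lit 0) (Arr Fac (V I1))) (block
      [Put Sum (Lit 0) (V Thr), Put Cnt (Lit 0) (Lit 0), For I2 (V Size) upd_sum,
       Put Sum (Lit 0) (Op Div (V Sum) (V Cnt)),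
       Cond (lt (V Sum) (Arr Key (V I0))) (Put Key (V I0) (V Sum)) Pass]) Pass"
  have mods: "mods upd_sum = {Sum, Cnt}" "mods body = {Sum, Cnt, I2, Key}"
    by (auto simp: upd_sum_def body_def)
  have qn: "0 \<le> q c \<Longrightarrow> 0 \<le> c \<Longrightarrow> c < n \<Longrightarrow> q c < n" for c
    using q(2) by (auto simp: valid_def active_def)
  have inner: "run (For I2 (V Size) upd_sum) u Sum 0 = T + (\<Sum>c\<in>prefix q f x. d f (q c)) \<and>
      run (For I2 (V Size) upd_sum) u Cnt 0 = int (card (prefix q f x))"
    if u: "u Size 0 = n" "u Dist = s Dist" "u Fac = q" "u I0 0 = f" "u I1 0 = x"
      "u Sum 0 = T" "u Cnt 0 = 0"
      and f: "0 \<le> f" "f < n" and x: "0 \<le> x" "x < n" "0 \<le> q x" for u f x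
  proof -
    define P where "P c \<longleftrightarrow> 0 \<le> q c \<and> d f (q c) \<le> d f (q x)" for c
    define Q where "Q i u \<longleftrightarrow> u Sum 0 = T + (\<Sum>c\<in>below P i. d f (q c)) \<and>
      u Cnt 0 = int (card (below P i))" for i and u :: state
    have "Q n (run (For I2 (V Size) upd_sum) u)"
    proof (rule run_For_induct)
      fix i v assume i: "0 \<le> i" "i < n" "v I2 0 = i" and Q: "Q i v"
        and fr: "\<And>y. y \<noteq> I2 \<Longrightarrow> y \<notin> mods upd_sum \<Longrightarrow> v y = u y"
      have v: "v Fac = q" "v I0 0 = f" "v I1 0 = x" "v Dist = s Dist" "v Size 0 = n"
        using u fr by (simp_all add: mods)
      show "Q (i + 1) (upd (run upd_sum v) I2 0 (i + 1))"
        using Q i v f x qn[of i] qn[of x] e(5)[of f "q i"] e(5)[of f "q x"]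
        unfolding Q_def sum_below_Suc[OF i(1)] card_below_Suc[OF i(1)]
        by (simp add: upd_sum_def upd_apply P_def)
    qed (use u n in \<open>simp_all add: mods Q_def upd_apply\<close>)
    moreover have "below P n = prefix q f x"
      by (auto simp: below_def prefix_def active_def P_def)
    ultimately show ?thesis by (simp add: Q_def)
  qed
  have middle: "(\<forall>g. g \<noteq> f \<longrightarrow> run (For I1 (V Size) body) u Key g = u Key g) \<and>
      radius_up_to n q f (run (For I1 (V Size) body) u Key f)"
    if u: "u Size 0 = n" "u Thr 0 = T" "u Dist = s Dist" "u Fac = q" "u I0 0 = f" "u Key f = T"
      and f: "0 \<le> f" "f < n" for u f
  proof -
    define Q where "Q i w \<longleftrightarrow> (\<forall>g. g \<noteq> f \<longrightarrow> w Key g = u Key g) \<and> radius_up_to i q f (w Key f)"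
      for i and w :: state
    have "Q n (run (For I1 (V Size) body) u)"
    proof (rule run_For_induct)
      fix i v assume i: "0 \<le> i" "i < n" "v I1 0 = i" and Q: "Q i v"
        and fr: "\<And>y. y \<noteq> I1 \<Longrightarrow> y \<notin> mods body \<Longrightarrow> v y = u y"
      have v: "v Fac = q" "v I0 0 = f" "v Dist = s Dist" "v Size 0 = n" "v Thr 0 = T"
        using u fr by (simp_all add: mods)
      show "Q (i + 1) (upd (run body v) I1 0 (i + 1))"
      proof (cases "0 \<le> q i")
        case False
        then have "run body v = v" using i v by (simp add: body_def)
        then show ?thesis using Q False i
          by (auto simp: Q_def upd_apply radius_up_to_def active_def zless_add1_eq simp del: zle_add1_eq_le)
      next
        case True
        define w where "w = upd (upd v Sum 0 T) Cnt 0 0"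
        define w' where "w' = run (For I2 (V Size) upd_sum) w"
        have w': "w' Sum 0 = T + (\<Sum>c\<in>prefix q f i. d f (q c))" "w' Cnt 0 = int (card (prefix q f i))"
          using inner[of w f i] v i f True by (simp_all add: w'_def w_def upd_apply)
        have w'_fr: "w' Key = v Key" "w' I0 0 = f"
          using v by (simp_all add: w'_def run_unmodified mods w_def upd_apply)
        have "run body v = run (Then (Put Sum (Lit 0) (Op Div (V Sum) (V Cnt)))
            (Cond (lt (V Sum) (Arr Key (V I0))) (Put Key (V I0) (V Sum)) Pass)) w'"
          using True i v by (simp add: body_def w'_def w_def)
        then have Key: "run body v Key = (if ratio q f i < v Key f then (v Key)(f := ratio q f i) else v Key)"
          using w' w'_fr by (simp add: upd_apply ratio_def)
        have "i \<in> active q" using True i by (simp add: active_def)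
        then have "radius_up_to (i + 1) q f (run body v Key f)"
          using Q unfolding Key Q_def radius_up_to_def
          by (auto simp: zless_add1_eq simp del: zle_add1_eq_le)
        then show ?thesis using Q by (simp add: Q_def Key upd_apply)
      qed
    next
      show "Q 0 (upd u I1 0 0)"
        using u by (auto simp: Q_def upd_apply radius_up_to_def active_def)
    qed (use u n in \<open>simp_all add: mods\<close>)
    then show ?thesis by (simp add: Q_def)
  qed
  define outer where "outer = Then (Put Key (V I0) (V Thr)) (For I1 (V Size) body)"
  define Q where "Q i u \<longleftrightarrow> (\<forall>f. 0 \<le> f \<longrightarrow> f < i \<longrightarrow> radius_up_to n q f (u Key f))"
    for i and u :: state
  have "Q n (run (For I0 (V Size) outer) s)"
  proof (rule run_For_induct)
    fix i v assume i: "0 \<le> i" "i < n" "v I0 0 = i" and Q: "Q i v"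
      and fr: "\<And>y. y \<noteq> I0 \<Longrightarrow> y \<notin> mods outer \<Longrightarrow> v y = s y"
    have v: "v Fac = q" "v Dist = s Dist" "v Size 0 = n" "v Thr 0 = T"
      using fr q e by (simp_all add: outer_def mods)
    have "(\<forall>g. g \<noteq> i \<longrightarrow> run outer v Key g = v Key g) \<and> radius_up_to n q i (run outer v Key i)"
      using middle[of "upd v Key i T" i] v i by (simp add: outer_def upd_apply)
    then show "Q (i + 1) (upd (run outer v) I0 0 (i + 1))"
      using Q unfolding Q_def
      by (auto simp: zless_add1_eq upd_apply simp del: zle_add1_eq_le)
  qed (use e n in \<open>simp_all add: outer_def mods Q_def\<close>)
  then show ?thesis
    using f by (simp add: Q_def t radii_def outer_def body_def upd_sum_def)
qed

text \<open>The invariant \<open>Q\<close> speaks about the set \<open>S\<close> of facilities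
  already processed, all of which have keys no larger than that of the next one. By
  \<open>cong\<close> it may not depend on the scratch names of the loop, and \<open>c\<close> may
  not touch the keys or the bookkeeping.\<close>

lemma run_by_key:
  assumes env: "env s" and q: "q = s Fac" "valid q"
    and mods: "mods c \<inter> {Todo, Key, Fac, I0, I1, Best, Size, Thr, IsFac, IsCli, Dist} = {}"
    and init: "Q {} s"
    and cong: "\<And>S u u'. (\<And>y. y \<notin> {I0, I1, Best, Todo} \<Longrightarrow> u' y = u y) \<Longrightarrow> Q S u \<Longrightarrow> Q S u'"
    and step: "\<And>S b u. S \<subseteq> q ` active q \<Longrightarrow> b \<in> q ` active q \<Longrightarrow> b \<notin> S \<Longrightarrow>
      (\<And>x. x \<in> S \<Longrightarrow> s Key x \<le> s Key b) \<Longrightarrow> u Best 0 = b \<Longrightarrow>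
      (\<And>y. y \<notin> mods c \<Longrightarrow> y \<notin> {I0, I1, Best, Todo} \<Longrightarrow> u y = s y) \<Longrightarrow>
      Q S u \<Longrightarrow> Q (insert b S) (run c u)"
  shows "Q (q ` active q) (run (by_key c) s)"
proof -
  define G where "G = q ` active q"
  have G: "G \<subseteq> {0..<n}" using q(2) by (auto simp: G_def valid_def)
  note e = envD[OF env]
  define l1 where "l1 = For I0 (V Size) (Put Todo (V I0) (Lit 0))"
  define s1 where "s1 = run l1 s"
  have s1: "s1 y = s y" if "y \<notin> {I0, Todo}" for y
    using that by (simp add: s1_def l1_def run_unmodified)
  define P1 where "P1 i u \<longleftrightarrow> (\<forall>v. 0 \<le> v \<longrightarrow> v < i \<longrightarrow> u Todo v = 0)" for i and u :: state
  have "P1 n s1"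
    unfolding s1_def l1_def
  proof (rule run_For_induct)
    fix i u assume "0 \<le> i" "u I0 0 = i" "P1 i u"
    then show "P1 (i + 1) (upd (run (Put Todo (V I0) (Lit 0)) u) I0 0 (i + 1))"
      by (simp add: P1_def upd_apply)
  qed (use e n in \<open>simp_all add: P1_def\<close>)
  define mark where "mark = Cond (le (Lit 0) (Arr Fac (V I0))) (Put Todo (Arr Fac (V I0)) (Lit 1)) Pass"
  define s2 where "s2 = run (For I0 (V Size) mark) s1"
  have s2: "s2 y = s y" if "y \<notin> {I0, Todo}" for y
    using that s1 by (simp add: s2_def mark_def run_unmodified)
  define P2 where "P2 i u \<longleftrightarrow> (\<forall>v. 0 \<le> v \<longrightarrow> v < n \<longrightarrow> (0 < u Todo v \<longleftrightarrow> v \<in> q ` {c \<in> active q. c < i}))"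
    for i and u :: state
  have "P2 n s2"
    unfolding s2_def
  proof (rule run_For_induct)
    fix i u assume i: "0 \<le> i" "i < n" "u I0 0 = i" and P: "P2 i u"
      and fr: "\<And>y. y \<noteq> I0 \<Longrightarrow> y \<notin> mods mark \<Longrightarrow> u y = s1 y"
    have u: "u Fac = q" using fr s1 q by (simp add: mark_def)
    have "{c \<in> active q. c < i + 1} = (if 0 \<le> q i then insert i {c \<in> active q. c < i} else {c \<in> active q. c < i})"
      using i(1,2) by (auto simp: active_def zless_add1_eq simp del: zle_add1_eq_le)
    moreover have "run mark u Todo = (if 0 \<le> q i then (u Todo)(q i := 1) else u Todo)"
      using u i by (simp add: mark_def upd_apply)
    ultimately show "P2 (i + 1) (upd (run mark u) I0 0 (i + 1))"
      using P by (simp add: P2_def upd_apply)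
  next
    show "P2 0 (upd s1 I0 0 0)"
      using \<open>P1 n s1\<close> by (auto simp: P2_def P1_def upd_apply active_def)
  qed (use e n s1 in \<open>simp_all add: mark_def\<close>)
  define sel where "sel = search Best I1 (lt (Lit 0) (Arr Todo (V I1))) (Lit 1) (\<lambda>e. Arr Key e)"
  define round where "round = Then sel (Cond (le (Lit 0) (V Best)) (Then (Put Todo (V Best) (Lit 0)) c) Pass)"
  \<comment> \<open>The last clause counts progress: each round processes one more facility until
    none is left, so \<open>n\<close> rounds suffice.\<close>
  define R where "R i u \<longleftrightarrow> (\<exists>S\<subseteq>G. Q S u \<and> (\<forall>v. 0 \<le> v \<longrightarrow> v < n \<longrightarrow> (0 < u Todo v \<longleftrightarrow> v \<in> G - S)) \<and>
      (\<forall>x\<in>S. \<forall>y\<in>G - S. s Key x \<le> s Key y) \<and> (S = G \<or> i \<le> int (card S)))" for i and u :: state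
  have finG: "finite G" using G finite_subset by blast
  have modr: "mods round = {Best, I1, Todo} \<union> mods c" by (auto simp: round_def sel_def)
  have "R n (run (For I0 (V Size) round) s2)"
  proof (rule run_For_induct)
    fix i u assume i: "0 \<le> i" "i < n" "u I0 0 = i" and R: "R i u"
      and fr: "\<And>y. y \<noteq> I0 \<Longrightarrow> y \<notin> mods round \<Longrightarrow> u y = s2 y"
    obtain S where S: "S \<subseteq> G" "Q S u" "\<And>v. 0 \<le> v \<Longrightarrow> v < n \<Longrightarrow> (0 < u Todo v \<longleftrightarrow> v \<in> G - S)"
      "\<And>x y. x \<in> S \<Longrightarrow> y \<in> G - S \<Longrightarrow> s Key x \<le> s Key y" "S = G \<or> i \<le> int (card S)"
      using R unfolding R_def by blast
    have fru: "u y = s y" if "y \<notin> mods c" "y \<notin> {I0, I1, Best, Todo}" for y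
      using that fr[of y] s2[of y] by (simp add: modr)
    define u1 where "u1 = run sel u"
    have u1: "u1 y = u y" if "y \<noteq> Best" "y \<noteq> I1" for y
      using that by (simp add: u1_def sel_def run_unmodified)
    define b where "b = u1 Best 0"
    have key: "u Key = s Key" using fru mods by auto
    have size: "u Size 0 = n" using fru[of Size] mods e by auto
    have b: "b = -1 \<and> (\<forall>y. 0 \<le> y \<longrightarrow> y < n \<longrightarrow> \<not> y \<in> G - S) \<or>
        0 \<le> b \<and> b < n \<and> b \<in> G - S \<and> (\<forall>y. 0 \<le> y \<longrightarrow> y < n \<longrightarrow> y \<in> G - S \<longrightarrow> s Key b \<le> s Key y)"
      unfolding b_def u1_def sel_def
      by (rule run_search[where s = u]) (use n size S(3) in \<open>auto simp: key\<close>)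
    show "R (i + 1) (upd (run round u) I0 0 (i + 1))"
    proof (cases "0 \<le> b")
      case False
      with b have "\<forall>y. 0 \<le> y \<longrightarrow> y < n \<longrightarrow> \<not> y \<in> G - S" by simp
      then have "S = G" using S(1) G by auto
      moreover have "run round u = u1" using False by (simp add: round_def u1_def[symmetric] b_def[symmetric])
      moreover have "Q S (upd u1 I0 0 (i + 1))"
        by (rule cong[OF _ S(2)]) (simp add: upd_apply u1)
      ultimately show ?thesis
        unfolding R_def using S(3) by (intro exI[of _ S]) (auto simp: upd_apply u1)
    next
      case True
      with b have b': "b \<in> G" "b \<notin> S" "\<And>y. y \<in> G - S \<Longrightarrow> s Key b \<le> s Key y" "0 \<le> b" "b < n"
        using G by auto
      define u2 where "u2 = upd u1 Todo b 0"
      have u2: "u2 y = u y" if "y \<notin> {I0, I1, Best, Todo}" for y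
        using that by (simp add: u2_def upd_apply u1)
      have rr: "run round u = run c u2"
        using True by (simp add: round_def u1_def[symmetric] b_def[symmetric] u2_def)
      have "Q (insert b S) (run c u2)"
      proof (rule step)
        show "S \<subseteq> q ` active q" "b \<in> q ` active q" "b \<notin> S"
          using S(1) b' by (simp_all add: G_def)
        show "s Key x \<le> s Key b" if "x \<in> S" for x using S(4)[OF that] b' by simp
        show "u2 Best 0 = b" by (simp add: u2_def upd_apply b_def)
        show "u2 y = s y" if "y \<notin> mods c" "y \<notin> {I0, I1, Best, Todo}" for y
          using that u2 fru by simp
        show "Q S u2" by (rule cong[OF _ S(2)]) (rule u2)
      qed
      then have "Q (insert b S) (upd (run c u2) I0 0 (i + 1))"
        by (rule cong[rotated]) (simp add: upd_apply)
      moreover have "run c u2 Todo = (u Todo)(b := 0)"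
        using mods u1 by (subst run_unmodified) (auto simp: u2_def upd_apply)
      moreover have "card (insert b S) = card S + 1"
        using b' finite_subset[OF S(1) finG] by simp
      ultimately show ?thesis
        unfolding R_def rr using S b'
        by (intro exI[of _ "insert b S"]) (auto simp: upd_apply)
    qed
  next
    show "R 0 (upd s2 I0 0 0)"
      unfolding R_def
    proof (intro exI[of _ "{}"] conjI allI impI)
      show "Q {} (upd s2 I0 0 0)"
        by (rule cong[OF _ init]) (simp add: upd_apply s2)
      have "{c \<in> active q. c < n} = active q" by (auto simp: active_def)
      then show "0 < upd s2 I0 0 0 Todo v \<longleftrightarrow> v \<in> G - {}" if "0 \<le> v" "v < n" for v
        using \<open>P2 n s2\<close> that by (simp add: P2_def upd_apply G_def)
    qed auto
  qed (use e n s2 mods modr in \<open>auto simp: modr\<close>)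
  then obtain S where S: "S \<subseteq> G" "Q S (run (For I0 (V Size) round) s2)" "S = G \<or> n \<le> int (card S)"
    unfolding R_def by blast
  have "S = G"
  proof (rule ccontr)
    assume "S \<noteq> G"
    then have "card S < card G" using S(1) finG by (intro psubset_card_mono) auto
    also have "card G \<le> card {0..<n}" using G by (intro card_mono) auto
    finally show False using S(3) \<open>S \<noteq> G\<close> by auto
  qed
  moreover have "run (by_key c) s = run (For I0 (V Size) round) s2"
    by (simp only: by_key_def block.simps run.simps round_def sel_def s2_def mark_def s1_def l1_def)
  ultimately show ?thesis using S(2) by (simp add: G_def)
qed


definition opened :: "state \<Rightarrow> int set" where
  "opened s = {h. 0 \<le> h \<and> h < n \<and> 0 < s Opened h}"

text \<open>Facilities come by increasing radius, so when \<open>b\<close> is opened, being farther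
  than twice its own radius from an earlier one also means being farther than twice the earlier
  radius. This gives the separation in both orders.\<close>

lemma run_open:
  assumes env: "env s" and q: "q = s Fac" "valid q" and t: "t = run (by_key open_step) s"
    and empty: "opened s = {}" and key: "\<And>g. g \<in> q ` active q \<Longrightarrow> 0 \<le> s Key g"
  shows "opened t \<subseteq> q ` active q \<and> (\<forall>g\<in>q ` active q. \<exists>h\<in>opened t. d g h \<le> 2 * s Key g) \<and>
    (\<forall>h\<in>opened t. \<forall>h'\<in>opened t. h \<noteq> h' \<longrightarrow> 2 * s Key h < d h h')"
proof -
  define Q where "Q S u \<longleftrightarrow> opened u \<subseteq> S \<and> (\<forall>g\<in>S. \<exists>h\<in>opened u. d g h \<le> 2 * s Key g) \<and>
    (\<forall>h\<in>opened u. \<forall>h'\<in>opened u. h \<noteq> h' \<longrightarrow> 2 * s Key h < d h h')" for S and u :: state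
  have G: "q ` active q \<subseteq> {0..<n}" using q(2) by (auto simp: valid_def)
  have "Q (q ` active q) t"
    unfolding t
  proof (rule run_by_key[OF env q])
    show "Q S u'" if "\<And>y. y \<notin> {I0, I1, Best, Todo} \<Longrightarrow> u' y = u y" "Q S u" for S u u'
      using that(2) that(1)[of Opened] by (simp add: Q_def opened_def)
  next
    fix S b u assume S: "S \<subseteq> q ` active q" and b: "b \<in> q ` active q" "b \<notin> S"
      and least: "\<And>x. x \<in> S \<Longrightarrow> s Key x \<le> s Key b" and ub: "u Best 0 = b"
      and fr: "\<And>y. y \<notin> mods open_step \<Longrightarrow> y \<notin> {I0, I1, Best, Todo} \<Longrightarrow> u y = s y"
      and Q: "Q S u"
    have env_u: "env u" using env by (subst env_cong[of _ s]) (auto intro!: fr simp: open_step_def)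
    have key_u: "u Key = s Key" by (rule fr) (auto simp: open_step_def)
    have bn: "0 \<le> b" "b < n" using b G by auto
    define sel where "sel = search Hit I2 (lt (Lit 0) (Arr Opened (V I2)))
      (le (dst (V Best) (V I2)) (Op Add (Arr Key (V Best)) (Arr Key (V Best)))) (\<lambda>_. Lit 0)"
    define u1 where "u1 = run sel u"
    define z where "z = u1 Hit 0"
    have u1: "u1 y = u y" if "y \<noteq> Hit" "y \<noteq> I2" for y
      using that by (simp add: u1_def sel_def run_unmodified)
    have z: "z = -1 \<and> (\<forall>y. 0 \<le> y \<longrightarrow> y < n \<longrightarrow> \<not> (y \<in> opened u \<and> d b y \<le> 2 * s Key b)) \<or>
        0 \<le> z \<and> z < n \<and> (z \<in> opened u \<and> d b z \<le> 2 * s Key b) \<and>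
        (\<forall>y. 0 \<le> y \<longrightarrow> y < n \<longrightarrow> y \<in> opened u \<and> d b y \<le> 2 * s Key b \<longrightarrow> (0::int) \<le> 0)"
      unfolding z_def u1_def sel_def
      by (rule run_search[where s = u]) (use n envD[OF env_u] bn in \<open>auto simp: key_u ub opened_def\<close>)
    have run_eq: "run open_step u = (if z < 0 then upd u1 Opened b 1 else u1)"
      using u1[of Best] ub by (simp add: open_step_def sel_def[symmetric] u1_def[symmetric] z_def[symmetric])
    show "Q (insert b S) (run open_step u)"
    proof (cases "z < 0")
      case False
      then have "z \<in> opened u" "d b z \<le> 2 * s Key b" using z by auto
      moreover have "opened (run open_step u) = opened u"
        using False by (simp add: run_eq opened_def u1)
      ultimately show ?thesis using Q by (auto simp: Q_def)
    next
      case True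
      with z have far: "\<forall>y. 0 \<le> y \<longrightarrow> y < n \<longrightarrow> \<not> (y \<in> opened u \<and> d b y \<le> 2 * s Key b)" by simp
      have op: "opened (run open_step u) = insert b (opened u)"
        using True bn by (auto simp: run_eq opened_def u1 upd_apply)
      have old: "2 * s Key b < d b h \<and> 2 * s Key h < d h b" if "h \<in> opened u" for h
      proof -
        have h: "0 \<le> h" "h < n" "h \<in> S" using that Q by (auto simp: opened_def Q_def)
        then have "2 * s Key b < d b h" using far that by force
        moreover have "d b h = d h b" using h bn by (intro sym) auto
        ultimately show ?thesis using least[OF h(3)] by simp
      qed
      \<comment> \<open>A newly opened facility is its own witness of domination, which requires a
        nonnegative radius.\<close>
      have "d b b \<le> 2 * s Key b" using self_dist[of b] key[OF b(1)] bn by simp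
      then show ?thesis using Q old unfolding Q_def op by (auto 0 3)
    qed
  qed (use empty in \<open>auto simp: Q_def open_step_def\<close>)
  then show ?thesis by (simp add: Q_def)
qed

lemma run_nearest:
  assumes env: "env s" and t: "t = run nearest s" and ne: "opened s \<noteq> {}" and g: "0 \<le> g" "g < n"
  shows "t Nearest g \<in> opened s \<and> t Key g = d g (t Nearest g) \<and> (\<forall>h\<in>opened s. t Key g \<le> d g h)"
proof -
  note e = envD[OF env]
  define sel where "sel = search Best I1 (lt (Lit 0) (Arr Opened (V I1))) (Lit 1) (\<lambda>e. dst (V I0) e)"
  define body where "body = block [sel, Put Nearest (V I0) (V Best), Put Key (V I0) (dst (V I0) (V Best))]"
  define Q where "Q i u \<longleftrightarrow> (\<forall>g. 0 \<le> g \<longrightarrow> g < i \<longrightarrow> u Nearest g \<in> opened s \<and> u Key g = d g (u Nearest g) \<and>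
    (\<forall>h\<in>opened s. u Key g \<le> d g h))" for i and u :: state
  have "Q n t"
    unfolding t nearest_def sel_def[symmetric] body_def[symmetric]
  proof (rule run_For_induct)
    fix i u assume i: "0 \<le> i" "i < n" "u I0 0 = i" and Q: "Q i u"
      and fr: "\<And>y. y \<noteq> I0 \<Longrightarrow> y \<notin> mods body \<Longrightarrow> u y = s y"
    have u: "u Dist = s Dist" "u Size = s Size" "u Opened = s Opened"
      by (auto intro!: fr simp: body_def sel_def)
    define u1 where "u1 = run sel u"
    define b where "b = u1 Best 0"
    have u1: "u1 y = u y" if "y \<noteq> Best" "y \<noteq> I1" for y
      using that by (simp add: u1_def sel_def run_unmodified)
    have b: "b = -1 \<and> (\<forall>y. 0 \<le> y \<longrightarrow> y < n \<longrightarrow> \<not> (y \<in> opened s)) \<or>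
        0 \<le> b \<and> b < n \<and> (b \<in> opened s) \<and> (\<forall>y. 0 \<le> y \<longrightarrow> y < n \<longrightarrow> y \<in> opened s \<longrightarrow> d i b \<le> d i y)"
      unfolding b_def u1_def sel_def
      by (rule run_search[where s = u]) (use n e i in \<open>auto simp: u opened_def\<close>)
    moreover have "\<exists>y. 0 \<le> y \<and> y < n \<and> y \<in> opened s" using ne by (auto simp: opened_def)
    ultimately have b: "0 \<le> b" "b < n" "b \<in> opened s" "\<And>y. y \<in> opened s \<Longrightarrow> d i b \<le> d i y"
      by (auto simp: opened_def)
    have "run body u Nearest = (u Nearest)(i := b)" "run body u Key = (u Key)(i := d i b)"
      using i b(1,2) u e by (simp_all add: body_def u1_def[symmetric] upd_apply u1 b_def[symmetric])
    then show "Q (i + 1) (upd (run body u) I0 0 (i + 1))"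
      using Q b unfolding Q_def by (auto simp: upd_apply)
  qed (use e n in \<open>simp_all add: Q_def body_def sel_def\<close>)
  then show ?thesis using g unfolding Q_def by blast
qed

lemma run_masses:
  assumes env: "env s" and q: "q = s Fac" "valid q" and t: "t = run masses s"
    and init: "\<And>g. 0 \<le> g \<Longrightarrow> g < n \<Longrightarrow> s Mass g = 0" and g: "0 \<le> g" "g < n"
  shows "t Mass g = (\<Sum>c | c \<in> active q \<and> q c = g. d g c + 2 * s Key g)"
proof -
  note e = envD[OF env]
  define body where "body = Cond (le (Lit 0) (Arr Fac (V I0)))
     (Put Mass (Arr Fac (V I0)) (Op Add (Arr Mass (Arr Fac (V I0)))
       (Op Add (dst (Arr Fac (V I0)) (V I0))
         (Op Add (Arr Key (Arr Fac (V I0))) (Arr Key (Arr Fac (V I0))))))) Pass"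
  define P where "P g c \<longleftrightarrow> 0 \<le> q c \<and> q c = g" for g c
  define Q where "Q i u \<longleftrightarrow> (\<forall>g. 0 \<le> g \<longrightarrow> g < n \<longrightarrow>
      u Mass g = (\<Sum>c\<in>below (P g) i. d g c + 2 * s Key g))" for i and u :: state
  have "Q n t"
    unfolding t masses_def body_def[symmetric]
  proof (rule run_For_induct)
    fix i u assume i: "0 \<le> i" "i < n" "u I0 0 = i" and Q: "Q i u"
      and fr: "\<And>y. y \<noteq> I0 \<Longrightarrow> y \<notin> mods body \<Longrightarrow> u y = s y"
    have u: "u Dist = s Dist" "u Size = s Size" "u Fac = q" "u Key = s Key"
      using q by (auto intro!: fr simp: body_def)
    have "0 \<le> q i \<Longrightarrow> q i < n" using q(2) i by (auto simp: valid_def active_def)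
    then have "run body u Mass = (if 0 \<le> q i then (u Mass)(q i := u Mass (q i) + (d (q i) i + 2 * s Key (q i)))
        else u Mass)"
      using i u e by (simp add: body_def upd_apply)
    then show "Q (i + 1) (upd (run body u) I0 0 (i + 1))"
      using Q i unfolding Q_def by (auto simp: upd_apply sum_below_Suc P_def)
  qed (use e n init in \<open>simp_all add: Q_def body_def upd_apply\<close>)
  moreover have "below (P g) n = {c. c \<in> active q \<and> q c = g}"
    by (auto simp: below_def P_def active_def)
  ultimately show ?thesis using g by (simp add: Q_def)
qed

end

section \<open>Packing the facilities around each open one into groups\<close>

context integral_instance
begin

definition group :: "int set \<Rightarrow> (int \<Rightarrow> int) \<Rightarrow> int \<Rightarrow> int set" where
  "group S fin x = {g \<in> S. fin g = x}"

text \<open>Here \<open>fin g\<close> is the leader of the group of \<open>g\<close>, and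
  \<open>acc h\<close> is the mass of the group of \<open>h\<close> that still accepts members, or
  exceeds \<open>T\<close> if there is none. The last clause is the charging argument: a new group
  costs \<open>T\<close>, paid by its own mass if it is heavy and otherwise by the accumulator above
  \<open>T\<close> that it replaces; the term with \<open>card H\<close> covers the initial
  accumulators.\<close>

definition merge_inv ::
    "int set \<Rightarrow> (int \<Rightarrow> int) \<Rightarrow> (int \<Rightarrow> int) \<Rightarrow> (int \<Rightarrow> int) \<Rightarrow>
     int set \<Rightarrow> (int \<Rightarrow> int) \<Rightarrow> (int \<Rightarrow> int) \<Rightarrow> (int \<Rightarrow> int) \<Rightarrow> bool" where
  "merge_inv H near key mass S fin acc lead \<longleftrightarrow>
     (\<forall>g\<in>S. fin g \<in> S \<and> fin (fin g) = fin g \<and>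
        (fin g = g \<or> near (fin g) = near g \<and> key (fin g) \<le> key g)) \<and>
     (\<forall>x\<in>S. fin x = x \<longrightarrow> group S fin x = {x} \<or> sum mass (group S fin x) \<le> 2 * T) \<and>
     (\<forall>h\<in>H. 0 \<le> acc h \<and> (T < acc h \<or>
        lead h \<in> S \<and> fin (lead h) = lead h \<and> near (lead h) = h \<and> acc h = sum mass (group S fin (lead h)))) \<and>
     T * int (card (fin ` S)) + sum acc H \<le> sum mass S + (2 * T + 1) * int (card H)"

lemma merge_invD:
  assumes inv: "merge_inv H near key mass S fin acc lead"
  shows "g \<in> S \<Longrightarrow> fin g \<in> S" "g \<in> S \<Longrightarrow> fin (fin g) = fin g"
    "g \<in> S \<Longrightarrow> fin g = g \<or> near (fin g) = near g \<and> key (fin g) \<le> key g"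
    "x \<in> S \<Longrightarrow> fin x = x \<Longrightarrow> group S fin x = {x} \<or> sum mass (group S fin x) \<le> 2 * T"
    "h \<in> H \<Longrightarrow> 0 \<le> acc h"
    "h \<in> H \<Longrightarrow> T < acc h \<or> lead h \<in> S \<and> fin (lead h) = lead h \<and> near (lead h) = h \<and>
       acc h = sum mass (group S fin (lead h))"
    "T * int (card (fin ` S)) + sum acc H \<le> sum mass S + (2 * T + 1) * int (card H)"
proof -
  note * = inv[unfolded merge_inv_def]
  note 1 = bspec[OF conjunct1[OF *]] and 2 = bspec[OF conjunct1[OF conjunct2[OF *]]]
    and 3 = bspec[OF conjunct1[OF conjunct2[OF conjunct2[OF *]]]]
  show "g \<in> S \<Longrightarrow> fin g \<in> S" "g \<in> S \<Longrightarrow> fin (fin g) = fin g"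
    "g \<in> S \<Longrightarrow> fin g = g \<or> near (fin g) = near g \<and> key (fin g) \<le> key g"
    using 1[of g] by simp_all
  show "x \<in> S \<Longrightarrow> fin x = x \<Longrightarrow> group S fin x = {x} \<or> sum mass (group S fin x) \<le> 2 * T"
    using 2[of x] by simp
  show "h \<in> H \<Longrightarrow> 0 \<le> acc h"
    "h \<in> H \<Longrightarrow> T < acc h \<or> lead h \<in> S \<and> fin (lead h) = lead h \<and> near (lead h) = h \<and>
       acc h = sum mass (group S fin (lead h))"
    using 3[of h] by simp_all
  show "T * int (card (fin ` S)) + sum acc H \<le> sum mass S + (2 * T + 1) * int (card H)"
    using * by (elim conjE)
qed

lemma group_fresh:
  assumes "b \<notin> S" "\<And>g. g \<in> S \<Longrightarrow> fin g \<in> S"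
  shows "group (insert b S) (fin(b := b)) x = (if x = b then {b} else group S fin x)"
  using assms by (auto simp: group_def)

lemma group_join:
  assumes "b \<notin> S" "l \<in> S"
  shows "group (insert b S) (fin(b := l)) x = (if x = l then insert b (group S fin x) else group S fin x)"
  using assms by (auto simp: group_def)

text \<open>Treats a heavy facility, which leaves the accumulators alone, together with a light one
  that starts a new group of its open facility. In both cases \<open>total\<close> states that the
  additional group is paid for.\<close>

lemma merge_fresh:
  assumes inv: "merge_inv H near key mass S fin acc lead" and S: "finite S" "b \<notin> S"
    and H: "finite H"
    and acc': "\<And>h. h \<in> H \<Longrightarrow> acc' h = acc h \<and> lead' h = lead h \<or>
      acc' h = mass b \<and> lead' h = b \<and> near b = h \<and> 0 \<le> mass b"
    and total: "T + sum acc' H \<le> sum acc H + mass b"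
  shows "merge_inv H near key mass (insert b S) (fin(b := b)) acc' lead'"
proof -
  note inv1 = merge_invD(1-3)[OF inv] and inv2 = merge_invD(4)[OF inv]
    and inv3 = merge_invD(5,6)[OF inv] and inv4 = merge_invD(7)[OF inv]
  have grp: "group (insert b S) (fin(b := b)) x = (if x = b then {b} else group S fin x)" for x
    using S(2) by (rule group_fresh) (rule inv1(1))
  have neq: "g \<noteq> b" "fin g \<noteq> b" if "g \<in> S" for g using S(2) inv1(1)[OF that] that by auto
  show ?thesis
    unfolding merge_inv_def
  proof (intro conjI ballI impI)
    fix g assume g: "g \<in> insert b S"
    show "(fin(b := b)) g \<in> insert b S"
      using g inv1(1)[of g] by (cases "g = b") simp_all
    show "(fin(b := b)) ((fin(b := b)) g) = (fin(b := b)) g"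
      using g inv1(2)[of g] neq(2)[of g] by (cases "g = b") simp_all
    show "(fin(b := b)) g = g \<or> near ((fin(b := b)) g) = near g \<and> key ((fin(b := b)) g) \<le> key g"
      using g inv1(3)[of g] by (cases "g = b") simp_all
  next
    fix x assume x: "x \<in> insert b S" "(fin(b := b)) x = x"
    show "group (insert b S) (fin(b := b)) x = {x} \<or>
        sum mass (group (insert b S) (fin(b := b)) x) \<le> 2 * T"
    proof (cases "x = b")
      case True
      then show ?thesis by (simp add: grp)
    next
      case False
      then have "x \<in> S" "fin x = x" using x by simp_all
      then show ?thesis using inv2[of x] False by (simp only: grp if_False)
    qed
  next
    fix h assume h: "h \<in> H"
    show "0 \<le> acc' h" using acc'[OF h] inv3(1)[OF h] by auto
    show "T < acc' h \<or> lead' h \<in> insert b S \<and> (fin(b := b)) (lead' h) = lead' h \<and> near (lead' h) = h \<and>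
        acc' h = sum mass (group (insert b S) (fin(b := b)) (lead' h))"
    proof (cases "acc' h = acc h \<and> lead' h = lead h")
      case True
      then show ?thesis unfolding grp using inv3(2)[OF h] neq(1)[of "lead h"] by auto
    next
      case False
      then have "acc' h = mass b \<and> lead' h = b \<and> near b = h" using acc'[OF h] by blast
      then show ?thesis unfolding grp by simp
    qed
  next
    have "(fin(b := b)) ` insert b S = insert b (fin ` S)" using S(2) by auto
    moreover have "b \<notin> fin ` S" using neq by auto
    ultimately have "card ((fin(b := b)) ` insert b S) = card (fin ` S) + 1" using S(1) by simp
    then show "T * int (card ((fin(b := b)) ` insert b S)) + sum acc' H \<le>
        sum mass (insert b S) + (2 * T + 1) * int (card H)"
      using inv4 total S by (simp add: algebra_simps)
  qed
qed

text \<open>An accumulated mass of at most \<open>T\<close> and a new one of at most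
  \<open>T\<close> stay within \<open>2 * T\<close>. The number of groups is unchanged, and
  \<open>sum acc H\<close> and the total mass grow by the same amount. Since keys come in increasing
  order, the leader is at least as close to the open facility as \<open>b\<close>.\<close>

lemma merge_join:
  assumes inv: "merge_inv H near key mass S fin acc lead" and S: "finite S" "b \<notin> S"
    and H: "finite H" "near b \<in> H" and acc: "acc (near b) \<le> T" and mass: "0 \<le> mass b" "mass b \<le> T"
    and least: "\<And>x. x \<in> S \<Longrightarrow> key x \<le> key b"
  shows "merge_inv H near key mass (insert b S) (fin(b := lead (near b)))
    (acc(near b := acc (near b) + mass b)) lead"
proof -
  define l where "l = lead (near b)"
  note inv1 = merge_invD(1-3)[OF inv] and inv2 = merge_invD(4)[OF inv]
    and inv3 = merge_invD(5,6)[OF inv] and inv4 = merge_invD(7)[OF inv]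
  have l: "l \<in> S" "fin l = l" "near l = near b" "acc (near b) = sum mass (group S fin l)"
    using inv3(2)[OF H(2)] acc by (auto simp: l_def)
  note grp = group_join[OF S(2) l(1)]
  have neq: "g \<noteq> b" if "g \<in> S" for g using S(2) that by auto
  have fin_group: "finite (group S fin x)" "b \<notin> group S fin x" for x
    using S by (auto simp: group_def)
  show ?thesis
    unfolding merge_inv_def l_def[symmetric]
  proof (intro conjI ballI impI)
    fix g assume g: "g \<in> insert b S"
    show "(fin(b := l)) g \<in> insert b S"
      using g inv1(1)[of g] l(1) by (cases "g = b") simp_all
    show "(fin(b := l)) ((fin(b := l)) g) = (fin(b := l)) g"
      using g inv1(1,2)[of g] l(1,2) neq[of "fin g"] neq[of l] by (cases "g = b") simp_all
    show "(fin(b := l)) g = g \<or> near ((fin(b := l)) g) = near g \<and> key ((fin(b := l)) g) \<le> key g"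
      using g inv1(3)[of g] l(3) least[OF l(1)] by (cases "g = b") simp_all
  next
    fix x assume x: "x \<in> insert b S" "(fin(b := l)) x = x"
    then have xS: "x \<in> S" "fin x = x" using neq[OF l(1)] by (auto split: if_splits)
    show "group (insert b S) (fin(b := l)) x = {x} \<or>
        sum mass (group (insert b S) (fin(b := l)) x) \<le> 2 * T"
    proof (cases "x = l")
      case True
      then have "sum mass (group (insert b S) (fin(b := l)) x) = acc (near b) + mass b"
        unfolding grp using fin_group l(4) by simp
      then show ?thesis using acc mass by simp
    next
      case False
      then show ?thesis unfolding grp using inv2[OF xS] by simp
    qed
  next
    fix h assume h: "h \<in> H"
    show "0 \<le> (acc(near b := acc (near b) + mass b)) h"
      using inv3(1)[OF h] mass by auto
    show "T < (acc(near b := acc (near b) + mass b)) h \<or>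
      lead h \<in> insert b S \<and> (fin(b := l)) (lead h) = lead h \<and> near (lead h) = h \<and>
        (acc(near b := acc (near b) + mass b)) h = sum mass (group (insert b S) (fin(b := l)) (lead h))"
    proof (cases "h = near b")
      case True
      have "acc (near b) + mass b = sum mass (group (insert b S) (fin(b := l)) l)"
        unfolding grp using fin_group l(4) by simp
      then show ?thesis using True l neq[OF l(1)] by (simp add: l_def[symmetric])
    next
      case False
      show ?thesis
      proof (cases "T < acc h")
        case notlt: False
        then have *: "lead h \<in> S" "fin (lead h) = lead h" "near (lead h) = h" "acc h = sum mass (group S fin (lead h))"
          using inv3(2)[OF h] by auto
        then have "lead h \<noteq> l" using False l by auto
        then show ?thesis unfolding grp using * False neq[OF *(1)] by simp
      qed (use False in simp)
    qed
  next
    have "(fin(b := l)) ` insert b S = fin ` S"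
    proof -
      have "(fin(b := l)) ` insert b S = insert l (fin ` S)" using S(2) by auto
      moreover have "l \<in> fin ` S" using imageI[OF l(1), of fin] l(2) by simp
      ultimately show ?thesis by (simp add: insert_absorb)
    qed
    moreover have "sum (acc(near b := acc (near b) + mass b)) H = sum acc H + mass b"
      using H by (simp add: sum.remove[of H "near b"] cong: sum.cong_simp)
    ultimately show "T * int (card ((fin(b := l)) ` insert b S)) + sum (acc(near b := acc (near b) + mass b)) H \<le>
        sum mass (insert b S) + (2 * T + 1) * int (card H)"
      using inv4 S by simp
  qed
qed

lemma run_merge:
  assumes env: "env s" and q: "q = s Fac" "valid q" and t: "t = run (by_key merge_step) s"
    and H: "finite H" and near: "\<And>g. g \<in> q ` active q \<Longrightarrow> s Nearest g \<in> H"
    and mass: "\<And>g. g \<in> q ` active q \<Longrightarrow> 0 \<le> s Mass g"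
    and acc: "\<And>h. h \<in> H \<Longrightarrow> s Acc h = T + 1"
  shows "\<exists>acc lead. merge_inv H (s Nearest) (s Key) (s Mass) (q ` active q) (t Final) acc lead"
proof -
  define Q where "Q S u \<longleftrightarrow> merge_inv H (s Nearest) (s Key) (s Mass) S (u Final) (u Acc) (u Lead)"
    for S and u :: state
  have fin: "finite (q ` active q)" by (intro finite_imageI finite_active)
  have "Q (q ` active q) t"
    unfolding t
  proof (rule run_by_key[OF env q])
    show "Q {} s"
      using acc T by (simp add: Q_def merge_inv_def algebra_simps)
    show "Q S u'" if "\<And>y. y \<notin> {I0, I1, Best, Todo} \<Longrightarrow> u' y = u y" "Q S u" for S u u'
      using that(2) that(1)[of Final] that(1)[of Acc] that(1)[of Lead] by (simp add: Q_def)
  next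
    fix S b u assume S: "S \<subseteq> q ` active q" and b: "b \<in> q ` active q" "b \<notin> S"
      and least: "\<And>x. x \<in> S \<Longrightarrow> s Key x \<le> s Key b" and ub: "u Best 0 = b"
      and fr: "\<And>y. y \<notin> mods merge_step \<Longrightarrow> y \<notin> {I0, I1, Best, Todo} \<Longrightarrow> u y = s y"
      and Q: "Q S u"
    have u: "u Mass = s Mass" "u Nearest = s Nearest" "u Thr = s Thr"
      by (auto intro!: fr simp: merge_step_def)
    note u = u envD(2)[OF env] ub
    have finS: "finite S" using S fin finite_subset by blast
    show "Q (insert b S) (run merge_step u)"
    proof (cases "T < s Mass b")
      case True
      then have "run merge_step u Final = (u Final)(b := b)" "run merge_step u Acc = u Acc"
        "run merge_step u Lead = u Lead"
        using u by (simp_all add: merge_step_def upd_apply)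
      then show ?thesis
        unfolding Q_def using merge_fresh[OF Q[unfolded Q_def] finS b(2) H, of "u Acc" "u Lead"] True by simp
    next
      case light: False
      show ?thesis
      proof (cases "T < u Acc (s Nearest b)")
        case True
        then have r: "run merge_step u Final = (u Final)(b := b)"
          "run merge_step u Acc = (u Acc)(s Nearest b := s Mass b)"
          "run merge_step u Lead = (u Lead)(s Nearest b := b)"
          using u light by (simp_all add: merge_step_def upd_apply)
        have "sum ((u Acc)(s Nearest b := s Mass b)) H = sum (u Acc) H - u Acc (s Nearest b) + s Mass b"
          using H near[OF b(1)] by (simp add: sum.remove[of H "s Nearest b"] cong: sum.cong_simp)
        then show ?thesis
          unfolding Q_def r using True mass[OF b(1)]
          by (intro merge_fresh[OF Q[unfolded Q_def] finS b(2) H]) auto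
      next
        case False
        then have r: "run merge_step u Final = (u Final)(b := u Lead (s Nearest b))"
          "run merge_step u Acc = (u Acc)(s Nearest b := u Acc (s Nearest b) + s Mass b)"
          "run merge_step u Lead = u Lead"
          using u light by (simp_all add: merge_step_def upd_apply)
        show ?thesis
          unfolding Q_def r using False light mass[OF b(1)] near[OF b(1)] least
          by (intro merge_join[OF Q[unfolded Q_def] finS b(2) H]) auto
      qed
    qed
  qed (auto simp: merge_step_def)
  then show ?thesis unfolding Q_def by blast
qed

end

section \<open>Initialization and the output as a list of stars\<close>

definition clients_of :: "(int \<Rightarrow> bool) \<Rightarrow> (int \<Rightarrow> int) \<Rightarrow> int \<Rightarrow> nat \<Rightarrow> nat list" where
  "clients_of P D x k = filter (\<lambda>c. P (int c) \<and> D (int c) = x) [0..<k]"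

definition star_list :: "(int \<Rightarrow> bool) \<Rightarrow> (int \<Rightarrow> int) \<Rightarrow> nat \<Rightarrow> nat \<Rightarrow> (nat \<times> nat list) list" where
  "star_list P D N k = map (\<lambda>x. (x, clients_of P D (int x) N))
     (filter (\<lambda>x. clients_of P D (int x) N \<noteq> []) [0..<k])"

definition enc_star :: "nat \<times> nat list \<Rightarrow> int list" where
  "enc_star = (\<lambda>(f, cs). int f # int (length cs) # map int cs)"

lemma clients_of_Suc:
  "clients_of P D x (Suc k) = clients_of P D x k @ (if P (int k) \<and> D (int k) = x then [k] else [])"
  by (simp add: clients_of_def)

lemma star_list_Suc:
  "star_list P D N (Suc k) = star_list P D N k @
    (if clients_of P D (int k) N \<noteq> [] then [(k, clients_of P D (int k) N)] else [])"
  by (simp add: star_list_def)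

context integral_instance
begin

lemma run_init:
  assumes env: "env s" and t: "t = run init s" and v: "0 \<le> v" "v < n"
  shows "t Price v = 2 \<and> t Fac v = -1 \<and> t Load v = 0 \<and> t Opened v = 0 \<and> t Mass v = 0 \<and> t Acc v = T + 1"
proof -
  note e = envD[OF env]
  define body where "body = block
    [Put Price (V I0) (Lit 2), Put Fac (V I0) (Lit (-1)), Put Load (V I0) (Lit 0),
     Put Opened (V I0) (Lit 0), Put Mass (V I0) (Lit 0),
     Put Acc (V I0) (Op Add (V Thr) (Lit 1))]"
  define Q where "Q i t \<longleftrightarrow> (\<forall>v. 0 \<le> v \<longrightarrow> v < i \<longrightarrow>
    t Price v = 2 \<and> t Fac v = -1 \<and> t Load v = 0 \<and> t Opened v = 0 \<and> t Mass v = 0 \<and> t Acc v = T + 1)"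
    for i and t :: state
  have "Q n t"
    unfolding t init_def body_def[symmetric]
  proof (rule run_For_induct)
    fix i u assume i: "0 \<le> i" "i < n" "u I0 0 = i" and Q: "Q i u"
      and fr: "\<And>y. y \<noteq> I0 \<Longrightarrow> y \<notin> mods body \<Longrightarrow> u y = s y"
    have "u Thr 0 = T" using fr[of Thr] e by (simp add: body_def)
    then show "Q (i + 1) (upd (run body u) I0 0 (i + 1))"
      using Q i by (simp add: Q_def body_def upd_apply)
  qed (use e n in \<open>simp_all add: Q_def body_def\<close>)
  then show ?thesis using v by (simp add: Q_def)
qed

text \<open>Appending a star changes only cells from the current position on, so the encoding of the
  earlier stars persists. The inner invariant leaves the two header cells alone; cell 0 receives the
  number of stars at the very end.\<close>

lemma run_write_stars:
  assumes env: "env s" and q: "q = s Fac" and D: "D = (\<lambda>c. s Final (q c))"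
    and t: "t = run write_stars s" and N: "N = nat n"
    and i: "i < length (enc_stars (star_list (\<lambda>c. 0 \<le> q c) D N N))"
  shows "t IO (int i) = enc_stars (star_list (\<lambda>c. 0 \<le> q c) D N N) ! i"
proof -
  note e = envD[OF env]
  define P where "P c \<longleftrightarrow> 0 \<le> q c" for c
  define put where "put = Cond (le (Lit 0) (Arr Fac (V I1)))
       (Cond (eq (Arr Final (Arr Fac (V I1))) (V I0))
         (Then (Out (Op Add (Op Add (V Pos) (V Cnt)) (Lit 2)) (V I1))
           (Put Cnt (Lit 0) (Op Add (V Cnt) (Lit 1)))) Pass) Pass"
  have mods: "mods put = {IO, Cnt}" by (auto simp: put_def)
  have inner: "run (For I1 (V Size) put) u Cnt 0 = int (length (clients_of P D x N)) \<and>
      (\<forall>k < length (clients_of P D x N). run (For I1 (V Size) put) u IO (p + 2 + int k) = int (clients_of P D x N ! k)) \<and>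
      (\<forall>a < p + 2. run (For I1 (V Size) put) u IO a = u IO a)"
    if u: "u Size 0 = n" "u Fac = q" "u Final = s Final" "u I0 0 = x" "u Pos 0 = p" "u Cnt 0 = 0" and p: "1 \<le> p"
    for u x p
  proof -
    define Q where "Q i w \<longleftrightarrow> w Cnt 0 = int (length (clients_of P D x (nat i))) \<and>
      (\<forall>k < length (clients_of P D x (nat i)). w IO (p + 2 + int k) = int (clients_of P D x (nat i) ! k)) \<and>
      (\<forall>a < p + 2. w IO a = u IO a)" for i and w :: state
    have "Q n (run (For I1 (V Size) put) u)"
    proof (rule run_For_induct)
      fix i v assume i: "0 \<le> i" "i < n" "v I1 0 = i" and Q: "Q i v"
        and fr: "\<And>y. y \<noteq> I1 \<Longrightarrow> y \<notin> mods put \<Longrightarrow> v y = u y"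
      have v: "v Fac = q" "v I0 0 = x" "v Final = s Final" "v Pos 0 = p"
        using u fr by (simp_all add: mods)
      define L where "L = clients_of P D x (nat i)"
      have Q': "v Cnt 0 = int (length L)" "\<And>k. k < length L \<Longrightarrow> v IO (p + 2 + int k) = int (L ! k)"
        "\<And>a. a < p + 2 \<Longrightarrow> v IO a = u IO a"
        using Q by (auto simp: Q_def L_def)
      have next_L: "clients_of P D x (nat (i + 1)) = L @ (if P i \<and> D i = x then [nat i] else [])"
        using i clients_of_Suc[of P D x "nat i"] by (simp add: nat_add_distrib L_def)
      show "Q (i + 1) (upd (run put v) I1 0 (i + 1))"
      proof (cases "P i \<and> D i = x")
        case False
        then have "run put v = v" using v i by (auto simp: put_def P_def D)
        then show ?thesis using Q' False unfolding Q_def next_L by (simp add: upd_apply)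
      next
        case True
        then have "run put v = upd (upd v IO (p + int (length L) + 2) i) Cnt 0 (int (length L) + 1)"
          using v i p Q'(1) by (simp add: put_def P_def D upd_apply)
        then show ?thesis using Q' True i p unfolding Q_def next_L
          by (auto simp: upd_apply nth_append less_Suc_eq)
      qed
    qed (use u n in \<open>simp_all add: mods Q_def upd_apply clients_of_def\<close>)
    then show ?thesis by (simp add: Q_def N)
  qed
  define enc where "enc k = concat (map enc_star (star_list P D N k))" for k
  define Q where "Q i u \<longleftrightarrow> u Pos 0 = 1 + int (length (enc (nat i))) \<and>
    (\<forall>k < length (enc (nat i)). u IO (1 + int k) = enc (nat i) ! k) \<and>
    u Stars 0 = int (length (star_list P D N (nat i)))" for i and u :: state
  define s0 where "s0 = upd (upd s Pos 0 1) Stars 0 0"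
  have ms: "mods write_star = {IO, Cnt, I1, Pos, Stars}" by (auto simp: write_star_def)
  have "Q n (run (For I0 (V Size) write_star) s0)"
  proof (rule run_For_induct)
    fix i u assume i: "0 \<le> i" "i < n" "u I0 0 = i" and Q: "Q i u"
      and fr: "\<And>y. y \<noteq> I0 \<Longrightarrow> y \<notin> mods write_star \<Longrightarrow> u y = s0 y"
    have u: "u Fac = q" "u Final = s Final" "u Size 0 = n"
      using fr e q by (simp_all add: ms s0_def upd_apply)
    define p where "p = u Pos 0"
    define E where "E = enc (nat i)"
    have p: "p = 1 + int (length E)" using Q by (simp add: Q_def p_def E_def)
    have old: "u IO (1 + int k) = E ! k" if "k < length E" for k
      using Q that by (simp add: Q_def E_def)
    define L where "L = clients_of P D i N"
    define w where "w = run (For I1 (V Size) put) (upd u Cnt 0 0)"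
    have w: "w Cnt 0 = int (length L)" "\<And>k. k < length L \<Longrightarrow> w IO (p + 2 + int k) = int (L ! k)"
      "\<And>a. a < p + 2 \<Longrightarrow> w IO a = u IO a"
      using inner[of "upd u Cnt 0 0" i p] u i(3) p by (auto simp: w_def L_def p_def upd_apply)
    have w_fr: "w I0 0 = i" "w Pos 0 = p" "w Stars = u Stars"
      using i(3) by (simp_all add: w_def run_unmodified mods upd_apply p_def)
    have run_eq: "run write_star u = run (Cond (lt (Lit 0) (V Cnt)) (block
       [Out (V Pos) (V I0),
        Out (Op Add (V Pos) (Lit 1)) (V Cnt),
        Put Pos (Lit 0) (Op Add (Op Add (V Pos) (V Cnt)) (Lit 2)),
        Put Stars (Lit 0) (Op Add (V Stars) (Lit 1))]) Pass) w"
      by (simp add: write_star_def w_def put_def)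
    have nat_i: "nat (i + 1) = Suc (nat i)" "int (nat i) = i" using i by auto
    have stars: "star_list P D N (nat (i + 1)) = star_list P D N (nat i) @ (if L \<noteq> [] then [(nat i, L)] else [])"
      unfolding nat_i star_list_Suc by (simp add: nat_i L_def)
    show "Q (i + 1) (upd (run write_star u) I0 0 (i + 1))"
    proof (cases "L = []")
      case True
      then have "run write_star u = w" using w by (simp add: run_eq)
      moreover have "enc (nat (i + 1)) = E" unfolding enc_def stars E_def by (simp add: True)
      ultimately show ?thesis
        using Q True w(3) p w_fr old unfolding Q_def stars
        by (simp add: upd_apply E_def[symmetric] p_def[symmetric])
    next
      case False
      have E': "enc (nat (i + 1)) = E @ (i # int (length L) # map int L)"
        unfolding enc_def stars E_def using False nat_i by (simp add: enc_star_def)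
      have r: "run write_star u = upd (upd (upd (upd w IO p i) IO (p + 1) (int (length L)))
          Pos 0 (p + int (length L) + 2)) Stars 0 (u Stars 0 + 1)"
        using False w(1) w_fr p by (simp add: run_eq upd_apply)
      have "run write_star u IO (1 + int k) = (E @ (i # int (length L) # map int L)) ! k"
        if "k < length E + 2 + length L" for k
      proof -
        note k = that
        \<comment> \<open>A cell belongs to the earlier stars, or it is the facility, the number of
          clients or one of the clients of the new star.\<close>
        consider "k < length E" | "k = length E" | "k = length E + 1" | j where "k = length E + 2 + j" "j < length L"
        proof -
          have "k < length E \<or> k = length E \<or> k = length E + 1 \<or>
              k = length E + 2 + (k - (length E + 2)) \<and> k - (length E + 2) < length L"
            using k by linarith
          then show ?thesis by (elim disjE conjE) (rule that; assumption)+
        qed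
        then show ?thesis
        proof cases
          case 1
          then show ?thesis using p w(3)[of "1 + int k"] old[of k] by (simp add: r upd_apply nth_append)
        next
          case 4
          then show ?thesis using p w(2)[of j] by (simp add: r upd_apply nth_append algebra_simps)
        qed (use p in \<open>simp_all add: r upd_apply nth_append\<close>)
      qed
      then show ?thesis
        using Q p False unfolding Q_def E' stars by (simp add: r upd_apply)
    qed
  next
    show "Q 0 (upd s0 I0 0 0)" by (simp add: Q_def s0_def upd_apply enc_def star_list_def)
  qed (use e n in \<open>simp_all add: ms s0_def upd_apply\<close>)
  moreover have "t = upd (run (For I0 (V Size) write_star) s0) IO 0 (run (For I0 (V Size) write_star) s0 Stars 0)"
    by (simp add: t write_stars_def s0_def)
  moreover have "enc_stars (star_list P D N N) = int (length (star_list P D N N)) # enc N"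
    by (simp add: enc_stars_def enc_def enc_star_def)
  ultimately show ?thesis
    using i unfolding P_def[symmetric]
    by (cases i) (auto simp: Q_def upd_apply N)
qed

section \<open>Combining the phases: load and number of stars\<close>

lemma radius_nonneg:
  assumes "valid q" "0 \<le> f" "f < n" "radius_up_to n q f r"
  shows "0 \<le> r"
proof -
  have "0 \<le> ratio q f x" for x
    unfolding ratio_def using assms T
    by (intro div_int_pos_iff[THEN iffD2] disjI1 disjI2 conjI add_nonneg_nonneg sum_nonneg nonneg)
      (auto simp: prefix_def valid_def active_def)
  then show ?thesis using assms(4) T by (auto simp: radius_up_to_def)
qed

text \<open>The premise \<open>2 * n \<le> T\<close> pays for the integer radii: rounding a ratio
  down loses less than 1 per client of the prefix, so less than \<open>n\<close> and at most half of
  \<open>T\<close> in total.\<close>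

lemma packing_locale:
  assumes feas: "feasible opt" and q: "valid q" "active q = C" and T': "0 < T" "2 * n \<le> T"
    and R: "\<And>f. 0 \<le> f \<Longrightarrow> f < n \<Longrightarrow> radius_up_to n q f (R f)"
    and H: "H \<subseteq> q ` C" "\<forall>g\<in>q ` C. \<exists>h\<in>H. d g h \<le> 2 * R g"
      "\<forall>h\<in>H. \<forall>h'\<in>H. h \<noteq> h' \<longrightarrow> 2 * R h < d h h'"
  shows "ball_packing {0..<n} (\<lambda>x y. real_of_int (d x y)) C q opt (opt ` C) (real_of_int T) (\<lambda>f. real_of_int (R f)) H"
proof
  have qn: "q c \<in> {0..<n}" if "c \<in> C" for c using q that by (auto simp: valid_def)
  have Hn: "H \<subseteq> {0..<n}" using H(1) qn by auto
  show "real_of_int (d x z) \<le> real_of_int (d x y) + real_of_int (d y z)"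
    if "x \<in> {0..<n}" "y \<in> {0..<n}" "z \<in> {0..<n}" for x y z
    using triangle[OF that] by (metis of_int_add of_int_le_iff)
  show "q ` C \<subseteq> {0..<n}" using qn by auto
  show "opt ` C \<subseteq> {0..<n}" using feas FC by (auto simp: feasible_def)
  show "H \<subseteq> {0..<n}" "finite H" using Hn finite_subset by auto
  show "real_of_int (R h) + real_of_int (R h') \<le> real_of_int (d h h')"
    if h: "h \<in> H" "h' \<in> H" "h \<noteq> h'" for h h'
  proof -
    \<comment> \<open>The average of the two one-sided separations.\<close>
    have "2 * R h < d h h'" "2 * R h' < d h' h" using H(3) h by auto
    moreover have "d h' h = d h h'" using h Hn by (intro sym) auto
    ultimately show ?thesis by linarith
  qed
  show "\<exists>h\<in>H. real_of_int (d (q c) h) \<le> 2 * real_of_int (R (q c))" if "c \<in> C" for c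
  proof -
    obtain h where "h \<in> H" "d (q c) h \<le> 2 * R (q c)" using H(2) \<open>c \<in> C\<close> by blast
    then show ?thesis by (intro bexI[of _ h]) linarith+
  qed
  show "real_of_int (R (q c)) * real (card {y \<in> C. real_of_int (d (q c) (q y)) \<le> real_of_int (d (q c) (q x))}) \<le>
      real_of_int T + (\<Sum>y | y \<in> C \<and> real_of_int (d (q c) (q y)) \<le> real_of_int (d (q c) (q x)). real_of_int (d (q c) (q y)))"
    if c: "c \<in> C" and x: "x \<in> C" for c x
  proof -
    define S where "S = prefix q (q c) x"
    have "R (q c) \<le> ratio q (q c) x"
      using R[of "q c"] qn[OF c] x pts q(2) by (auto simp: radius_up_to_def)
    then have "R (q c) * int (card S) \<le> ratio q (q c) x * int (card S)" by (intro mult_right_mono) auto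
    also have "\<dots> \<le> T + (\<Sum>y\<in>S. d (q c) (q y))"
    proof (cases "card S = 0")
      case True
      have "0 \<le> (\<Sum>y\<in>S. d (q c) (q y))"
        using qn c q(2) by (intro sum_nonneg nonneg) (auto simp: S_def prefix_def)
      then show ?thesis using True T by simp
    next
      case False
      then show ?thesis
        unfolding ratio_def S_def[symmetric]
        using div_mult_mod_eq[of "T + (\<Sum>y\<in>S. d (q c) (q y))" "int (card S)"]
          pos_mod_sign[of "int (card S)" "T + (\<Sum>y\<in>S. d (q c) (q y))"] by linarith
    qed
    finally have "real_of_int (R (q c)) * real (card S) \<le> real_of_int T + (\<Sum>y\<in>S. real_of_int (d (q c) (q y)))"
      by (metis of_int_add of_int_le_iff of_int_mult of_int_of_nat_eq of_int_sum)
    then show ?thesis by (simp add: S_def prefix_def q(2))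
  qed
  show "\<exists>S\<subseteq>C. real_of_int T / 2 \<le> (\<Sum>c\<in>S. real_of_int (R h) - real_of_int (d h (q c)))" if h: "h \<in> H" for h
  proof -
    obtain c where c: "c \<in> C" "q c = h" using h H(1) by auto
    have hn: "0 \<le> h" "h < n" using qn[OF c(1)] c(2) by auto
    consider "R h = T" | x where "x \<in> C" "R h = ratio q h x"
      using R[OF hn] q(2) by (auto simp: radius_up_to_def)
    then show ?thesis
    proof cases
      case 1
      \<comment> \<open>The set consisting of one client located at \<open>h\<close>, which
        contributes the full radius \<open>T\<close>.\<close>
      then show ?thesis using c T self_dist[of h] hn by (intro exI[of _ "{c}"]) auto
    next
      case 2
      define S where "S = prefix q h x"
      have S: "S \<subseteq> C" "finite S" "x \<in> S"
        using 2 q(2) finite_FC finite_subset by (auto simp: S_def prefix_def)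
      then have pos: "0 < int (card S)" by (auto simp: card_gt_0_iff)
      have "S \<subseteq> {0..<n}" using S(1) FC(2) by blast
      then have "card S \<le> card {0..<n}" by (intro card_mono) auto
      then have small: "int (card S) \<le> n" using n by simp
      have "T + (\<Sum>c\<in>S. d h (q c)) = R h * int (card S) + (T + (\<Sum>c\<in>S. d h (q c))) mod int (card S)"
        unfolding 2(2) ratio_def S_def[symmetric] by simp
      also have "\<dots> < R h * int (card S) + int (card S)" using pos by simp
      finally have strict: "T + (\<Sum>c\<in>S. d h (q c)) < R h * int (card S) + int (card S)" .
      \<comment> \<open>The deficit from rounding is below \<open>card S\<close>, which is at most
        \<open>n\<close> and hence at most half of \<open>T\<close>.\<close>
      have "T \<le> 2 * (R h * int (card S) - (\<Sum>c\<in>S. d h (q c)))"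
      proof -
        have "T \<le> 2 * (x - y)" if "T + y < x + m" "m \<le> n" for x y m :: int
          using that T'(2) by presburger
        from this[OF strict small] show ?thesis .
      qed
      also have "R h * int (card S) - (\<Sum>c\<in>S. d h (q c)) = (\<Sum>c\<in>S. R h - d h (q c))"
        by (simp add: sum_subtractf)
      finally have "real_of_int T \<le> real_of_int (2 * (\<Sum>c\<in>S. R h - d h (q c)))"
        by (simp only: of_int_le_iff)
      then show ?thesis using S(1) by (intro exI[of _ S]) simp
    qed
  qed
  show "0 < real_of_int T" using T' by simp
  show "opt ` C \<subseteq> opt ` C" ..
qed (use finite_FC nonneg sym in auto)

text \<open>\<open>D\<close> maps each client to its final facility. The load bound holds for every
  \<open>T\<close>; the size bound is restricted to thresholds that are positive and large enough
  for integer radii.\<close>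

theorem run_solve:
  assumes env: "env s" and t: "t = run (Then solve write_stars) s" and feas: "feasible opt" and N: "N = nat n"
  shows "\<exists>D P. (\<forall>c\<in>C. D c \<in> F) \<and> (\<forall>x. (\<Sum>c | c \<in> C \<and> D c = x. d x c) \<le> 2 * T) \<and>
    (0 < T \<longrightarrow> 2 * n \<le> T \<longrightarrow> card (D ` C) \<le> 63 * card (opt ` C)) \<and>
    (\<forall>c. 0 \<le> c \<longrightarrow> c < n \<longrightarrow> (P c \<longleftrightarrow> c \<in> C)) \<and>
    (\<forall>i < length (enc_stars (star_list P D N N)). t IO (int i) = enc_stars (star_list P D N N) ! i)"
proof -
  define s1 where "s1 = run init s"
  define s2 where "s2 = run auction_loop s1"
  define s3 where "s3 = run radii s2"
  define s4 where "s4 = run (by_key open_step) s3"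
  define s5 where "s5 = run nearest s4"
  define s6 where "s6 = run masses s5"
  define s7 where "s7 = run (by_key merge_step) s6"
  have t: "t = run write_stars s7"
    by (simp add: t solve_def s7_def s6_def s5_def s4_def s3_def s2_def s1_def)
  have env1: "env s1" unfolding s1_def using env by (subst env_run) (auto simp: program_defs)
  have env2: "env s2" unfolding s2_def using env1 by (subst env_run) (auto simp: program_defs)
  have env3: "env s3" unfolding s3_def using env2 by (subst env_run) (auto simp: program_defs)
  have env4: "env s4" unfolding s4_def using env3 by (subst env_run) (auto simp: program_defs)
  have env5: "env s5" unfolding s5_def using env4 by (subst env_run) (auto simp: program_defs)
  have env6: "env s6" unfolding s6_def using env5 by (subst env_run) (auto simp: program_defs)
  have env7: "env s7" unfolding s7_def using env6 by (subst env_run) (auto simp: program_defs)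
  have i1: "s1 Price v = 2 \<and> s1 Fac v = -1 \<and> s1 Load v = 0 \<and> s1 Opened v = 0 \<and> s1 Mass v = 0 \<and> s1 Acc v = T + 1"
    if "0 \<le> v" "v < n" for v
    using run_init[OF env s1_def that] .
  define q where "q = s2 Fac"
  have inv: "auction_inv (s2 Price) q (s2 Paid) (s2 Load)"
    unfolding q_def by (rule run_auction_loop[OF env1 _ s2_def]) (use i1 in blast)
  have "active q = C \<and> (\<forall>f\<in>F. s2 Load f \<le> 2 * T)"
    unfolding q_def by (rule run_auction_loop(2)[OF env1 _ s2_def feas]) (use i1 in blast)
  then have act: "active q = C" and capped: "\<And>f. f \<in> F \<Longrightarrow> s2 Load f \<le> 2 * T" by auto
  have qF: "q c \<in> F" if "c \<in> C" for c
    using auction_inv_client[OF inv, of c] that act by blast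
  have valid: "valid q" using qF pts(1,2) by (auto simp: valid_def act)
  have qn: "q c \<in> {0..<n}" if "c \<in> C" for c using qF[OF that] FC by auto
  have fac: "s3 Fac = q" "s4 Fac = q" "s5 Fac = q" "s6 Fac = q" "s7 Fac = q"
    by (simp_all add: q_def s7_def s6_def s5_def s4_def s3_def run_unmodified program_defs)
  define R where "R = s3 Key"
  have R: "radius_up_to n q f (R f)" if "0 \<le> f" "f < n" for f
    unfolding R_def by (rule run_radii[OF env2 q_def valid s3_def that])
  define H where "H = opened s4"
  have op3: "opened s3 = {}"
    using i1 by (auto simp: opened_def s3_def s2_def run_unmodified program_defs)
  have H: "H \<subseteq> q ` C \<and> (\<forall>g\<in>q ` C. \<exists>h\<in>H. d g h \<le> 2 * R g) \<and>
      (\<forall>h\<in>H. \<forall>h'\<in>H. h \<noteq> h' \<longrightarrow> 2 * R h < d h h')"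
    unfolding H_def R_def act[symmetric]
    by (rule run_open[OF env3 fac(1)[symmetric] valid s4_def op3])
      (use R radius_nonneg[OF valid] qn act in \<open>auto simp: R_def\<close>)
  have Hn: "H \<subseteq> {0..<n}" using H qn by auto
  have finH: "finite H" using Hn finite_subset by blast
  define near where "near = s5 Nearest"
  define key where "key = s5 Key"
  have near: "near g \<in> H" "key g = d g (near g)" "\<And>h. h \<in> H \<Longrightarrow> key g \<le> d g h" if "g \<in> q ` C" for g
  proof -
    have "opened s4 \<noteq> {}" using H that unfolding H_def by auto
    then show "near g \<in> H" "key g = d g (near g)" "\<And>h. h \<in> H \<Longrightarrow> key g \<le> d g h"
      using run_nearest[OF env4 s5_def, of g] that qn by (auto simp: near_def key_def H_def)
  qed
  have key_nonneg: "0 \<le> key g" if "g \<in> q ` C" for g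
    unfolding near(2)[OF that] using near(1)[OF that] Hn that qn by (intro nonneg) auto
  define mass where "mass = s6 Mass"
  have mass: "mass g = (\<Sum>c | c \<in> C \<and> q c = g. d g c + 2 * key g)" if "g \<in> q ` C" for g
    unfolding mass_def key_def act[symmetric]
    by (rule run_masses[OF env5 fac(3)[symmetric] valid s6_def])
      (use i1 that qn in \<open>auto simp: s5_def s4_def s3_def s2_def run_unmodified program_defs\<close>)
  have mass_nonneg: "0 \<le> mass g" if "g \<in> q ` C" for g
    unfolding mass[OF that] using key_nonneg[OF that] that qn FC
    by (intro sum_nonneg add_nonneg_nonneg nonneg) auto
  have s6: "s6 Nearest = near" "s6 Key = key" "s6 Acc = s1 Acc"
    by (simp_all add: near_def key_def s6_def s5_def s4_def s3_def s2_def run_unmodified program_defs)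
  define fin where "fin = s7 Final"
  obtain acc lead where merged: "merge_inv H near key mass (q ` C) fin acc lead"
    using run_merge[OF env6 fac(4)[symmetric] valid s7_def finH] near(1) mass_nonneg i1 Hn
    unfolding s6 act fin_def mass_def by (metis atLeastLessThan_iff subsetD)
  note m = merge_invD[OF merged]
  define D where "D c = fin (q c)" for c
  have D: "D c \<in> q ` C" "fin (D c) = D c"
    "D c = q c \<or> near (D c) = near (q c) \<and> key (D c) \<le> key (q c)" if "c \<in> C" for c
    using m(1-3)[of "q c"] that by (auto simp: D_def)
  have DF: "D c \<in> F" if "c \<in> C" for c using D(1)[OF that] qF by auto
  have load: "(\<Sum>c | c \<in> C \<and> D c = x. d x c) \<le> 2 * T" for x
  proof (cases "x \<in> D ` C")
    case False
    then have "{c. c \<in> C \<and> D c = x} = {}" by auto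
    then show ?thesis using T by (simp only: sum.empty)
  next
    case True
    then have x: "x \<in> q ` C" "fin x = x" using D by auto
    consider "group (q ` C) fin x = {x}" | "sum mass (group (q ` C) fin x) \<le> 2 * T"
      using m(4)[OF x] by blast
    then show ?thesis
    proof cases
      case 1
      \<comment> \<open>A facility alone in its group serves the same clients as in the auction,
        which capped its load.\<close>
      then have "{c. c \<in> C \<and> D c = x} = {c. c \<in> active q \<and> q c = x}"
        unfolding act by (auto simp: group_def D_def)
      then have "(\<Sum>c | c \<in> C \<and> D c = x. d x c) = star_load_of q x" by (simp add: star_load_of_def)
      also have "x \<in> F" using x qF by auto
      then have "star_load_of q x \<le> 2 * T" using auction_inv_facility(2)[OF inv] capped by auto
      finally show ?thesis .
    next
      case 2
      have "(\<Sum>c | c \<in> C \<and> D c = x. d x c) \<le> (\<Sum>c | c \<in> C \<and> D c = x. d (q c) c + 2 * key (q c))"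
      proof (intro sum_mono)
        fix c assume "c \<in> {c. c \<in> C \<and> D c = x}"
        then have c: "c \<in> C" "D c = x" by auto
        have g: "q c \<in> q ` C" "q c \<in> {0..<n}" "x \<in> {0..<n}" "c \<in> {0..<n}"
          using c qn D(1)[OF c(1)] FC by auto
        \<comment> \<open>Leader and facility share the nearest open facility, and the leader is no
          farther from it.\<close>
        have "d x (q c) \<le> 2 * key (q c)"
          using D(3)[OF c(1)] unfolding c(2)
        proof
          assume "x = q c"
          then show ?thesis using self_dist[OF g(2)] key_nonneg[OF g(1)] by simp
        next
          assume *: "near x = near (q c) \<and> key x \<le> key (q c)"
          have h: "near (q c) \<in> {0..<n}" using near(1)[OF g(1)] Hn by auto
          have "d x (q c) \<le> d x (near (q c)) + d (near (q c)) (q c)" using g h by (intro triangle)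
          also have "d (near (q c)) (q c) = key (q c)" using near(2)[OF g(1)] sym[OF g(2) h] by simp
          also have "d x (near (q c)) = key x" using near(2)[OF x(1)] * by simp
          finally show ?thesis using * by simp
        qed
        moreover have "d x c \<le> d x (q c) + d (q c) c" using g by (intro triangle)
        ultimately show "d x c \<le> d (q c) c + 2 * key (q c)" by simp
      qed
      also have "\<dots> = (\<Sum>g\<in>group (q ` C) fin x. \<Sum>c | c \<in> {c. c \<in> C \<and> D c = x} \<and> q c = g. d (q c) c + 2 * key (q c))"
        using finite_FC by (intro sum.group[symmetric]) (auto simp: group_def D_def)
      also have "\<dots> = (\<Sum>g\<in>group (q ` C) fin x. mass g)"
      proof (intro sum.cong refl)
        fix g assume g: "g \<in> group (q ` C) fin x"
        then have "mass g = (\<Sum>c | c \<in> C \<and> q c = g. d g c + 2 * key g)"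
          by (intro mass) (auto simp: group_def)
        also have "\<dots> = (\<Sum>c | c \<in> {c. c \<in> C \<and> D c = x} \<and> q c = g. d (q c) c + 2 * key (q c))"
          using g by (intro sum.cong) (auto simp: group_def D_def)
        finally show "(\<Sum>c | c \<in> {c. c \<in> C \<and> D c = x} \<and> q c = g. d (q c) c + 2 * key (q c)) = mass g" ..
      qed
      finally show ?thesis using 2 by simp
    qed
  qed
  have size: "card (D ` C) \<le> 63 * card (opt ` C)" if T': "0 < T" "2 * n \<le> T"
  proof -
    interpret auction F C "active q" d T opt q "s2 Price" "s2 Paid"
      by (rule auction_locale[OF feas inv])
    interpret bp: ball_packing "{0..<n}" "\<lambda>x y. real_of_int (d x y)" C q opt "opt ` C" "real_of_int T"
        "\<lambda>f. real_of_int (R f)" H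
      using H by (intro packing_locale[OF feas valid act T' R]) auto
    define k where "k = real (card (opt ` C))"
    define Tr where "Tr = real_of_int T"
    define cost where "cost = (\<Sum>c\<in>C. real_of_int (d (q c) c))"
    define move where "move = (\<Sum>c\<in>C. real_of_int (d (q c) (opt c)))"
    have Tr: "0 < Tr" using T' by (simp add: Tr_def)
    have "real_of_int (\<Sum>c\<in>C. d (q c) c) \<le> real_of_int (2 * int (card (opt ` C)) * T)"
      using assignment_cost unfolding act by (simp only: of_int_le_iff)
    then have cost: "cost \<le> 2 * k * Tr" by (simp add: cost_def k_def Tr_def)
    have "real_of_int (\<Sum>c\<in>C. d (opt c) c) \<le> real_of_int (int (card (opt ` C)) * T)"
      using opt_cost by (simp only: of_int_le_iff)
    then have opt: "(\<Sum>c\<in>C. real_of_int (d (opt c) c)) \<le> k * Tr" by (simp add: k_def Tr_def)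
    have "move \<le> (\<Sum>c\<in>C. real_of_int (d (q c) c) + real_of_int (d (opt c) c))"
      unfolding move_def
    proof (intro sum_mono)
      fix c assume c: "c \<in> C"
      have p: "q c \<in> {0..<n}" "c \<in> {0..<n}" "opt c \<in> {0..<n}"
        using c qn FC feas by (auto simp: feasible_def)
      have "d (q c) (opt c) \<le> d (q c) c + d (opt c) c"
        using triangle[OF p] sym[OF p(2,3)] by simp
      then show "real_of_int (d (q c) (opt c)) \<le> real_of_int (d (q c) c) + real_of_int (d (opt c) c)"
        by linarith
    qed
    then have move: "move \<le> 3 * k * Tr" using cost opt by (simp add: sum.distrib cost_def)
    have "real (card H) * Tr \<le> k * Tr + 2 * move"
      using bp.card_opened by (simp add: k_def Tr_def move_def)
    then have cardH: "real (card H) * Tr \<le> 7 * k * Tr" using move by simp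
    have "(\<Sum>c\<in>C. real_of_int (key (q c))) \<le> 6 * move + 2 * Tr * k"
      using bp.connection_cost[of "\<lambda>c. real_of_int (key (q c))"] near(3)
      by (simp add: k_def Tr_def move_def)
    then have conn: "(\<Sum>c\<in>C. real_of_int (key (q c))) \<le> 20 * k * Tr"
      using move by (simp add: algebra_simps)
    have "sum mass (q ` C) = (\<Sum>g\<in>q ` C. \<Sum>c | c \<in> C \<and> q c = g. d (q c) c + 2 * key (q c))"
      by (intro sum.cong refl) (auto simp: mass intro!: sum.cong)
    also have "\<dots> = (\<Sum>c\<in>C. d (q c) c + 2 * key (q c))"
      using finite_FC by (intro sum.group) auto
    finally have "real_of_int (sum mass (q ` C)) = cost + 2 * (\<Sum>c\<in>C. real_of_int (key (q c)))"
      by (simp add: cost_def sum.distrib sum_distrib_left)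
    then have mass_total: "real_of_int (sum mass (q ` C)) \<le> 42 * k * Tr" using cost conn by simp
    have "0 \<le> sum acc H" using m(5) by (intro sum_nonneg)
    then have "T * int (card (fin ` q ` C)) \<le> sum mass (q ` C) + (2 * T + 1) * int (card H)"
      using m(7) by simp
    also have "(2 * T + 1) * int (card H) \<le> (3 * T) * int (card H)"
      using T' by (intro mult_right_mono) auto
    finally have "real_of_int (T * int (card (fin ` q ` C))) \<le>
        real_of_int (sum mass (q ` C) + (3 * T) * int (card H))"
      by (simp only: of_int_le_iff)
    then have "Tr * real (card (fin ` q ` C)) \<le> real_of_int (sum mass (q ` C)) + 3 * (real (card H) * Tr)"
      by (simp add: Tr_def algebra_simps)
    also have "\<dots> \<le> Tr * (63 * k)" using mass_total cardH by (simp add: algebra_simps)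
    finally have "real (card (fin ` q ` C)) \<le> 63 * k" using Tr by simp
    moreover have "D ` C = fin ` q ` C" by (auto simp: D_def)
    ultimately show ?thesis by (simp add: k_def)
  qed
  have P: "0 \<le> q c \<longleftrightarrow> c \<in> C" if "0 \<le> c" "c < n" for c
    using that unfolding act[symmetric] active_def by simp
  have out: "\<forall>i < length (enc_stars (star_list (\<lambda>c. 0 \<le> q c) D N N)).
      t IO (int i) = enc_stars (star_list (\<lambda>c. 0 \<le> q c) D N N) ! i"
    using run_write_stars[OF env7 fac(5)[symmetric] _ t N, of D] by (simp add: D_def fin_def fun_eq_iff)
  show ?thesis
    using DF load size P out by (intro exI[of _ D] exI[of _ "\<lambda>c. 0 \<le> q c"]) simp
qed

end

section \<open>Input and output\<close>

lemma nth_concat_uniform: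
  assumes "\<And>ys. ys \<in> set yss \<Longrightarrow> length ys = l" "i < length yss" "j < l"
  shows "concat yss ! (i * l + j) = yss ! i ! j"
  using assms
proof (induction yss arbitrary: i)
  case (Cons ys yss)
  show ?case
  proof (cases i)
    case 0
    then show ?thesis using Cons.prems by (simp add: nth_append)
  next
    case (Suc k)
    have "length ys = l" using Cons.prems by simp
    then show ?thesis using Cons.IH[of k] Cons.prems Suc by (simp add: nth_append)
  qed
qed simp

lemma length_concat_uniform:
  assumes "\<And>ys. ys \<in> set yss \<Longrightarrow> length ys = l"
  shows "length (concat yss) = length yss * l"
  using assms by (induction yss) auto

lemma enc_input_nth:
  fixes d :: "nat \<Rightarrow> nat \<Rightarrow> rat"
  assumes n: "F \<union> C = {..<n}" and xs: "xs = enc_input F C d T \<epsilon>"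
  shows "xs ! 0 = int n" "xs ! 1 = fst (quotient_of T)" "xs ! 2 = snd (quotient_of T)"
    "v < n \<Longrightarrow> xs ! (5 + v) = of_bool (v \<in> F)"
    "v < n \<Longrightarrow> xs ! (5 + n + v) = of_bool (v \<in> C)"
    "u < n \<Longrightarrow> v < n \<Longrightarrow> xs ! (5 + 2 * n + 2 * (u * n + v)) = fst (quotient_of (d u v))"
    "u < n \<Longrightarrow> v < n \<Longrightarrow> xs ! (6 + 2 * n + 2 * (u * n + v)) = snd (quotient_of (d u v))"
    "length xs = 5 + 2 * n + 2 * (n * n)"
proof -
  define Fs where "Fs = map (\<lambda>v. of_bool (v \<in> F) :: int) [0..<n]"
  define Cs where "Cs = map (\<lambda>v. of_bool (v \<in> C) :: int) [0..<n]"
  define row where "row u = concat (map (\<lambda>v. enc_rat (d u v)) [0..<n])" for u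
  define Ds where "Ds = concat (map row [0..<n])"
  define hd where "hd = [int n] @ enc_rat T @ enc_rat \<epsilon>"
  have eq: "xs = hd @ Fs @ Cs @ Ds"
    by (simp add: xs enc_input_def n Fs_def Cs_def row_def[abs_def] Ds_def hd_def)
  have len: "length hd = 5" "length Fs = n" "length Cs = n"
    by (simp_all add: hd_def enc_rat_def Fs_def Cs_def)
  have row_len: "length (row u) = 2 * n" for u
    unfolding row_def by (subst length_concat_uniform[of _ 2]) (auto simp: enc_rat_def)
  have row_nth: "row u ! (v * 2 + b) = enc_rat (d u v) ! b" if "v < n" "b < 2" for u v b
    unfolding row_def using that by (subst nth_concat_uniform[of _ 2]) (auto simp: enc_rat_def)
  have Ds_nth: "Ds ! (2 * (u * n + v) + b) = enc_rat (d u v) ! b" if "u < n" "v < n" "b < 2" for u v b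
  proof -
    have "2 * (u * n + v) + b = u * (2 * n) + (v * 2 + b)" by (simp add: algebra_simps)
    then have "Ds ! (2 * (u * n + v) + b) = row u ! (v * 2 + b)"
      unfolding Ds_def using that row_len by (simp only:) (subst nth_concat_uniform[of _ "2 * n"], auto)
    then show ?thesis using row_nth that by simp
  qed
  show "xs ! 0 = int n" "xs ! 1 = fst (quotient_of T)" "xs ! 2 = snd (quotient_of T)"
    by (simp_all add: eq hd_def enc_rat_def numeral_2_eq_2)
  show "v < n \<Longrightarrow> xs ! (5 + v) = of_bool (v \<in> F)"
    using len by (simp add: eq nth_append) (simp add: Fs_def)
  show "v < n \<Longrightarrow> xs ! (5 + n + v) = of_bool (v \<in> C)"
    using len by (simp add: eq nth_append) (simp add: Cs_def)
  have tail: "xs ! (5 + 2 * n + j) = Ds ! j" for j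
    using len by (simp add: eq nth_append)
  show "xs ! (5 + 2 * n + 2 * (u * n + v)) = fst (quotient_of (d u v))" if "u < n" "v < n"
    using tail[of "2 * (u * n + v)"] Ds_nth[of u v 0] that by (simp add: enc_rat_def)
  show "xs ! (6 + 2 * n + 2 * (u * n + v)) = snd (quotient_of (d u v))" if "u < n" "v < n"
    using tail[of "2 * (u * n + v) + 1"] Ds_nth[of u v 1] that by (simp add: enc_rat_def add.assoc)
  have "length Ds = n * (2 * n)"
    unfolding Ds_def by (subst length_concat_uniform[of _ "2 * n"]) (auto simp: row_len)
  then show "length xs = 5 + 2 * n + 2 * (n * n)" using len by (simp add: eq)
qed

text \<open>The scaling factor \<open>e\<close> is a multiple of every denominator, so all divisions
  are exact. Only \<open>m\<close>, the part that collects the denominators of the distances, is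
  left unspecified.\<close>

lemma run_scale_instance:
  fixes n :: int
  assumes n: "s Size 0 = n" "0 \<le> n" and td: "0 < s IO 2"
    and dd: "\<And>k. 0 \<le> k \<Longrightarrow> k < n * n \<Longrightarrow> 0 < s IO (2 * (n + k) + 6)"
    and t: "t = run scale_instance s"
  shows "\<exists>m\<ge>1. \<exists>e. e = (2 * n + 1) * s IO 2 * m \<and> t Size 0 = n \<and> t Thr 0 = e * s IO 1 div s IO 2 \<and>
    (\<forall>v. 0 \<le> v \<longrightarrow> v < n \<longrightarrow> t IsFac v = s IO (v + 5) \<and> t IsCli v = s IO (n + v + 5)) \<and>
    (\<forall>k. 0 \<le> k \<longrightarrow> k < n * n \<longrightarrow> s IO (2 * (n + k) + 6) dvd e \<and>
      t Dist k = e * s IO (2 * (n + k) + 5) div s IO (2 * (n + k) + 6))"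
proof -
  define den where "den k = s IO (2 * (n + k) + 6)" for k
  define c1 where "c1 = Scale Den (Lit 0) (V Den)
         (Op Add (Op Mul (Lit 2) (Op Add (V Size) (V I0))) (Lit 6))"
  define s1 where "s1 = upd (upd s Den 0 (2 * n + 1)) Den 0 ((2 * n + 1) * s IO 2)"
  define s2 where "s2 = run (For I0 (Op Mul (V Size) (V Size)) c1) s1"
  define Q2 where "Q2 i u \<longleftrightarrow> (\<exists>m\<ge>1. u Den 0 = (2 * n + 1) * s IO 2 * m \<and>
      (\<forall>k. 0 \<le> k \<longrightarrow> k < i \<longrightarrow> den k dvd m))" for i and u :: state
  have "Q2 (n * n) s2"
    unfolding s2_def
  proof (rule run_For_induct)
    fix i u assume i: "0 \<le> i" "i < n * n" "u I0 0 = i" and Q: "Q2 i u"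
      and fr: "\<And>y. y \<noteq> I0 \<Longrightarrow> y \<notin> mods c1 \<Longrightarrow> u y = s1 y"
    have u: "u IO = s IO" "u Size 0 = n" using fr n by (simp_all add: c1_def s1_def upd_apply)
    obtain m where m: "1 \<le> m" "u Den 0 = (2 * n + 1) * s IO 2 * m"
      "\<And>k. 0 \<le> k \<Longrightarrow> k < i \<Longrightarrow> den k dvd m"
      using Q unfolding Q2_def by blast
    have "0 < den i" using dd i by (simp add: den_def)
    then have "1 \<le> m * den i" using m(1) by (simp add: int_one_le_iff_zero_less)
    moreover have "run c1 u = upd u Den 0 ((2 * n + 1) * s IO 2 * (m * den i))"
      using i n u m(2) by (simp add: c1_def den_def mult.assoc)
    ultimately show "Q2 (i + 1) (upd (run c1 u) I0 0 (i + 1))"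
      unfolding Q2_def using m(3)
      by (intro exI[of _ "m * den i"])
        (auto simp: upd_apply zless_add1_eq simp del: zle_add1_eq_le)
  next
    show "Q2 0 (upd s1 I0 0 0)" by (auto simp: Q2_def upd_apply s1_def intro!: exI[of _ 1])
  qed (use n in \<open>simp_all add: c1_def s1_def upd_apply\<close>)
  then obtain m where m: "1 \<le> m" "s2 Den 0 = (2 * n + 1) * s IO 2 * m"
      "\<And>k. 0 \<le> k \<Longrightarrow> k < n * n \<Longrightarrow> den k dvd m"
    unfolding Q2_def by blast
  define e where "e = (2 * n + 1) * s IO 2 * m"
  have s2: "s2 IO = s IO" "s2 Size 0 = n"
    using n by (simp_all add: s2_def run_unmodified c1_def s1_def upd_apply)
  define s3 where "s3 = upd (upd (upd s2 Thr 0 (e * s IO 1)) Tmp 0 (s IO 2)) Thr 0 (e * s IO 1 div s IO 2)"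
  define c4 where "c4 = block
       [Scale IsFac (V I0) (Lit 1) (Op Add (V I0) (Lit 5)),
        Scale IsCli (V I0) (Lit 1) (Op Add (Op Add (V Size) (V I0)) (Lit 5))]"
  define s4 where "s4 = run (For I0 (V Size) c4) s3"
  define Q4 where "Q4 i u \<longleftrightarrow> (\<forall>v. 0 \<le> v \<longrightarrow> v < i \<longrightarrow> u IsFac v = s IO (v + 5) \<and> u IsCli v = s IO (n + v + 5))"
    for i and u :: state
  have Q4: "Q4 n s4"
    unfolding s4_def
  proof (rule run_For_induct)
    fix i u assume i: "0 \<le> i" "i < n" "u I0 0 = i" and Q: "Q4 i u"
      and fr: "\<And>y. y \<noteq> I0 \<Longrightarrow> y \<notin> mods c4 \<Longrightarrow> u y = s3 y"
    have "u IO = s IO" "u Size 0 = n" using fr n s2 by (simp_all add: c4_def s3_def upd_apply)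
    then show "Q4 (i + 1) (upd (run c4 u) I0 0 (i + 1))"
      using Q i n by (simp add: Q4_def c4_def upd_apply)
  qed (use n s2 in \<open>simp_all add: c4_def s3_def upd_apply Q4_def\<close>)
  have s4: "s4 IO = s IO" "s4 Size 0 = n" "s4 Den 0 = e" "s4 Thr 0 = e * s IO 1 div s IO 2"
    using s2 m(2) by (simp_all add: s4_def run_unmodified c4_def s3_def upd_apply e_def)
  define c5 where "c5 = block
       [Scale Dist (V I0) (V Den) (Op Add (Op Mul (Lit 2) (Op Add (V Size) (V I0))) (Lit 5)),
        Scale Tmp (Lit 0) (Lit 1) (Op Add (Op Mul (Lit 2) (Op Add (V Size) (V I0))) (Lit 6)),
        Put Dist (V I0) (Op Div (Arr Dist (V I0)) (V Tmp))]"
  have t5: "t = run (For I0 (Op Mul (V Size) (V Size)) c5) s4"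
    using n s2 m(2)[folded e_def] unfolding t scale_instance_def block.simps run.simps(1-6)
    by (simp add: s1_def[symmetric] c1_def[symmetric] s2_def[symmetric] upd_apply e_def[symmetric]
        s3_def[symmetric] c4_def[symmetric, unfolded block.simps] s4_def[symmetric]
        c5_def[symmetric, unfolded block.simps])
  define Q5 where "Q5 i u \<longleftrightarrow> (\<forall>k. 0 \<le> k \<longrightarrow> k < i \<longrightarrow>
      u Dist k = e * s IO (2 * (n + k) + 5) div s IO (2 * (n + k) + 6))" for i and u :: state
  have "Q5 (n * n) t"
    unfolding t5
  proof (rule run_For_induct)
    fix i u assume i: "0 \<le> i" "i < n * n" "u I0 0 = i" and Q: "Q5 i u"
      and fr: "\<And>y. y \<noteq> I0 \<Longrightarrow> y \<notin> mods c5 \<Longrightarrow> u y = s4 y"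
    have "u IO = s IO" "u Size 0 = n" "u Den 0 = e" using fr s4 by (simp_all add: c5_def)
    then show "Q5 (i + 1) (upd (run c5 u) I0 0 (i + 1))"
      using Q i n by (simp add: Q5_def c5_def upd_apply)
  qed (use n s4 in \<open>simp_all add: c5_def Q5_def\<close>)
  moreover have "t Size 0 = n" "t Thr 0 = e * s IO 1 div s IO 2" "t IsFac = s4 IsFac" "t IsCli = s4 IsCli"
    using s4 by (simp_all add: t5 run_unmodified c5_def)
  moreover have "den k dvd e" if "0 \<le> k" "k < n * n" for k
    using m(3)[OF that] by (simp add: e_def)
  ultimately show ?thesis
    using m(1) Q4 by (intro exI[of _ m] exI[of _ e]) (auto simp: e_def[symmetric] Q4_def Q5_def den_def)
qed

lemma scaled_quotient:
  assumes q: "quotient_of q = (a, b)" and b: "b dvd e"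
  shows "real_of_int (e * a div b) = real_of_rat q * real_of_int e"
proof -
  have pos: "0 < b" using q by (rule quotient_of_denom_pos)
  obtain c where c: "e = b * c" using b by (rule dvdE)
  have "e * a div b = c * a" using pos by (simp add: c)
  moreover have "real_of_rat q = real_of_int a / real_of_int b"
    using quotient_of_div[OF q] by (simp add: of_rat_divide)
  ultimately show ?thesis using pos by (simp add: c)
qed

lemma positive_numerator: "0 < q \<Longrightarrow> 0 < fst (quotient_of q)"
proof -
  assume q: "0 < q"
  obtain a b where ab: "quotient_of q = (a, b)" by (cases "quotient_of q")
  have "q = of_int a / of_int b" "0 < b"
    using ab by (rule quotient_of_div, rule quotient_of_denom_pos)
  then show ?thesis using q ab by (simp add: zero_less_divide_iff)
qed

text \<open>Each client chooses a star that contains it. Distinct stars have distinct facilities, so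
  all clients assigned to \<open>f\<close> lie in a single star and its load bounds theirs.\<close>

lemma star_cover_assignment:
  assumes S: "star_cover F C S" and load: "cover_load d S \<le> T" and T: "0 \<le> T" and fin: "finite C"
    and nonneg: "\<And>f c. f \<in> F \<Longrightarrow> c \<in> C \<Longrightarrow> 0 \<le> d f c"
  obtains \<phi> where "\<And>c. c \<in> C \<Longrightarrow> \<phi> c \<in> F" "\<And>f. (\<Sum>c | c \<in> C \<and> \<phi> c = f. d f c) \<le> T"
    "card (\<phi> ` C) \<le> card S"
proof -
  have finS: "finite S" and FC: "\<And>f A. (f, A) \<in> S \<Longrightarrow> f \<in> F \<and> A \<subseteq> C"
    and disj: "\<And>s t. s \<in> S \<Longrightarrow> t \<in> S \<Longrightarrow> s \<noteq> t \<Longrightarrow> disjoint_stars s t"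
    and cov: "C \<subseteq> (\<Union>(f, A)\<in>S. A)"
    using S by (auto simp: star_cover_def pairwise_def)
  have "\<forall>c\<in>C. \<exists>s. s \<in> S \<and> c \<in> snd s" using cov by fastforce
  then obtain \<sigma> where \<sigma>: "\<And>c. c \<in> C \<Longrightarrow> \<sigma> c \<in> S \<and> c \<in> snd (\<sigma> c)" by metis
  show ?thesis
  proof (rule that[of "\<lambda>c. fst (\<sigma> c)"])
    show "fst (\<sigma> c) \<in> F" if "c \<in> C" for c
      using \<sigma>[OF that] FC[of "fst (\<sigma> c)" "snd (\<sigma> c)"] by simp
    have "(\<lambda>c. fst (\<sigma> c)) ` C \<subseteq> fst ` S" using \<sigma> by auto
    then have "card ((\<lambda>c. fst (\<sigma> c)) ` C) \<le> card (fst ` S)"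
      using finS by (intro card_mono) auto
    also have "\<dots> \<le> card S" using finS by (rule card_image_le)
    finally show "card ((\<lambda>c. fst (\<sigma> c)) ` C) \<le> card S" .
    fix f
    show "(\<Sum>c | c \<in> C \<and> fst (\<sigma> c) = f. d f c) \<le> T"
    proof (cases "{c. c \<in> C \<and> fst (\<sigma> c) = f} = {}")
      case True
      then show ?thesis using T by (simp only: sum.empty)
    next
      case False
      then obtain c0 where c0: "c0 \<in> C" "fst (\<sigma> c0) = f" by auto
      define s where "s = \<sigma> c0"
      have s: "s \<in> S" "fst s = f" "snd s \<subseteq> C" "f \<in> F"
        using \<sigma>[OF c0(1)] c0(2) FC[of "fst s" "snd s"] by (auto simp: s_def)
      have "(\<Sum>c | c \<in> C \<and> fst (\<sigma> c) = f. d f c) \<le> (\<Sum>c\<in>snd s. d f c)"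
      proof (rule sum_mono2)
        show "finite (snd s)" using s(3) fin finite_subset by blast
        show "{c. c \<in> C \<and> fst (\<sigma> c) = f} \<subseteq> snd s"
        proof
          fix c assume c: "c \<in> {c. c \<in> C \<and> fst (\<sigma> c) = f}"
          then have "\<sigma> c = s" using disj[of "\<sigma> c" s] \<sigma>[of c] s by (auto simp: disjoint_stars_def)
          then show "c \<in> snd s" using \<sigma>[of c] c by auto
        qed
      qed (use s nonneg in auto)
      also have "\<dots> = star_load d s" by (simp add: star_load_def s(2))
      also have "\<dots> \<le> cover_load d S" using s(1) finS by (auto simp: cover_load_def)
      finally show ?thesis using load by simp
    qed
  qed
qed


lemma input_size_ge_length: "length xs \<le> input_size xs"
proof (induction xs)
  case (Cons x xs)
  then show ?case using bits_pos[of x] by (simp add: input_size_def)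
qed (simp add: input_size_def)

section \<open>Reducing a rational instance to an integral one\<close>

locale ms_input =
  fixes F C :: "nat set" and d :: "nat \<Rightarrow> nat \<Rightarrow> rat" and T \<epsilon> :: rat and n :: nat
    and xs :: "int list" and s t :: state
  assumes inst: "ms_instance F C d T" and n: "F \<union> C = {..<n}"
    and xs: "xs = enc_input F C d T \<epsilon>"
    and s: "s = upd (view (input_memory xs)) Size 0 (hd xs)"
    and t: "t = run scale_instance s"
begin

sublocale M: Metric_space "{..<n}" "real_dist d"
  using inst by (simp add: ms_instance_def n)

lemma T_nonneg: "0 \<le> T"
  using inst by (simp add: ms_instance_def)

lemma FCn: "F \<subseteq> {..<n}" "C \<subseteq> {..<n}"
  unfolding n[symmetric] by auto

lemmas nth = enc_input_nth[OF n xs]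

lemma xs_hd: "xs \<noteq> []" "hd xs = int n" "int n \<le> int (input_size xs)"
proof -
  show "xs \<noteq> []" using nth(8) by auto
  then show "hd xs = int n" using nth(1) by (simp add: hd_conv_nth)
  show "int n \<le> int (input_size xs)" using nth(8) input_size_ge_length[of xs] by linarith
qed

lemma IO_nth: "k < length xs \<Longrightarrow> s IO (int k) = xs ! k"
  by (simp add: s upd_apply view_input_memory) (simp add: input_memory_def)

definition point_dist :: "int \<Rightarrow> int \<Rightarrow> int" where
  "point_dist u v = t Dist (u * int n + v)"

lemma scaled:
  obtains e where "2 * int n + 1 \<le> e" "t Size 0 = int n"
    "real_of_int (t Thr 0) = real_of_rat T * real_of_int e"
    "0 < T \<Longrightarrow> 2 * int n \<le> t Thr 0"
    "\<And>v. v < n \<Longrightarrow> (0 < t IsFac (int v) \<longleftrightarrow> v \<in> F) \<and> (0 < t IsCli (int v) \<longleftrightarrow> v \<in> C)"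
    "\<And>u v. u < n \<Longrightarrow> v < n \<Longrightarrow>
      real_of_int (point_dist (int u) (int v)) = real_dist d u v * real_of_int e"
proof -
  have IO: "s IO 1 = fst (quotient_of T)" "s IO 2 = snd (quotient_of T)"
    using IO_nth[of 1] IO_nth[of 2] nth(2,3,8) by simp_all
  have cell: "\<exists>u v. u < n \<and> v < n \<and> k = int (u * n + v)" if k: "0 \<le> k" "k < int n * int n" for k
  proof -
    define j where "j = nat k"
    have j: "k = int j" "j < n * n" using k by (auto simp: j_def nat_less_iff)
    then have "0 < n" by (cases n) auto
    then show ?thesis using j
      by (intro exI[of _ "j div n"] exI[of _ "j mod n"]) (auto simp: less_mult_imp_div_less)
  qed
  have less: "u * n + v < n * n" if "u < n" "v < n" for u v
  proof -
    have "u * n + v < Suc u * n" using that by simp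
    also have "\<dots> \<le> n * n" using that by (intro mult_right_mono) auto
    finally show ?thesis .
  qed
  have num: "s IO (2 * (int n + int (u * n + v)) + 5) = fst (quotient_of (d u v))"
    and den: "s IO (2 * (int n + int (u * n + v)) + 6) = snd (quotient_of (d u v))"
    if "u < n" "v < n" for u v
    using IO_nth[of "5 + 2 * n + 2 * (u * n + v)"] IO_nth[of "6 + 2 * n + 2 * (u * n + v)"]
      nth(6,7)[OF that] nth(8) less[OF that] by (simp_all add: algebra_simps)
  have "0 < s IO (2 * (int n + k) + 6)" if k: "0 \<le> k" "k < int n * int n" for k
  proof -
    obtain u v where uv: "u < n" "v < n" "k = int (u * n + v)" using cell[OF k] by blast
    show ?thesis unfolding uv(3) den[OF uv(1,2)] by (rule quotient_of_denom_pos')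
  qed
  moreover have "0 < s IO 2" unfolding IO by (rule quotient_of_denom_pos')
  moreover have "s Size 0 = int n" using xs_hd by (simp add: s upd_apply)
  ultimately obtain m e where m: "1 \<le> m" "e = (2 * int n + 1) * s IO 2 * m" "t Size 0 = int n"
      "t Thr 0 = e * s IO 1 div s IO 2"
    and v: "\<And>v. 0 \<le> v \<Longrightarrow> v < int n \<Longrightarrow> t IsFac v = s IO (v + 5) \<and> t IsCli v = s IO (int n + v + 5)"
    and k: "\<And>k. 0 \<le> k \<Longrightarrow> k < int n * int n \<Longrightarrow> s IO (2 * (int n + k) + 6) dvd e \<and>
      t Dist k = e * s IO (2 * (int n + k) + 5) div s IO (2 * (int n + k) + 6)"
    using run_scale_instance[of s "int n" t] t by auto
  have pos: "0 < s IO 2" unfolding IO by (rule quotient_of_denom_pos')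
  have e_ge: "2 * int n + 1 \<le> e"
  proof -
    have "1 \<le> s IO 2 * m" using pos m(1) by (simp add: int_one_le_iff_zero_less)
    then have "(2 * int n + 1) * 1 \<le> (2 * int n + 1) * (s IO 2 * m)" by (intro mult_left_mono) auto
    then show ?thesis by (simp add: m(2) mult.assoc)
  qed
  show ?thesis
  proof (rule that[OF e_ge m(3)])
    show Thr: "real_of_int (t Thr 0) = real_of_rat T * real_of_int e"
      unfolding m(4) using IO m(2) by (intro scaled_quotient) auto
    show "2 * int n \<le> t Thr 0" if "0 < T"
    proof -
      have "0 < s IO 1"
        using that by (simp add: IO positive_numerator)
      \<comment> \<open>The denominator of the threshold cancels; its numerator is a positive
        integer, so the factor \<open>2 * n + 1\<close> survives.\<close>
      have "t Thr 0 = (2 * int n + 1) * (m * s IO 1)"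
        unfolding m(4,2) using pos by (simp add: mult.assoc mult.left_commute[of _ "s IO 2"])
      moreover have "1 \<le> m * s IO 1" using \<open>0 < s IO 1\<close> m(1) by (simp add: int_one_le_iff_zero_less)
      then have "(2 * int n + 1) * 1 \<le> (2 * int n + 1) * (m * s IO 1)" by (intro mult_left_mono) auto
      ultimately have "(2 * int n + 1) * 1 \<le> t Thr 0" by simp
      then show ?thesis by simp
    qed
    show "(0 < t IsFac (int v) \<longleftrightarrow> v \<in> F) \<and> (0 < t IsCli (int v) \<longleftrightarrow> v \<in> C)" if "v < n" for v
    proof -
      have "s IO (int v + 5) = of_bool (v \<in> F)" "s IO (int n + int v + 5) = of_bool (v \<in> C)"
        using IO_nth[of "5 + v"] IO_nth[of "5 + n + v"] nth(4,5)[OF that] nth(8) that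
        by (simp_all add: add_ac)
      then show ?thesis using v[of "int v"] that by simp
    qed
    show "real_of_int (point_dist (int u) (int v)) = real_dist d u v * real_of_int e"
      if "u < n" "v < n" for u v
    proof -
      have "int (u * n + v) < int n * int n" using less[OF that] by (metis of_nat_less_iff of_nat_mult)
      then have "point_dist (int u) (int v) = e * fst (quotient_of (d u v)) div snd (quotient_of (d u v))"
        and "snd (quotient_of (d u v)) dvd e"
        using k[of "int (u * n + v)"] num[OF that] den[OF that] by (simp_all add: point_dist_def)
      then show ?thesis unfolding real_dist_def by (simp add: scaled_quotient)
    qed
  qed
qed

lemma integral: "integral_instance (int n) (t Thr 0) (int ` F) (int ` C) point_dist"
  and env: "integral_instance.env (int n) (t Thr 0) (int ` F) (int ` C) point_dist t"
proof -
  obtain e where e: "2 * int n + 1 \<le> e" "t Size 0 = int n"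
    "real_of_int (t Thr 0) = real_of_rat T * real_of_int e"
    "\<And>v. v < n \<Longrightarrow> (0 < t IsFac (int v) \<longleftrightarrow> v \<in> F) \<and> (0 < t IsCli (int v) \<longleftrightarrow> v \<in> C)"
    and dist: "\<And>u v. u < n \<Longrightarrow> v < n \<Longrightarrow>
      real_of_int (point_dist (int u) (int v)) = real_dist d u v * real_of_int e"
    by (rule scaled) blast
  have e_pos: "0 < real_of_int e" using e(1) by linarith
  note FC = FCn
  have pt: "\<exists>u<n. x = int u" if "x \<in> {0..<int n}" for x
    using that by (intro exI[of _ "nat x"]) auto
  show *: "integral_instance (int n) (t Thr 0) (int ` F) (int ` C) point_dist"
  proof
    show "0 \<le> t Thr 0"
      using e(3) e_pos T_nonneg by (metis mult_nonneg_nonneg of_int_0_le_iff less_imp_le zero_le_of_rat_iff)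
    show "int ` F \<subseteq> {0..<int n}" "int ` C \<subseteq> {0..<int n}" using FC by auto
    fix x y z assume x: "x \<in> {0..<int n}"
    obtain u where u: "u < n" "x = int u" using pt[OF x] by blast
    have "real_of_int (point_dist x x) = 0" using dist[OF u(1) u(1)] u M.zero[of u u] by simp
    then show "point_dist x x = 0" by simp
    assume y: "y \<in> {0..<int n}"
    obtain v where v: "v < n" "y = int v" using pt[OF y] by blast
    have "0 \<le> real_of_int (point_dist x y)" using dist[OF u(1) v(1)] u v e_pos by simp
    then show "0 \<le> point_dist x y" by simp
    have "real_of_int (point_dist x y) = real_of_int (point_dist y x)"
      using dist[OF u(1) v(1)] dist[OF v(1) u(1)] u v M.commute[of u v] by simp
    then show "point_dist x y = point_dist y x" by simp
    assume z: "z \<in> {0..<int n}"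
    obtain w where w: "w < n" "z = int w" using pt[OF z] by blast
    have "real_dist d u w \<le> real_dist d u v + real_dist d v w"
      using u v w by (intro M.triangle) auto
    then have "real_dist d u w * real_of_int e \<le> (real_dist d u v + real_dist d v w) * real_of_int e"
      using e_pos by (intro mult_right_mono) auto
    then have "real_of_int (point_dist x z) \<le> real_of_int (point_dist x y + point_dist y z)"
      using dist u v w by (simp add: distrib_right)
    then show "point_dist x z \<le> point_dist x y + point_dist y z" by (simp only: of_int_le_iff)
  qed simp
  interpret integral_instance "int n" "t Thr 0" "int ` F" "int ` C" point_dist by fact
  show "integral_instance.env (int n) (t Thr 0) (int ` F) (int ` C) point_dist t"
    unfolding env_def
  proof (intro conjI allI impI)
    fix v assume "0 \<le> v" "v < int n"
    then obtain v' where "v' < n" "v = int v'" using pt[of v] by auto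
    then show "0 < t IsFac v \<longleftrightarrow> v \<in> int ` F" "0 < t IsCli v \<longleftrightarrow> v \<in> int ` C"
      using e(4)[of v'] by auto
  qed (use e(2) in \<open>simp_all add: point_dist_def\<close>)
qed

lemma cover_found:
  assumes cov: "coverable F C (real_dist d) (real_of_rat T)"
    and u: "u = run (Then solve write_stars) t"
  shows "\<exists>ss. (\<forall>i < length (enc_stars ss). u IO (int i) = enc_stars ss ! i) \<and>
    star_cover F C ((\<lambda>(f, cs). (f, set cs)) ` set ss) \<and>
    cover_load (real_dist d) ((\<lambda>(f, cs). (f, set cs)) ` set ss) \<le> 2 * real_of_rat T \<and>
    card ((\<lambda>(f, cs). (f, set cs)) ` set ss) \<le> 63 * OPT_MS F C (real_dist d) (real_of_rat T)"
proof -
  interpret integral_instance "int n" "t Thr 0" "int ` F" "int ` C" point_dist by (rule integral)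
  obtain e where e: "2 * int n + 1 \<le> e"
    "real_of_int (t Thr 0) = real_of_rat T * real_of_int e"
    "0 < T \<Longrightarrow> 2 * int n \<le> t Thr 0"
    and dist: "\<And>u v. u < n \<Longrightarrow> v < n \<Longrightarrow>
      real_of_int (point_dist (int u) (int v)) = real_dist d u v * real_of_int e"
    by (rule scaled) blast
  have e_pos: "0 < real_of_int e" using e(1) by linarith
  have finC: "finite C" using FCn finite_subset by blast
  have "\<exists>S. star_cover F C S \<and> cover_load (real_dist d) S \<le> real_of_rat T \<and>
      card S = OPT_MS F C (real_dist d) (real_of_rat T)"
    unfolding OPT_MS_def by (rule LeastI_ex) (use cov in \<open>auto simp: coverable_def\<close>)
  then obtain S where S: "star_cover F C S" "cover_load (real_dist d) S \<le> real_of_rat T"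
    "card S = OPT_MS F C (real_dist d) (real_of_rat T)" by blast
  obtain \<phi> where \<phi>: "\<And>c. c \<in> C \<Longrightarrow> \<phi> c \<in> F"
      "\<And>f. (\<Sum>c | c \<in> C \<and> \<phi> c = f. real_dist d f c) \<le> real_of_rat T"
      "card (\<phi> ` C) \<le> OPT_MS F C (real_dist d) (real_of_rat T)"
    using star_cover_assignment[OF S(1,2) _ finC] S(3) T_nonneg M.nonneg by force
  define opt where "opt c = int (\<phi> (nat c))" for c
  have opt_image: "opt ` int ` C = int ` \<phi> ` C" by (auto simp: opt_def image_iff)
  have card_opt: "card (opt ` int ` C) \<le> OPT_MS F C (real_dist d) (real_of_rat T)"
    unfolding opt_image using \<phi>(3) by (simp add: card_image)
  have sum_int: "real_of_int (\<Sum>c | c \<in> int ` C \<and> D c = int f. point_dist (int f) c) =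
      (\<Sum>c | c \<in> C \<and> D (int c) = int f. real_dist d f c) * real_of_int e" if "f < n" for D f
  proof -
    have "{c. c \<in> int ` C \<and> D c = int f} = int ` {c. c \<in> C \<and> D (int c) = int f}" by auto
    then have "real_of_int (\<Sum>c | c \<in> int ` C \<and> D c = int f. point_dist (int f) c) =
        (\<Sum>c | c \<in> C \<and> D (int c) = int f. real_of_int (point_dist (int f) (int c)))"
      by (simp add: sum.reindex)
    also have "\<dots> = (\<Sum>c | c \<in> C \<and> D (int c) = int f. real_dist d f c * real_of_int e)"
      using that FCn by (intro sum.cong refl dist) auto
    finally show ?thesis by (simp add: sum_distrib_right)
  qed
  have "feasible opt"
    unfolding feasible_def
  proof (intro conjI ballI)
    show "opt c \<in> int ` F" if "c \<in> int ` C" for c using that \<phi>(1) by (auto simp: opt_def)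
    fix f assume "f \<in> int ` F"
    then obtain f' where f': "f' < n" "f = int f'" using FCn by auto
    have "(\<Sum>c | c \<in> C \<and> opt (int c) = int f'. real_dist d f' c) \<le> real_of_rat T"
      using \<phi>(2)[of f'] by (simp add: opt_def)
    then have "(\<Sum>c | c \<in> C \<and> opt (int c) = int f'. real_dist d f' c) * real_of_int e \<le> real_of_int (t Thr 0)"
      unfolding e(2) using e_pos by (intro mult_right_mono) auto
    then show "(\<Sum>c | c \<in> int ` C \<and> opt c = f. point_dist f c) \<le> t Thr 0"
      unfolding f'(2) sum_int[OF f'(1), symmetric] by (simp only: of_int_le_iff)
  qed
  then obtain D P where D: "\<And>c. c \<in> int ` C \<Longrightarrow> D c \<in> int ` F"
      "\<And>x. (\<Sum>c | c \<in> int ` C \<and> D c = x. point_dist x c) \<le> 2 * t Thr 0"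
      "0 < t Thr 0 \<Longrightarrow> 2 * int n \<le> t Thr 0 \<Longrightarrow> card (D ` int ` C) \<le> 63 * card (opt ` int ` C)"
    and P: "\<And>c. 0 \<le> c \<Longrightarrow> c < int n \<Longrightarrow> P c \<longleftrightarrow> c \<in> int ` C"
    and out: "\<forall>i < length (enc_stars (star_list P D n n)). u IO (int i) = enc_stars (star_list P D n n) ! i"
    using run_solve[OF env u, of opt n] by auto
  define stars where "stars = (\<lambda>(f, cs). (f, set cs)) ` set (star_list P D n n)"
  define A where "A x = {c \<in> C. D (int c) = int x}" for x
  have clients: "set (clients_of P D (int x) n) = A x" for x
    using P FCn by (auto simp: clients_of_def A_def)
  then have nonempty: "clients_of P D (int x) n \<noteq> [] \<longleftrightarrow> A x \<noteq> {}" for x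
    by (metis set_empty)
  have stars: "stars = (\<lambda>x. (x, A x)) ` {x. x < n \<and> A x \<noteq> {}}"
    unfolding stars_def star_list_def by (auto simp: nonempty clients image_iff)
  have facility: "x \<in> F" if "A x \<noteq> {}" for x using that D(1) by (fastforce simp: A_def)
  have cover: "star_cover F C stars"
    unfolding star_cover_def
  proof (intro conjI)
    show "finite stars" by (simp add: stars)
    show "\<forall>(f, B)\<in>stars. f \<in> F \<and> B \<subseteq> C" using facility by (auto simp: stars A_def)
    show "pairwise disjoint_stars stars"
      by (auto simp: pairwise_def disjoint_stars_def stars A_def)
    show "C \<subseteq> (\<Union>(f, B)\<in>stars. B)"
    proof
      fix c assume c: "c \<in> C"
      then obtain x where x: "x \<in> F" "D (int c) = int x" using D(1) by blast
      then have "c \<in> A x" "x < n" using c FCn by (auto simp: A_def)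
      then show "c \<in> (\<Union>(f, B)\<in>stars. B)" by (force simp: stars)
    qed
  qed
  have load: "cover_load (real_dist d) stars \<le> 2 * real_of_rat T"
  proof -
    have "star_load (real_dist d) (x, A x) \<le> 2 * real_of_rat T" if "x < n" for x
    proof -
      have "real_of_int (\<Sum>c | c \<in> int ` C \<and> D c = int x. point_dist (int x) c) \<le> real_of_int (2 * t Thr 0)"
        using D(2)[of "int x"] by (simp only: of_int_le_iff)
      then have "star_load (real_dist d) (x, A x) * real_of_int e \<le> 2 * real_of_rat T * real_of_int e"
        unfolding sum_int[OF that] by (simp add: e(2) star_load_def A_def)
      then show ?thesis using e_pos by simp
    qed
    moreover have "finite stars" by (simp add: stars)
    ultimately show ?thesis using T_nonneg by (auto simp: cover_load_def stars)
  qed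
  have "card stars \<le> card (D ` int ` C)"
  proof (rule card_inj_on_le)
    show "inj_on (\<lambda>s. int (fst s)) stars" by (auto simp: stars inj_on_def)
    show "(\<lambda>s. int (fst s)) ` stars \<subseteq> D ` int ` C" by (force simp: stars A_def)
  qed (simp add: finC)
  also have "\<dots> \<le> 63 * OPT_MS F C (real_dist d) (real_of_rat T)"
  proof (cases "0 < T")
    case True
    then have "0 < real_of_int (t Thr 0)" unfolding e(2) using e_pos by simp
    then show ?thesis using D(3) e(3)[OF True] card_opt by simp
  next
    case False
    \<comment> \<open>For threshold 0 every client of the optimal cover is at distance 0 from its
      facility and therefore coincides with it. The optimum then has at least one star per client,
      and no assignment uses more facilities than that.\<close>
    have "\<phi> c = c" if c: "c \<in> C" for c
    proof -
      have "real_dist d (\<phi> c) c \<le> (\<Sum>x | x \<in> C \<and> \<phi> x = \<phi> c. real_dist d (\<phi> c) x)"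
        using c finC by (intro member_le_sum) auto
      also have "\<dots> \<le> 0" using \<phi>(2)[of "\<phi> c"] False T_nonneg by simp
      finally have "real_dist d (\<phi> c) c = 0" by (simp add: antisym)
      then show ?thesis using M.zero[of "\<phi> c" c] \<phi>(1)[OF c] c FCn by auto
    qed
    then have "\<phi> ` C = C" by auto
    have "card (D ` int ` C) \<le> card C" using card_image_le[of "int ` C" D] finC by (simp add: card_image)
    also have "\<dots> \<le> OPT_MS F C (real_dist d) (real_of_rat T)" using \<phi>(3) \<open>\<phi> ` C = C\<close> by simp
    finally show ?thesis by simp
  qed
  finally show ?thesis using out cover load unfolding stars_def by blast
qed

end

theorem theorem2:
  shows "\<exists>(A :: com) (K :: real).
    poly_time_on A {enc_input F C d T \<epsilon> | F C d T \<epsilon>. ms_instance F C d T \<and> 0 < \<epsilon> \<and> \<epsilon> < 1} \<and>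
    (\<forall>F C d T \<epsilon>. ms_instance F C d T \<and> 0 < \<epsilon> \<and> \<epsilon> < 1 \<and>
        coverable F C (real_dist d) (real_of_rat T) \<longrightarrow>
      (\<exists>S. outputs_stars A (enc_input F C d T \<epsilon>) S \<and>
           star_cover F C S \<and>
           cover_load (real_dist d) S \<le> (2 + real_of_rat \<epsilon>) * real_of_rat T \<and>
           real (card S) \<le> K * real (OPT_MS F C (real_dist d) (real_of_rat T)) / (real_of_rat \<epsilon>)\<^sup>2))"
proof -
  obtain p where p: "\<And>xs. xs \<noteq> [] \<Longrightarrow> 0 \<le> hd xs \<Longrightarrow> hd xs \<le> int (input_size xs) \<Longrightarrow>
    \<exists>t m. exec star_cover_program (input_memory xs) t m \<and> t \<le> poly p (input_size xs) \<and>
      view m = run (Then solve write_stars) (run scale_instance (upd (view (input_memory xs)) Size 0 (hd xs)))"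
    using program_correct[OF scale_instance_well_formed solve_write_well_formed loop_bounds]
    unfolding star_cover_program_def by blast
  have exec: "\<exists>t m. exec star_cover_program (input_memory xs) t m \<and> t \<le> poly p (input_size xs) \<and>
      view m = run (Then solve write_stars) (run scale_instance (upd (view (input_memory xs)) Size 0 (hd xs)))"
    and cover: "coverable F C (real_dist d) (real_of_rat T) \<Longrightarrow>
      \<exists>S. outputs_stars star_cover_program xs S \<and> star_cover F C S \<and>
        cover_load (real_dist d) S \<le> 2 * real_of_rat T \<and>
        card S \<le> 63 * OPT_MS F C (real_dist d) (real_of_rat T)"
    if inst: "ms_instance F C d T" and xs: "xs = enc_input F C d T \<epsilon>" for F C d T \<epsilon> xs
  proof -
    obtain n where n: "F \<union> C = {..<n}" using inst by (auto simp: ms_instance_def)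
    define s where "s = upd (view (input_memory xs)) Size 0 (hd xs)"
    define t where "t = run scale_instance s"
    interpret ms_input F C d T \<epsilon> n xs s t
      by standard (use inst n xs s_def t_def in auto)
    show exec: "\<exists>t m. exec star_cover_program (input_memory xs) t m \<and> t \<le> poly p (input_size xs) \<and>
      view m = run (Then solve write_stars) (run scale_instance (upd (view (input_memory xs)) Size 0 (hd xs)))"
      using xs_hd by (intro p) auto
    assume cov: "coverable F C (real_dist d) (real_of_rat T)"
    obtain k m where m: "exec star_cover_program (input_memory xs) k m"
        "view m = run (Then solve write_stars) t"
      using exec unfolding s_def[symmetric] t_def[symmetric] by blast
    obtain ss where ss: "\<forall>i < length (enc_stars ss). view m IO (int i) = enc_stars ss ! i"
      "star_cover F C ((\<lambda>(f, cs). (f, set cs)) ` set ss)"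
      "cover_load (real_dist d) ((\<lambda>(f, cs). (f, set cs)) ` set ss) \<le> 2 * real_of_rat T"
      "card ((\<lambda>(f, cs). (f, set cs)) ` set ss) \<le> 63 * OPT_MS F C (real_dist d) (real_of_rat T)"
      using cover_found[OF cov m(2)] by blast
    have "outputs_stars star_cover_program xs ((\<lambda>(f, cs). (f, set cs)) ` set ss)"
      unfolding outputs_stars_def using m(1) ss(1) by (auto simp: view_def)
    then show "\<exists>S. outputs_stars star_cover_program xs S \<and> star_cover F C S \<and>
        cover_load (real_dist d) S \<le> 2 * real_of_rat T \<and>
        card S \<le> 63 * OPT_MS F C (real_dist d) (real_of_rat T)"
      using ss by blast
  qed
  show ?thesis
  \<comment> \<open>The bounds \<open>2 * T\<close> and \<open>63 * OPT_MS\<close> do not depend on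
    \<epsilon>; as it lies between 0 and 1, adding it to the load factor and dividing by its square
    only weaken them.\<close>
  proof (intro exI[of _ star_cover_program] exI[of _ 63] conjI allI impI)
    show "poly_time_on star_cover_program
        {enc_input F C d T \<epsilon> | F C d T \<epsilon>. ms_instance F C d T \<and> 0 < \<epsilon> \<and> \<epsilon> < 1}"
      unfolding poly_time_on_def using exec by blast
    fix F C :: "nat set" and d :: "nat \<Rightarrow> nat \<Rightarrow> rat" and T \<epsilon> :: rat
    assume *: "ms_instance F C d T \<and> 0 < \<epsilon> \<and> \<epsilon> < 1 \<and> coverable F C (real_dist d) (real_of_rat T)"
    obtain S where S: "outputs_stars star_cover_program (enc_input F C d T \<epsilon>) S" "star_cover F C S"
      "cover_load (real_dist d) S \<le> 2 * real_of_rat T"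
      "card S \<le> 63 * OPT_MS F C (real_dist d) (real_of_rat T)"
      using cover[of F C d T _ \<epsilon>] * by blast
    have eps: "0 < real_of_rat \<epsilon>" "real_of_rat \<epsilon> \<le> 1" using * by auto
    have "0 \<le> T" using * by (simp add: ms_instance_def)
    then have "2 * real_of_rat T \<le> (2 + real_of_rat \<epsilon>) * real_of_rat T"
      using eps by (intro mult_right_mono) auto
    then have load: "cover_load (real_dist d) S \<le> (2 + real_of_rat \<epsilon>) * real_of_rat T"
      using S(3) by simp
    have "real (card S) \<le> 63 * real (OPT_MS F C (real_dist d) (real_of_rat T))"
      using S(4) by linarith
    also have "\<dots> \<le> 63 * real (OPT_MS F C (real_dist d) (real_of_rat T)) / (real_of_rat \<epsilon>)\<^sup>2"
      using eps by (intro le_divide_eq[THEN iffD2]) (auto simp: power_le_one mult_left_le)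
    finally show "\<exists>S. outputs_stars star_cover_program (enc_input F C d T \<epsilon>) S \<and> star_cover F C S \<and>
           cover_load (real_dist d) S \<le> (2 + real_of_rat \<epsilon>) * real_of_rat T \<and>
           real (card S) \<le> 63 * real (OPT_MS F C (real_dist d) (real_of_rat T)) / (real_of_rat \<epsilon>)\<^sup>2"
      using S(1,2) load by blast
  qed
qed

end
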